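(* Let $\mathsf{X}$ be a subshift over an alphabet $\mathscr{A}$, let $\mathbb{F}$ be the free group generated by $\mathscr{A}$, let $R$ be a nonzero commutative unital ring, and let $\pi:\mathbb{F}\to\widetilde{\mathcal{A}}_R(\mathsf{X})$ be the partial representation given by $\pi(g)=s_\alpha s_\beta^*$ if the reduced form of $g$ is $\alpha\beta^{-1}$ with $\alpha,\beta\in\mathcal{L}_{\mathsf{X}}$, and $\pi(g)=0$ otherwise. Consider the set of relations $$\mathcal{R}=\Big\{\sum_{i}\lambda_i\prod_j\varepsilon_{\beta_{ij}\gamma_{ij}^{-1}}:\ \sum_{i}\lambda_i\prod_{j}p_{C(\gamma_{ij},\beta_{ij})}=0\text{ in }\widetilde{\mathcal{A}}_R(\mathsf{X})\Big\}\cup\{\varepsilon_g:\pi(g)=0\},$$ where $\lambda_i\in R$, $\beta_{ij},\gamma_{ij}\in\mathcal{L}_{\mathsf{X}}$, and sums and products are finite. Then there exists an isomorphism $\Xi:R_{\operatorname{par}}(\mathbb{F},\mathcal{R})\to\widetilde{\mathcal{A}}_R(\mathsf{X})$ such that $\Xi([g])=\pi(g)$ for all $g\in\mathbb{F}$. Moreover, $\Xi$ restricts to an isomorphism between $A_{\operatorname{par}}(\mathbb{F},\mathcal{R})$ and $\widetilde{\mathcal{D}}_R(\mathsf{X})$, which is equivariant with respect to the partial actions $\theta$ and $\tau$.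
   Context: Subshifts. $\mathscr{A}$ is a non-empty set (alphabet), $\omega$ the empty word (identity of $\mathbb{F}$). A subshift $\mathsf{X}\subseteq\mathscr{A}^{\mathbb{N}}$ is the set of all sequences none of whose finite subwords lies in some given set of words. $\mathcal{L}_{\mathsf{X}}$ is the language: the set of all finite words (including $\omega$) occurring in elements of $\mathsf{X}$. For $\alpha,\beta\in\mathcal{L}_{\mathsf{X}}$, $C(\alpha,\beta)=\{\beta x\in\mathsf{X}:\alpha x\in\mathsf{X}\}$. $\mathcal{U}$ is the Boolean algebra of subsets of $\mathsf{X}$ generated by all $C(\alpha,\beta)$, $\alpha,\beta\in\mathcal{L}_{\mathsf{X}}$. Subshift algebra. $\widetilde{\mathcal{A}}_R(\mathsf{X})$ is the universal unital $R$-algebra with generators $\{p_A:A\in\mathcal{U}\}\cup\{s_a,s_a^*:a\in\mathscr{A}\}$ subject to: (i) $p_{\mathsf{X}}=1$, $p_\emptyset=0$, $p_{A\cap B}=p_Ap_B$, $p_{A\cup B}=p_A+p_B-p_{A\cap B}$ for $A,B\in\mathcal{U}$; (ii) $s_as_a^*s_a=s_a$, $s_a^*s_as_a^*=s_a^*$ for $a\in\mathscr{A}$; (iii) $s_\beta s_\alpha^*s_\alpha s_\beta^*=p_{C(\alpha,\beta)}$ for $\alpha,\beta\in\mathcal{L}_{\mathsf{X}}$, where $s_\omega=s_\omega^*=1$ and for $\alpha=\alpha_1\cdots\alpha_n$, $s_\alpha=s_{\alpha_1}\cdots s_{\alpha_n}$, $s_\alpha^*=s_{\alpha_n}^*\cdots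 s_{\alpha_1}^*$. $\widetilde{\mathcal{D}}_R(\mathsf{X})=\mathrm{span}_R\{1_{C(\alpha,\beta)}:\alpha,\beta\in\mathcal{L}_{\mathsf{X}}\}$, where $1_A$ denotes the characteristic function of $A\subseteq\mathsf{X}$; it is identified with the diagonal subalgebra $\mathrm{span}_R\{p_{C(\alpha,\beta)}:\alpha,\beta\in\mathcal{L}_{\mathsf{X}}\}$ of $\widetilde{\mathcal{A}}_R(\mathsf{X})$ via the (known) isomorphism $1_{C(\alpha,\beta)}\mapsto p_{C(\alpha,\beta)}$. Partial action $\tau$. An element of $\mathbb{F}$ is simple (with respect to $\mathsf{X}$) if its reduced form is $\alpha\beta^{-1}$ with $\alpha,\beta\in\mathcal{L}_{\mathsf{X}}$. For such an element put $\widehat\tau_{\alpha\beta^{-1}}:C(\alpha,\beta)\to C(\beta,\alpha)$, $\beta x\mapsto\alpha x$; let $D_{\alpha\beta^{-1}}$ be the ideal of $\widetilde{\mathcal{D}}_R(\mathsf{X})$ generated by $1_{C(\beta,\alpha)}$ and $\tau_{\alpha\beta^{-1}}:D_{\beta\alpha^{-1}}\to D_{\alpha\beta^{-1}}$, $\tau_{\alpha\beta^{-1}}(f)=f\circ\widehat\tau_{\beta\alpha^{-1}}$ (understood as $0$ outside $C(\beta,\alpha)$). If $g$ is not simple, $D_g=\{0\}$ and $\tau_g=0$. Partial group algebra. For a group $G$ and a set $\mathcal{R}$ of relations of the form $\sum_i\lambda_i\prod_j\varepsilon_{g_{ij}}=0$ (an element written in $\mathcal{R}$ stands for the relation that it equals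 $0$), $R_{\operatorname{par}}(G,\mathcal{R})$ is the universal $R$-algebra with generators $\{[g]:g\in G\}$ subject to $[e]=1$, $[g^{-1}][g][h]=[g^{-1}][gh]$, $[g][h][h^{-1}]=[gh][h^{-1}]$ for all $g,h\in G$, and the relations in $\mathcal{R}$, where $\varepsilon_g=[g][g^{-1}]$. $A_{\operatorname{par}}(G,\mathcal{R})$ is its $R$-subalgebra generated by $\{\varepsilon_g:g\in G\}$. The partial action $\theta$ of $G$ on $A_{\operatorname{par}}(G,\mathcal{R})$ has ideals $A_{\operatorname{par}}(G,\mathcal{R})\varepsilon_g$ and isomorphisms $\theta_g: A_{\operatorname{par}}(G,\mathcal{R})\varepsilon_{g^{-1}}\to A_{\operatorname{par}}(G,\mathcal{R})\varepsilon_g$ with $\theta_g(\varepsilon_h\varepsilon_{g^{-1}})=\varepsilon_{gh}\varepsilon_g$. Equivariance of $\Xi$ means $\Xi\circ\theta_g=\tau_g\circ\Xi$ on $A_{\operatorname{par}}(\mathbb{F},\mathcal{R})\varepsilon_{g^{-1}}$ for every $g\in\mathbb{F}$.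
   Formalization: Repaired: if X is nonempty, every letter of the alphabet must occur in X; in the relations each βγ⁻¹ is required to be in reduced form; and D̃_R(X) (and the diagonal subalgebra) is the subalgebra generated by the 1_{C(α,β)}, not merely their linear span. *)

theory Defs
  imports
    "HOL-Algebra.QuotRing"
    "HOL-Algebra.Subrings"
    "HOL-Algebra.Module"
    "HOL-Library.Poly_Mapping"
    "HOL-Library.Indicator_Function"
    "HOL-Library.Omega_Words_Fun"
begin

section \<open>Algebras over a commutative ring\<close>

text \<open>
  The base ring is a type of class \<open>comm_ring_1\<close> (hence nonzero), and an algebra over it is a
  possibly noncommutative unital ring with a scalar multiplication, carried by the record
  \<open>('r, 'b) module\<close>; the locale \<open>algebra\<close> of the library is restricted to commutative rings.
\<close>

definition alg_iso :: "('r, 'b) module \<Rightarrow> ('r, 'c) module \<Rightarrow> ('b \<Rightarrow> 'c) set" where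
  "alg_iso A B = {h \<in> ring_iso A B. \<forall>r. \<forall>x\<in>carrier A. h (r \<odot>\<^bsub>A\<^esub> x) = r \<odot>\<^bsub>B\<^esub> h x}"

definition gen_subalgebra :: "('r, 'b) module \<Rightarrow> 'b set \<Rightarrow> 'b set" where
  "gen_subalgebra A S =
    \<Inter>{B. subring B A \<and> (\<forall>r. \<forall>x\<in>B. r \<odot>\<^bsub>A\<^esub> x \<in> B) \<and> S \<subseteq> B}"

text \<open>For a central idempotent \<open>e\<close> the ideal \<open>A e\<close> is a unital algebra with unit \<open>e\<close>.\<close>

definition idem_ideal :: "('r, 'b) module \<Rightarrow> 'b \<Rightarrow> ('r, 'b) module" where
  "idem_ideal A e = A\<lparr>carrier := {x \<otimes>\<^bsub>A\<^esub> e | x. x \<in> carrier A}, one := e\<rparr>"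


section \<open>Algebras presented by generators and relations\<close>

text \<open>
  Lists under concatenation are the free monoid, so that \<open>'x list \<Rightarrow>\<^sub>0 'r\<close>, with the convolution
  product of \<open>Poly_Mapping\<close>, is the free associative unital algebra on \<open>'x\<close>.
\<close>

instantiation list :: (type) monoid_add
begin
definition zero_list :: "'a list" where "zero_list = []"
definition plus_list :: "'a list \<Rightarrow> 'a list \<Rightarrow> 'a list" where "plus_list xs ys = xs @ ys"
instance by standard (simp_all add: zero_list_def plus_list_def)
end

abbreviation gen :: "'x \<Rightarrow> 'x list \<Rightarrow>\<^sub>0 'r::comm_ring_1" where
  "gen x \<equiv> Poly_Mapping.single [x] 1"

abbreviation scal :: "'r \<Rightarrow> 'x list \<Rightarrow>\<^sub>0 'r::comm_ring_1" where
  "scal r \<equiv> Poly_Mapping.single [] r"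

definition free_algebra :: "'x set \<Rightarrow> ('r::comm_ring_1, 'x list \<Rightarrow>\<^sub>0 'r) module" where
  "free_algebra S =
    \<lparr>carrier = {f. Poly_Mapping.keys f \<subseteq> lists S}, mult = (*), one = 1, zero = 0, add = (+),
     smult = (\<lambda>r f. scal r * f)\<rparr>"

lemma ring_free_algebra: "ring (free_algebra S)"
proof -
  have mult: "Poly_Mapping.keys (f * g) \<subseteq> lists S"
    if "Poly_Mapping.keys f \<subseteq> lists S" "Poly_Mapping.keys g \<subseteq> lists S"
    for f g :: "'a list \<Rightarrow>\<^sub>0 'b"
    using keys_mult[of f g] that by (fastforce simp: plus_list_def)
  have add: "Poly_Mapping.keys (f + g) \<subseteq> lists S"
    if "Poly_Mapping.keys f \<subseteq> lists S" "Poly_Mapping.keys g \<subseteq> lists S"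
    for f g :: "'a list \<Rightarrow>\<^sub>0 'b"
    using Poly_Mapping.keys_add[of f g] that by blast
  have one: "Poly_Mapping.keys (1 :: 'a list \<Rightarrow>\<^sub>0 'b) \<subseteq> lists S"
    by (simp add: zero_list_def)
  show ?thesis
  proof (rule ringI)
    show "abelian_group (free_algebra S :: ('b, 'a list \<Rightarrow>\<^sub>0 'b) module)"
    proof (rule abelian_groupI)
      fix f assume "f \<in> carrier (free_algebra S :: ('b, 'a list \<Rightarrow>\<^sub>0 'b) module)"
      then show "\<exists>g\<in>carrier (free_algebra S). g \<oplus>\<^bsub>free_algebra S\<^esub> f = \<zero>\<^bsub>free_algebra S\<^esub>"
        by (intro bexI[of _ "- f"]) (simp_all add: free_algebra_def)
    qed (use add in \<open>auto simp: free_algebra_def add_ac\<close>)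
    show "monoid (free_algebra S :: ('b, 'a list \<Rightarrow>\<^sub>0 'b) module)"
      by (rule monoidI) (use mult one in \<open>auto simp: free_algebra_def mult.assoc\<close>)
  qed (auto simp: free_algebra_def algebra_simps)
qed

text \<open>
  The universal algebra on the generators \<open>S\<close> subject to \<open>\<rho> = 0\<close> for \<open>\<rho> \<in> Rel\<close>. The value in it of
  an element of the free algebra is given by \<open>pres_class\<close>.
\<close>

definition pres_ideal :: "'x set \<Rightarrow> ('x list \<Rightarrow>\<^sub>0 'r::comm_ring_1) set \<Rightarrow> ('x list \<Rightarrow>\<^sub>0 'r) set" where
  "pres_ideal S Rel = Idl\<^bsub>free_algebra S\<^esub> Rel"

definition pres_class ::
  "'x set \<Rightarrow> ('x list \<Rightarrow>\<^sub>0 'r::comm_ring_1) set \<Rightarrow> ('x list \<Rightarrow>\<^sub>0 'r) \<Rightarrow> ('x list \<Rightarrow>\<^sub>0 'r) set" where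
  "pres_class S Rel f = pres_ideal S Rel +>\<^bsub>free_algebra S\<^esub> f"

definition pres_algebra ::
  "'x set \<Rightarrow> ('x list \<Rightarrow>\<^sub>0 'r::comm_ring_1) set \<Rightarrow> ('r, ('x list \<Rightarrow>\<^sub>0 'r) set) module" where
  "pres_algebra S Rel = (let Q = free_algebra S Quot pres_ideal S Rel in
    \<lparr>carrier = carrier Q, mult = mult Q, one = one Q, zero = zero Q, add = add Q,
     smult = (\<lambda>r K. \<Union>f\<in>K. pres_class S Rel (r \<odot>\<^bsub>free_algebra S\<^esub> f))\<rparr>)"


section \<open>The free group\<close>

text \<open>
  A letter \<open>(a, True)\<close> stands for \<open>a\<close> and \<open>(a, False)\<close> for its formal inverse. Elements of the free
  group are reduced words.
\<close>

fun reduced :: "('a \<times> bool) list \<Rightarrow> bool" where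
  "reduced ((a, b) # (c, d) # w) \<longleftrightarrow> \<not> (a = c \<and> b \<noteq> d) \<and> reduced ((c, d) # w)"
| "reduced _ \<longleftrightarrow> True"

fun red_cons :: "'a \<times> bool \<Rightarrow> ('a \<times> bool) list \<Rightarrow> ('a \<times> bool) list" where
  "red_cons (a, b) ((c, d) # w) = (if a = c \<and> b \<noteq> d then w else (a, b) # (c, d) # w)"
| "red_cons l [] = [l]"

definition free_group :: "('a \<times> bool) list monoid" where
  "free_group = \<lparr>carrier = {w. reduced w}, mult = (\<lambda>u v. foldr red_cons u v), one = []\<rparr>"

lemma reduced_Cons_tl: "reduced (l # w) \<Longrightarrow> reduced w"
  by (cases w; cases l) auto

lemma reduced_red_cons: "reduced w \<Longrightarrow> reduced (red_cons l w)"
  by (cases l; cases w) (auto dest: reduced_Cons_tl)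

lemma reduced_foldr_red_cons: "reduced v \<Longrightarrow> reduced (foldr red_cons u v)"
  by (induction u) (auto intro: reduced_red_cons)

lemma red_cons_cancel: "reduced w \<Longrightarrow> red_cons (a, \<not> b) (red_cons (a, b) w) = w"
proof (cases w)
  case (Cons l v)
  assume "reduced w"
  with Cons show ?thesis
    by (cases l; cases v) auto
qed simp

lemma red_cons_reduced: "reduced (l # w) \<Longrightarrow> red_cons l w = l # w"
  by (cases l; cases w) auto

lemma foldr_red_cons_red_cons:
  "reduced v \<Longrightarrow> reduced w \<Longrightarrow>
     foldr red_cons (red_cons l v) w = red_cons l (foldr red_cons v w)"
proof (cases v)
  case (Cons m v')
  obtain a b c d where lm: "l = (a, b)" "m = (c, d)" by fastforce
  assume w: "reduced v" "reduced w"
  show ?thesis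
  proof (cases "a = c \<and> b \<noteq> d")
    case True
    then have "red_cons (a, b) (red_cons (c, d) (foldr red_cons v' w)) = foldr red_cons v' w"
      using red_cons_cancel[of "foldr red_cons v' w" c d] reduced_foldr_red_cons[OF w(2)]
      by (cases b; cases d) auto
    with True show ?thesis by (simp add: lm Cons)
  qed (auto simp: lm Cons)
qed (cases l; simp)

lemma foldr_red_cons_assoc:
  "reduced v \<Longrightarrow> reduced w \<Longrightarrow>
     foldr red_cons (foldr red_cons u v) w = foldr red_cons u (foldr red_cons v w)"
  by (induction u) (simp_all add: foldr_red_cons_red_cons reduced_foldr_red_cons)

lemma foldr_red_cons_Nil: "reduced u \<Longrightarrow> foldr red_cons u [] = u"
proof (induction u)
  case (Cons l u)
  then show ?case using red_cons_reduced[OF Cons.prems] reduced_Cons_tl[OF Cons.prems] by simp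
qed simp

lemma foldr_red_cons_inverse:
  "reduced w \<Longrightarrow>
     foldr red_cons (rev (map (\<lambda>(a, b). (a, \<not> b)) u)) (foldr red_cons u w) = w"
  by (induction u arbitrary: w) (auto simp: red_cons_cancel reduced_foldr_red_cons)

lemma group_free_group: "group free_group"
proof (rule groupI)
  fix u assume u: "u \<in> carrier (free_group :: ('a \<times> bool) list monoid)"
  define v where "v = foldr red_cons (rev (map (\<lambda>(a, b). (a, \<not> b)) u)) []"
  have "reduced v" by (simp add: v_def reduced_foldr_red_cons)
  moreover have "foldr red_cons v u = []"
    using foldr_red_cons_inverse[of "[]" u] u
    by (simp add: v_def free_group_def foldr_red_cons_assoc foldr_red_cons_Nil)
  ultimately show "\<exists>v\<in>carrier free_group. v \<otimes>\<^bsub>free_group\<^esub> u = \<one>\<^bsub>free_group\<^esub>"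
    by (auto simp: free_group_def)
qed (auto simp: free_group_def reduced_foldr_red_cons foldr_red_cons_assoc)

text \<open>The word \<open>\<alpha> \<beta>\<^sup>-\<^sup>1\<close> without cancellation, and \<open>\<alpha>\<close>, \<open>\<beta>\<close> as functions of that word.\<close>

definition quot_word :: "'a list \<Rightarrow> 'a list \<Rightarrow> ('a \<times> bool) list" where
  "quot_word \<alpha> \<beta> = map (\<lambda>a. (a, True)) \<alpha> @ map (\<lambda>b. (b, False)) (rev \<beta>)"

definition numer :: "('a \<times> bool) list \<Rightarrow> 'a list" where
  "numer g = (THE \<alpha>. \<exists>\<beta>. g = quot_word \<alpha> \<beta>)"

definition denom :: "('a \<times> bool) list \<Rightarrow> 'a list" where
  "denom g = (THE \<beta>. \<exists>\<alpha>. g = quot_word \<alpha> \<beta>)"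

lemma quot_word_eq_iff [simp]: "quot_word \<alpha> \<beta> = quot_word \<gamma> \<delta> \<longleftrightarrow> \<alpha> = \<gamma> \<and> \<beta> = \<delta>"
proof
  assume *: "quot_word \<alpha> \<beta> = quot_word \<gamma> \<delta>"
  have pos: "filter snd (quot_word \<alpha> \<beta>) = map (\<lambda>a. (a, True)) \<alpha>" for \<alpha> \<beta> :: "'a list"
    by (simp add: quot_word_def filter_map comp_def)
  have neg: "filter (\<lambda>l. \<not> snd l) (quot_word \<alpha> \<beta>) = map (\<lambda>b. (b, False)) (rev \<beta>)"
    for \<alpha> \<beta> :: "'a list"
    by (simp add: quot_word_def filter_map comp_def)
  have inj: "inj (\<lambda>a::'a. (a, s))" for s :: bool
    by (simp add: inj_on_def)
  show "\<alpha> = \<gamma> \<and> \<beta> = \<delta>"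
    using pos[of \<alpha> \<beta>] pos[of \<gamma> \<delta>] neg[of \<alpha> \<beta>] neg[of \<gamma> \<delta>] *
    by (metis inj inj_map_eq_map rev_rev_ident)
qed simp

lemma numer_quot_word [simp]: "numer (quot_word \<alpha> \<beta>) = \<alpha>"
  by (simp add: numer_def)

lemma denom_quot_word [simp]: "denom (quot_word \<alpha> \<beta>) = \<beta>"
  by (simp add: denom_def)


section \<open>Subshifts\<close>

definition subshift :: "'a word set \<Rightarrow> bool" where
  "subshift X \<longleftrightarrow> (\<exists>F. X = {x. \<forall>i j. x [i \<rightarrow> j] \<notin> F})"

definition language :: "'a word set \<Rightarrow> 'a list set" where
  "language X = insert [] {x [i \<rightarrow> j] | x i j. x \<in> X}"

definition cyl :: "'a word set \<Rightarrow> 'a list \<Rightarrow> 'a list \<Rightarrow> 'a word set" where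
  "cyl X \<alpha> \<beta> = {\<beta> \<frown> x | x. \<beta> \<frown> x \<in> X \<and> \<alpha> \<frown> x \<in> X}"

inductive_set bool_alg :: "'a word set \<Rightarrow> 'a word set set" for X :: "'a word set" where
  cyl: "\<alpha> \<in> language X \<Longrightarrow> \<beta> \<in> language X \<Longrightarrow> cyl X \<alpha> \<beta> \<in> bool_alg X"
| empty: "{} \<in> bool_alg X"
| union: "A \<in> bool_alg X \<Longrightarrow> B \<in> bool_alg X \<Longrightarrow> A \<union> B \<in> bool_alg X"
| compl: "A \<in> bool_alg X \<Longrightarrow> X - A \<in> bool_alg X"


section \<open>The subshift algebra\<close>

datatype 'a sgen = Proj "'a word set" | Gen 'a | Gen_star 'a

definition sgens :: "'a word set \<Rightarrow> 'a sgen set" where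
  "sgens X = Proj ` bool_alg X \<union> range Gen \<union> range Gen_star"

definition s_word :: "'a list \<Rightarrow> 'a sgen list \<Rightarrow>\<^sub>0 'r::comm_ring_1" where
  "s_word \<alpha> = (\<Prod>a\<leftarrow>\<alpha>. gen (Gen a))"

definition s_star_word :: "'a list \<Rightarrow> 'a sgen list \<Rightarrow>\<^sub>0 'r::comm_ring_1" where
  "s_star_word \<alpha> = (\<Prod>a\<leftarrow>rev \<alpha>. gen (Gen_star a))"

definition srels :: "'a word set \<Rightarrow> ('a sgen list \<Rightarrow>\<^sub>0 'r::comm_ring_1) set" where
  "srels X =
     {gen (Proj X) - 1, gen (Proj {})}
   \<union> {gen (Proj (A \<inter> B)) - gen (Proj A) * gen (Proj B) | A B. A \<in> bool_alg X \<and> B \<in> bool_alg X}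
   \<union> {gen (Proj (A \<union> B)) - (gen (Proj A) + gen (Proj B) - gen (Proj (A \<inter> B))) | A B.
        A \<in> bool_alg X \<and> B \<in> bool_alg X}
   \<union> {gen (Gen a) * gen (Gen_star a) * gen (Gen a) - gen (Gen a) | a. True}
   \<union> {gen (Gen_star a) * gen (Gen a) * gen (Gen_star a) - gen (Gen_star a) | a. True}
   \<union> {s_word \<beta> * s_star_word \<alpha> * s_word \<alpha> * s_star_word \<beta> - gen (Proj (cyl X \<alpha> \<beta>)) | \<alpha> \<beta>.
        \<alpha> \<in> language X \<and> \<beta> \<in> language X}"

text \<open>
  Only the two relations of a partial isometry involve \<open>s\<^sub>a\<close> if the letter \<open>a\<close> does not occur in
  \<open>X\<close>, unless \<open>X\<close> is empty (and then the algebra is zero). Such an \<open>s\<^sub>a\<close> is not in the subalgebra generated by the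
  image of the partial representation \<open>\<pi>\<close> below; statements that \<open>\<pi>\<close> generates the algebra therefore need all
  letters to occur in \<open>X\<close>.
\<close>

definition subshift_algebra ::
  "'a word set \<Rightarrow> ('r::comm_ring_1, ('a sgen list \<Rightarrow>\<^sub>0 'r) set) module" where
  "subshift_algebra X = pres_algebra (sgens X) (srels X)"

abbreviation sclass ::
  "'a word set \<Rightarrow> ('a sgen list \<Rightarrow>\<^sub>0 'r::comm_ring_1) \<Rightarrow> ('a sgen list \<Rightarrow>\<^sub>0 'r) set" where
  "sclass X \<equiv> pres_class (sgens X) (srels X)"

text \<open>
  The diagonal algebras are the subalgebras generated by the \<open>p\<^sub>C\<close>, respectively by the
  indicator functions \<open>1\<^sub>C\<close>, for \<open>C = cyl X \<alpha> \<beta>\<close>. The linear span of these elements is in general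
  not closed under products: let the alphabet consist of \<open>a\<close>, \<open>b\<close> and the natural numbers,
  where \<open>a\<close> may only be followed by multiples of 2, \<open>b\<close> by multiples of 3, and every number by any
  number. Then \<open>cyl X [a] [] \<inter> cyl X [b] []\<close> is the set of sequences starting with a
  multiple of 6, and its indicator function is not a linear combination of functions \<open>1\<^sub>C\<close>.
\<close>

definition diag_subalgebra ::
  "'a word set \<Rightarrow> ('r::comm_ring_1, ('a sgen list \<Rightarrow>\<^sub>0 'r) set) module" where
  "diag_subalgebra X = (subshift_algebra X)\<lparr>carrier := gen_subalgebra (subshift_algebra X)
     {sclass X (gen (Proj (cyl X \<alpha> \<beta>))) | \<alpha> \<beta>. \<alpha> \<in> language X \<and> \<beta> \<in> language X}\<rparr>"

text \<open>Functions on \<open>X\<close> are represented by their extensions by zero to all sequences.\<close>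

definition fun_algebra :: "'a word set \<Rightarrow> ('r::comm_ring_1, 'a word \<Rightarrow> 'r) module" where
  "fun_algebra X =
    \<lparr>carrier = {f. \<forall>x. x \<notin> X \<longrightarrow> f x = 0}, mult = (\<lambda>f g x. f x * g x), one = indicator X,
     zero = (\<lambda>x. 0), add = (\<lambda>f g x. f x + g x), smult = (\<lambda>r f x. r * f x)\<rparr>"

definition diag_algebra :: "'a word set \<Rightarrow> ('r::comm_ring_1, 'a word \<Rightarrow> 'r) module" where
  "diag_algebra X = (fun_algebra X)\<lparr>carrier := gen_subalgebra (fun_algebra X)
     {indicator (cyl X \<alpha> \<beta>) | \<alpha> \<beta>. \<alpha> \<in> language X \<and> \<beta> \<in> language X}\<rparr>"

definition diag_ident ::
  "'a word set \<Rightarrow> ('a word \<Rightarrow> 'r::comm_ring_1) \<Rightarrow> ('a sgen list \<Rightarrow>\<^sub>0 'r) set" where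
  "diag_ident X = (THE \<iota>. \<iota> \<in> extensional (carrier (diag_algebra X)) \<and>
     \<iota> \<in> alg_iso (diag_algebra X) (diag_subalgebra X) \<and>
     (\<forall>\<alpha>\<in>language X. \<forall>\<beta>\<in>language X.
        \<iota> (indicator (cyl X \<alpha> \<beta>)) = sclass X (gen (Proj (cyl X \<alpha> \<beta>)))))"


section \<open>The partial action \<open>\<tau>\<close> and the partial representation \<open>\<pi>\<close>\<close>

definition simple_elt :: "'a word set \<Rightarrow> ('a \<times> bool) list \<Rightarrow> bool" where
  "simple_elt X g \<longleftrightarrow> reduced g \<and> (\<exists>\<alpha>\<in>language X. \<exists>\<beta>\<in>language X. g = quot_word \<alpha> \<beta>)"

text \<open>The map \<open>\<beta> x \<mapsto> \<alpha> x\<close>, used on \<open>cyl X \<alpha> \<beta>\<close>.\<close>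

definition tau_hat :: "'a list \<Rightarrow> 'a list \<Rightarrow> 'a word \<Rightarrow> 'a word" where
  "tau_hat \<alpha> \<beta> y = \<alpha> \<frown> suffix (length \<beta>) y"

definition tau_dom :: "'a word set \<Rightarrow> ('a \<times> bool) list \<Rightarrow> ('a word \<Rightarrow> 'r::comm_ring_1) set" where
  "tau_dom X g = (if simple_elt X g
     then Idl\<^bsub>diag_algebra X\<^esub> {indicator (cyl X (denom g) (numer g))} else {\<lambda>x. 0})"

definition tau ::
  "'a word set \<Rightarrow> ('a \<times> bool) list \<Rightarrow> ('a word \<Rightarrow> 'r::comm_ring_1) \<Rightarrow> 'a word \<Rightarrow> 'r" where
  "tau X g f = (if simple_elt X g
     then (\<lambda>y. if y \<in> cyl X (denom g) (numer g) then f (tau_hat (denom g) (numer g) y) else 0)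
     else (\<lambda>y. 0))"

definition spi ::
  "'a word set \<Rightarrow> ('a \<times> bool) list \<Rightarrow> ('a sgen list \<Rightarrow>\<^sub>0 'r::comm_ring_1) set" where
  "spi X g = (if simple_elt X g
     then sclass X (s_word (numer g) * s_star_word (denom g)) else \<zero>\<^bsub>subshift_algebra X\<^esub>)"


section \<open>Partial group algebras with relations\<close>

definition par_rels :: "('g, 'm) monoid_scheme \<Rightarrow> ('g list \<Rightarrow>\<^sub>0 'r::comm_ring_1) set" where
  "par_rels G =
     {gen \<one>\<^bsub>G\<^esub> - 1}
   \<union> {gen (inv\<^bsub>G\<^esub> g) * gen g * gen h - gen (inv\<^bsub>G\<^esub> g) * gen (g \<otimes>\<^bsub>G\<^esub> h) | g h.
        g \<in> carrier G \<and> h \<in> carrier G}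
   \<union> {gen g * gen h * gen (inv\<^bsub>G\<^esub> h) - gen (g \<otimes>\<^bsub>G\<^esub> h) * gen (inv\<^bsub>G\<^esub> h) | g h.
        g \<in> carrier G \<and> h \<in> carrier G}"

text \<open>The element \<open>\<epsilon>\<^sub>g = [g][g\<^sup>-\<^sup>1]\<close> of the free algebra.\<close>

definition eps_sym :: "('g, 'm) monoid_scheme \<Rightarrow> 'g \<Rightarrow> 'g list \<Rightarrow>\<^sub>0 'r::comm_ring_1" where
  "eps_sym G g = gen g * gen (inv\<^bsub>G\<^esub> g)"

definition par_algebra ::
  "('g, 'm) monoid_scheme \<Rightarrow> ('g list \<Rightarrow>\<^sub>0 'r::comm_ring_1) set \<Rightarrow> ('r, ('g list \<Rightarrow>\<^sub>0 'r) set) module"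
  where "par_algebra G Rel = pres_algebra (carrier G) (par_rels G \<union> Rel)"

definition par_elt ::
  "('g, 'm) monoid_scheme \<Rightarrow> ('g list \<Rightarrow>\<^sub>0 'r::comm_ring_1) set \<Rightarrow> 'g \<Rightarrow> ('g list \<Rightarrow>\<^sub>0 'r) set" where
  "par_elt G Rel g = pres_class (carrier G) (par_rels G \<union> Rel) (gen g)"

definition par_eps ::
  "('g, 'm) monoid_scheme \<Rightarrow> ('g list \<Rightarrow>\<^sub>0 'r::comm_ring_1) set \<Rightarrow> 'g \<Rightarrow> ('g list \<Rightarrow>\<^sub>0 'r) set" where
  "par_eps G Rel g = pres_class (carrier G) (par_rels G \<union> Rel) (eps_sym G g)"

definition par_diag ::
  "('g, 'm) monoid_scheme \<Rightarrow> ('g list \<Rightarrow>\<^sub>0 'r::comm_ring_1) set \<Rightarrow> ('r, ('g list \<Rightarrow>\<^sub>0 'r) set) module"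
  where "par_diag G Rel = (par_algebra G Rel)
    \<lparr>carrier := gen_subalgebra (par_algebra G Rel) (par_eps G Rel ` carrier G)\<rparr>"

definition theta ::
  "('g, 'm) monoid_scheme \<Rightarrow> ('g list \<Rightarrow>\<^sub>0 'r::comm_ring_1) set \<Rightarrow> 'g \<Rightarrow>
     ('g list \<Rightarrow>\<^sub>0 'r) set \<Rightarrow> ('g list \<Rightarrow>\<^sub>0 'r) set" where
  "theta G Rel g =
    (let A = par_diag G Rel; \<epsilon> = par_eps G Rel;
         D = idem_ideal A (\<epsilon> (inv\<^bsub>G\<^esub> g)); E = idem_ideal A (\<epsilon> g)
     in THE f. f \<in> extensional (carrier D) \<and> f \<in> alg_iso D E \<and>
          (\<forall>h\<in>carrier G. f (\<epsilon> h \<otimes>\<^bsub>A\<^esub> \<epsilon> (inv\<^bsub>G\<^esub> g)) = \<epsilon> (g \<otimes>\<^bsub>G\<^esub> h) \<otimes>\<^bsub>A\<^esub> \<epsilon> g))"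


section \<open>The relations attached to a subshift\<close>

text \<open>
  The list \<open>c\<close> encodes the formal expression with coefficients \<open>r = \<lambda>\<^sub>i\<close> and factors indexed by the
  pairs \<open>(\<beta>\<^sub>i\<^sub>j, \<gamma>\<^sub>i\<^sub>j)\<close>. As everywhere else, \<open>\<beta> \<gamma>\<^sup>-\<^sup>1\<close> is understood to be in reduced form.
  This cannot be dropped: \<open>cyl X \<beta> \<beta>\<close> is the set of all \<open>x \<in> X\<close> that start with \<open>\<beta>\<close>,
  whereas \<open>\<beta> \<beta>\<^sup>-\<^sup>1\<close> is trivial in the free group; pairing the two makes the quotient zero for the
  full shift on two letters.
\<close>

definition subshift_rels :: "'a word set \<Rightarrow> (('a \<times> bool) list list \<Rightarrow>\<^sub>0 'r::comm_ring_1) set" where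
  "subshift_rels X =
     {(\<Sum>(r, ps)\<leftarrow>c. scal r * (\<Prod>(\<beta>, \<gamma>)\<leftarrow>ps. eps_sym free_group (quot_word \<beta> \<gamma>))) | c.
        (\<forall>(r, ps)\<in>set c. \<forall>(\<beta>, \<gamma>)\<in>set ps.
           \<beta> \<in> language X \<and> \<gamma> \<in> language X \<and> reduced (quot_word \<beta> \<gamma>)) \<and>
        sclass X (\<Sum>(r, ps)\<leftarrow>c. scal r * (\<Prod>(\<beta>, \<gamma>)\<leftarrow>ps. gen (Proj (cyl X \<gamma> \<beta>))))
          = \<zero>\<^bsub>subshift_algebra X\<^esub>}
   \<union> {eps_sym free_group g | g.
        g \<in> carrier free_group \<and> spi X g = (\<zero>\<^bsub>subshift_algebra X\<^esub> :: ('a sgen list \<Rightarrow>\<^sub>0 'r) set)}"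

end

theory Submission
  imports Defs
begin

text \<open>
  In the subshift algebra the elements \<open>s\<^sub>\<beta> s\<^sub>\<alpha>\<^sup>* s\<^sub>\<alpha> s\<^sub>\<beta>\<^sup>*\<close> are commuting projections; inserting
  \<open>\<pi>(g) = \<pi>(g) \<pi>(g\<^sup>-\<^sup>1) \<pi>(g)\<close> and commuting them one letter at a time shows that the product of letters
  along reduced words is a partial representation \<open>\<pi>\<close>, which therefore induces \<open>\<Xi>\<close>.
  The diagonal of the partial group algebra consists of polynomials in the \<open>\<epsilon>\<^sub>g\<close>, and the relations were
  chosen such that a polynomial whose image vanishes is zero: \<open>\<Xi>\<close> is injective on the diagonal.
  Every identity between diagonal elements can hence be checked in the subshift algebra. In particular the
  \<open>p\<^sub>C\<close> lift uniquely, the lifts together with \<open>[a]\<close> and \<open>[a\<^sup>-\<^sup>1]\<close> satisfy the relations of the subshift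
  algebra, and the resulting homomorphism inverts \<open>\<Xi>\<close>, because \<open>[g]\<close> is the product of the letters of \<open>g\<close>.
  Letting the subshift algebra act on functions on \<open>X\<close> turns diagonal elements into multiplication
  operators and \<open>\<pi>(g)\<close> into \<open>\<tau>\<^sub>g\<close>; since \<open>\<theta>\<^sub>g\<close> is \<open>x \<mapsto> [g] x [g\<^sup>-\<^sup>1]\<close>, equivariance follows.
\<close>

section \<open>Algebras and presentations\<close>

text \<open>Outside words \<open>\<alpha> \<beta>^-1\<close> over the language, \<open>\<pi>\<close>
  is zero by decree, whereas a product of letters makes sense on every word. That both agree on
  reduced words is not among the relations but follows from them: the sets belonging to adjacent
  factors are disjoint, so their projections are orthogonal. The hypothesis on letters enters here,
  since at a letter that does not occur \<open>\<pi>\<close> would be zero while the generator need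
  not be. A second obstacle is that \<open>\<R>\<close> mentions only reduced words
  \<open>\<beta> \<gamma>^-1\<close>, while there is a projection for every pair of language words.
  If the words of a pair end in the same letter, its projection need not be the image of a single
  \<open>\<epsilon>\<close>; conjugation exhibits it as the image of two, one at the reduced product
  and one at the left word. Finally, both the identification of the two diagonals and
  \<open>theta\<close> are definite descriptions. Each needs a concrete candidate and a uniqueness
  argument on generators: the candidates are the inverse of evaluating an operator at the unit
  function, and conjugation by \<open>[g]\<close>.\<close>

locale ralg = ring A for A :: "('r::comm_ring_1, 'b) module" (structure) +
  assumes smult_closed [simp, intro]: "x \<in> carrier A \<Longrightarrow> r \<odot> x \<in> carrier A"
    and smult_l_distr: "x \<in> carrier A \<Longrightarrow> (r + s) \<odot> x = r \<odot> x \<oplus> s \<odot> x"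
    and smult_r_distr: "x \<in> carrier A \<Longrightarrow> y \<in> carrier A \<Longrightarrow> r \<odot> (x \<oplus> y) = r \<odot> x \<oplus> r \<odot> y"
    and smult_assoc: "x \<in> carrier A \<Longrightarrow> (r * s) \<odot> x = r \<odot> (s \<odot> x)"
    and smult_one [simp]: "x \<in> carrier A \<Longrightarrow> 1 \<odot> x = x"
    and smult_mult_l: "x \<in> carrier A \<Longrightarrow> y \<in> carrier A \<Longrightarrow> (r \<odot> x) \<otimes> y = r \<odot> (x \<otimes> y)"
    and smult_mult_r: "x \<in> carrier A \<Longrightarrow> y \<in> carrier A \<Longrightarrow> x \<otimes> (r \<odot> y) = r \<odot> (x \<otimes> y)"
begin

lemma smult_zero_l [simp]: "x \<in> carrier A \<Longrightarrow> 0 \<odot> x = \<zero>"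
  using smult_l_distr[of x 0 0] add.l_cancel_one'[of "0 \<odot> x" "0 \<odot> x"] by auto

lemma smult_zero_r [simp]: "r \<odot> \<zero> = \<zero>"
  using smult_r_distr[of \<zero> \<zero> r] add.l_cancel_one'[of "r \<odot> \<zero>" "r \<odot> \<zero>"] by auto

lemma smult_left_commute: "x \<in> carrier A \<Longrightarrow> r \<odot> (s \<odot> x) = s \<odot> (r \<odot> x)"
  by (metis smult_assoc mult.commute)

lemma smult_minus_one: "x \<in> carrier A \<Longrightarrow> (-1) \<odot> x = \<ominus> x"
  using smult_l_distr[of x "-1" 1] by (simp add: minus_equality)

end

definition alg_hom :: "('r, 'b) module \<Rightarrow> ('r, 'c) module \<Rightarrow> ('b \<Rightarrow> 'c) set" where
  "alg_hom A B = {h \<in> ring_hom A B. \<forall>r. \<forall>x\<in>carrier A. h (r \<odot>\<^bsub>A\<^esub> x) = r \<odot>\<^bsub>B\<^esub> h x}"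

lemma alg_iso_def': "alg_iso A B = {h \<in> alg_hom A B. bij_betw h (carrier A) (carrier B)}"
  by (auto simp: alg_iso_def alg_hom_def ring_iso_def)

lemma alg_homI:
  assumes "\<And>x. x \<in> carrier A \<Longrightarrow> h x \<in> carrier B"
    and "\<And>x y. x \<in> carrier A \<Longrightarrow> y \<in> carrier A \<Longrightarrow> h (x \<otimes>\<^bsub>A\<^esub> y) = h x \<otimes>\<^bsub>B\<^esub> h y"
    and "\<And>x y. x \<in> carrier A \<Longrightarrow> y \<in> carrier A \<Longrightarrow> h (x \<oplus>\<^bsub>A\<^esub> y) = h x \<oplus>\<^bsub>B\<^esub> h y"
    and "h \<one>\<^bsub>A\<^esub> = \<one>\<^bsub>B\<^esub>"
    and "\<And>r x. x \<in> carrier A \<Longrightarrow> h (r \<odot>\<^bsub>A\<^esub> x) = r \<odot>\<^bsub>B\<^esub> h x"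
  shows "h \<in> alg_hom A B"
  using assms by (auto simp: alg_hom_def ring_hom_def)

lemma alg_homD:
  assumes "h \<in> alg_hom A B"
  shows "x \<in> carrier A \<Longrightarrow> h x \<in> carrier B"
    and "x \<in> carrier A \<Longrightarrow> y \<in> carrier A \<Longrightarrow> h (x \<otimes>\<^bsub>A\<^esub> y) = h x \<otimes>\<^bsub>B\<^esub> h y"
    and "x \<in> carrier A \<Longrightarrow> y \<in> carrier A \<Longrightarrow> h (x \<oplus>\<^bsub>A\<^esub> y) = h x \<oplus>\<^bsub>B\<^esub> h y"
    and "h \<one>\<^bsub>A\<^esub> = \<one>\<^bsub>B\<^esub>"
    and "x \<in> carrier A \<Longrightarrow> h (r \<odot>\<^bsub>A\<^esub> x) = r \<odot>\<^bsub>B\<^esub> h x"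
  using assms by (auto simp: alg_hom_def ring_hom_def)

lemma alg_hom_zero:
  assumes "ralg A" "ralg B" "h \<in> alg_hom A B"
  shows "h \<zero>\<^bsub>A\<^esub> = \<zero>\<^bsub>B\<^esub>"
proof -
  interpret A: ralg A by fact
  interpret B: ralg B by fact
  have "h (0 \<odot>\<^bsub>A\<^esub> \<zero>\<^bsub>A\<^esub>) = 0 \<odot>\<^bsub>B\<^esub> h \<zero>\<^bsub>A\<^esub>"
    by (simp only: alg_homD[OF assms(3)] A.zero_closed)
  then show ?thesis using alg_homD(1)[OF assms(3)] by simp
qed

lemma alg_hom_minus:
  assumes "ralg A" "ralg B" "h \<in> alg_hom A B" "x \<in> carrier A" "y \<in> carrier A"
  shows "h (x \<ominus>\<^bsub>A\<^esub> y) = h x \<ominus>\<^bsub>B\<^esub> h y"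
proof -
  interpret A: ralg A by fact
  interpret B: ralg B by fact
  have "h (x \<oplus>\<^bsub>A\<^esub> (-1) \<odot>\<^bsub>A\<^esub> y) = h x \<oplus>\<^bsub>B\<^esub> (-1) \<odot>\<^bsub>B\<^esub> h y"
    using assms by (simp add: alg_homD[OF assms(3)])
  then show ?thesis
    using assms alg_homD(1)[OF assms(3)] by (simp add: A.smult_minus_one B.smult_minus_one a_minus_def)
qed

lemma alg_hom_comp:
  "f \<in> alg_hom A B \<Longrightarrow> g \<in> alg_hom B C \<Longrightarrow> g \<circ> f \<in> alg_hom A C"
  by (rule alg_homI) (auto simp: alg_homD)

definition mprod :: "('b, 'm) monoid_scheme \<Rightarrow> 'b list \<Rightarrow> 'b" where
  "mprod A xs = foldr (\<otimes>\<^bsub>A\<^esub>) xs \<one>\<^bsub>A\<^esub>"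

lemma mprod_Nil [simp]: "mprod A [] = \<one>\<^bsub>A\<^esub>"
  and mprod_Cons [simp]: "mprod A (x # xs) = x \<otimes>\<^bsub>A\<^esub> mprod A xs"
  by (simp_all add: mprod_def)

lemma (in monoid) mprod_closed [simp, intro]: "set xs \<subseteq> carrier G \<Longrightarrow> mprod G xs \<in> carrier G"
  by (induction xs) auto

lemma (in monoid) mprod_append:
  "set xs \<subseteq> carrier G \<Longrightarrow> set ys \<subseteq> carrier G \<Longrightarrow> mprod G (xs @ ys) = mprod G xs \<otimes> mprod G ys"
  by (induction xs) (auto simp: m_assoc)

lemma alg_hom_mprod:
  assumes "h \<in> alg_hom A B" "ralg A" "set xs \<subseteq> carrier A"
  shows "h (mprod A xs) = mprod B (map h xs)"
proof -
  interpret A: ralg A by fact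
  show ?thesis using assms(3) by (induction xs) (auto simp: alg_homD[OF assms(1)])
qed

section \<open>Generated subalgebras as spans of monomials\<close>

context ralg
begin

lemma gen_subalgebra:
  assumes "S \<subseteq> carrier A"
  shows gen_subalgebra_subring: "subring (gen_subalgebra A S) A"
    and gen_subalgebra_smult: "x \<in> gen_subalgebra A S \<Longrightarrow> r \<odot> x \<in> gen_subalgebra A S"
    and gen_subalgebra_gen: "S \<subseteq> gen_subalgebra A S"
proof -
  \<comment> \<open>The whole algebra is a member of the family, so the intersection is taken over a
    nonempty family.\<close>
  have "subring (carrier A) A" by (rule carrier_is_subring)
  then have "carrier A \<in> {B. subring B A \<and> (\<forall>r. \<forall>x\<in>B. r \<odot> x \<in> B) \<and> S \<subseteq> B}"
    using assms by auto
  then show "subring (gen_subalgebra A S) A"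
    unfolding gen_subalgebra_def by (intro subring_Inter) auto
qed (auto simp: gen_subalgebra_def)

lemma gen_subalgebra_closed:
  assumes "S \<subseteq> carrier A"
  shows "x \<in> gen_subalgebra A S \<Longrightarrow> x \<in> carrier A"
    and "\<one> \<in> gen_subalgebra A S"
    and "\<zero> \<in> gen_subalgebra A S"
    and "x \<in> gen_subalgebra A S \<Longrightarrow> y \<in> gen_subalgebra A S \<Longrightarrow> x \<oplus> y \<in> gen_subalgebra A S"
    and "x \<in> gen_subalgebra A S \<Longrightarrow> y \<in> gen_subalgebra A S \<Longrightarrow> x \<otimes> y \<in> gen_subalgebra A S"
  using subringE[OF gen_subalgebra_subring[OF assms]] by auto

lemma gen_subalgebra_minimal:
  assumes "B \<subseteq> carrier A" "\<one> \<in> B" "\<And>x y. x \<in> B \<Longrightarrow> y \<in> B \<Longrightarrow> x \<oplus> y \<in> B"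
    and "\<And>x y. x \<in> B \<Longrightarrow> y \<in> B \<Longrightarrow> x \<otimes> y \<in> B" "\<And>r x. x \<in> B \<Longrightarrow> r \<odot> x \<in> B" "S \<subseteq> B"
  shows "gen_subalgebra A S \<subseteq> B"
proof -
  have "subring B A"
  proof (rule subringI)
    \<comment> \<open>Negation is multiplication by the scalar \<open>-1\<close>.\<close>
    fix h assume "h \<in> B"
    then show "\<ominus> h \<in> B" using assms(1) assms(5)[of h "-1"] by (auto simp: smult_minus_one)
  qed (use assms in auto)
  then show ?thesis using assms unfolding gen_subalgebra_def by blast
qed

lemma gen_subalgebra_mono_gen:
  assumes "T \<subseteq> carrier A" "S \<subseteq> gen_subalgebra A T"
  shows "gen_subalgebra A S \<subseteq> gen_subalgebra A T"
  using gen_subalgebra_closed[OF assms(1)] gen_subalgebra_smult[OF assms(1)] assms(2)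
  by (intro gen_subalgebra_minimal[of "gen_subalgebra A T"] subsetI) auto

lemma gen_subalgebra_induct [consumes 2, case_names gen one add mult smult]:
  assumes "S \<subseteq> carrier A" "x \<in> gen_subalgebra A S"
    and gen: "\<And>x. x \<in> S \<Longrightarrow> P x"
    and one: "P \<one>"
    and add: "\<And>x y. x \<in> gen_subalgebra A S \<Longrightarrow> y \<in> gen_subalgebra A S \<Longrightarrow> P x \<Longrightarrow> P y \<Longrightarrow> P (x \<oplus> y)"
    and mult: "\<And>x y. x \<in> gen_subalgebra A S \<Longrightarrow> y \<in> gen_subalgebra A S \<Longrightarrow> P x \<Longrightarrow> P y \<Longrightarrow> P (x \<otimes> y)"
    and smult: "\<And>r x. x \<in> gen_subalgebra A S \<Longrightarrow> P x \<Longrightarrow> P (r \<odot> x)"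
  shows "P x"
proof -
  note closed = gen_subalgebra_closed[OF assms(1)]
  have "gen_subalgebra A S \<subseteq> {x \<in> gen_subalgebra A S. P x}"
  proof (rule gen_subalgebra_minimal)
    show "S \<subseteq> {x \<in> gen_subalgebra A S. P x}" using gen gen_subalgebra_gen[OF assms(1)] by auto
  qed (use closed assms gen_subalgebra_smult[OF assms(1)] in auto)
  then show ?thesis using assms(2) by auto
qed

lemma ralg_gen_subalgebra:
  assumes "S \<subseteq> carrier A"
  shows "ralg (A\<lparr>carrier := gen_subalgebra A S\<rparr>)"
proof -
  interpret B: ring "A\<lparr>carrier := gen_subalgebra A S\<rparr>"
    by (rule subring_is_ring[OF gen_subalgebra_subring[OF assms]])
  show ?thesis
    by unfold_locales
      (use gen_subalgebra_closed[OF assms] gen_subalgebra_smult[OF assms] in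
        \<open>auto simp: smult_l_distr smult_r_distr smult_assoc smult_mult_l smult_mult_r\<close>)
qed

text \<open>A normal form from which an induction can strip one monomial at a time. Both
  \<open>diag_kernel\<close> and \<open>diag_lincomb\<close> run over it.\<close>

inductive_set mspan :: "'b set \<Rightarrow> 'b set" for S where
  zero: "\<zero> \<in> mspan S"
| step: "xs \<in> lists S \<Longrightarrow> y \<in> mspan S \<Longrightarrow> r \<odot> mprod A xs \<oplus> y \<in> mspan S"

text \<open>Monomials multiply by concatenation, so their span is already closed under
  products.\<close>

lemma gen_subalgebra_eq_mspan:
  assumes S: "S \<subseteq> carrier A"
  shows "gen_subalgebra A S = mspan S"
proof
  have mono [simp]: "mprod A xs \<in> carrier A" if "xs \<in> lists S" for xs
    using that S by (intro mprod_closed) auto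
  have carr [simp]: "x \<in> carrier A" if "x \<in> mspan S" for x
    using that by induction auto
  have add: "x \<oplus> y \<in> mspan S" if "x \<in> mspan S" "y \<in> mspan S" for x y
    using that by induction (auto simp: a_assoc intro: mspan.step)
  have smult: "r \<odot> x \<in> mspan S" if "x \<in> mspan S" for r x
    using that
    by induction (auto simp: smult_r_distr smult_assoc[symmetric] intro: mspan.step mspan.zero)
  have lmul: "mprod A xs \<otimes> x \<in> mspan S" if "x \<in> mspan S" "xs \<in> lists S" for xs x
    using that
  proof induction
    case (step ys y r)
    then have "mprod A xs \<otimes> (r \<odot> mprod A ys \<oplus> y) = r \<odot> mprod A (xs @ ys) \<oplus> mprod A xs \<otimes> y"
      using S by (subst mprod_append) (auto simp: r_distr smult_mult_r)
    with step show ?case by (auto intro!: mspan.step simp del: in_lists_conv_set)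
  qed (auto intro: mspan.zero)
  have mul: "x \<otimes> y \<in> mspan S" if "x \<in> mspan S" "y \<in> mspan S" for x y
    using that
  proof induction
    case (step xs x r)
    then show ?case by (auto simp: l_distr smult_mult_l intro!: add smult lmul)
  qed (auto intro: mspan.zero)
  have single: "mprod A xs \<in> mspan S" if "xs \<in> lists S" for xs
    using mspan.step[OF that mspan.zero, of 1] that by simp
  show "gen_subalgebra A S \<subseteq> mspan S"
  proof (rule gen_subalgebra_minimal)
    show "\<one> \<in> mspan S" using single[of "[]"] by simp
    show "S \<subseteq> mspan S" using single[of "[_]"] S by (auto simp: subset_eq)
  qed (auto intro: add mul smult)
  note closed = gen_subalgebra_closed[OF S]
  have "mprod A xs \<in> gen_subalgebra A S" if "xs \<in> lists S" for xs
    using that by (induction xs) (use closed gen_subalgebra_gen[OF S] in auto)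
  then show "mspan S \<subseteq> gen_subalgebra A S"
  proof -
    assume a: "\<And>xs. xs \<in> lists S \<Longrightarrow> mprod A xs \<in> gen_subalgebra A S"
    have "x \<in> gen_subalgebra A S" if "x \<in> mspan S" for x
      using that by induction (use closed a gen_subalgebra_smult[OF S] in \<open>auto simp del: in_lists_conv_set\<close>)
    then show ?thesis by auto
  qed
qed

end

lemma alg_hom_eq_on_gen_subalgebra:
  assumes "ralg A" "S \<subseteq> carrier A" "x \<in> gen_subalgebra A S"
    and f: "f \<in> alg_hom (A\<lparr>carrier := gen_subalgebra A S\<rparr>) B"
    and g: "g \<in> alg_hom (A\<lparr>carrier := gen_subalgebra A S\<rparr>) B"
    and "\<And>x. x \<in> S \<Longrightarrow> f x = g x"
  shows "f x = g x"
proof -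
  interpret ralg A by fact
  show ?thesis using assms(2,3)
    by (induction rule: gen_subalgebra_induct)
      (use assms(6) alg_homD[OF f] alg_homD[OF g] in auto)
qed

text \<open>The map is assumed to be a homomorphism on the subalgebra alone, because this is applied
  to \<open>delta\<close>, which is shown to be multiplicative only on the diagonal.\<close>

lemma alg_hom_image_gen_subalgebra:
  assumes "ralg A" "ralg B" and S: "S \<subseteq> carrier A"
    and hom: "h \<in> alg_hom (A\<lparr>carrier := gen_subalgebra A S\<rparr>) B"
  shows "h ` gen_subalgebra A S = gen_subalgebra B (h ` S)"
proof -
  interpret A: ralg A by fact
  interpret B: ralg B by fact
  note h = alg_homD[OF hom, simplified]
  have hS: "h ` S \<subseteq> carrier B" using h(1) A.gen_subalgebra_gen[OF S] by auto
  note Acl = A.gen_subalgebra_closed[OF S] A.gen_subalgebra_smult[OF S]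
  note Bcl = B.gen_subalgebra_closed[OF hS] B.gen_subalgebra_smult[OF hS]
  have "h x \<in> gen_subalgebra B (h ` S)" if "x \<in> gen_subalgebra A S" for x
    using S that
    by (induction rule: A.gen_subalgebra_induct)
      (use B.gen_subalgebra_gen[OF hS] Bcl Acl h in auto)
  moreover have "gen_subalgebra B (h ` S) \<subseteq> h ` gen_subalgebra A S"
  proof (rule B.gen_subalgebra_minimal)
    show "\<one>\<^bsub>B\<^esub> \<in> h ` gen_subalgebra A S"
      using Acl(2) h(4) by (metis imageI)
    show "h ` S \<subseteq> h ` gen_subalgebra A S" using A.gen_subalgebra_gen[OF S] by auto
    fix x y assume "x \<in> h ` gen_subalgebra A S" "y \<in> h ` gen_subalgebra A S"
    then obtain u v where uv: "u \<in> gen_subalgebra A S" "v \<in> gen_subalgebra A S" "x = h u" "y = h v"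
      by auto
    show "x \<oplus>\<^bsub>B\<^esub> y \<in> h ` gen_subalgebra A S"
      by (rule image_eqI[of _ _ "u \<oplus>\<^bsub>A\<^esub> v"]) (use uv Acl h in auto)
    show "x \<otimes>\<^bsub>B\<^esub> y \<in> h ` gen_subalgebra A S"
      by (rule image_eqI[of _ _ "u \<otimes>\<^bsub>A\<^esub> v"]) (use uv Acl h in auto)
  next
    fix r x assume "x \<in> h ` gen_subalgebra A S"
    then obtain u where u: "u \<in> gen_subalgebra A S" "x = h u" by auto
    show "r \<odot>\<^bsub>B\<^esub> x \<in> h ` gen_subalgebra A S"
      by (rule image_eqI[of _ _ "r \<odot>\<^bsub>A\<^esub> u"]) (use u Acl h in auto)
  qed (use Acl h in auto)
  ultimately show ?thesis by auto
qed

lemma alg_iso_inv_into: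
  assumes "ralg A" "h \<in> alg_iso A B"
  shows "inv_into (carrier A) h \<in> alg_iso B A"
proof -
  interpret A: ralg A by fact
  let ?k = "inv_into (carrier A) h"
  have h: "h \<in> ring_iso A B" "h \<in> alg_hom A B" "bij_betw h (carrier A) (carrier B)"
    using assms(2) by (auto simp: alg_iso_def alg_iso_def' alg_hom_def ring_iso_def)
  have k: "?k \<in> ring_iso B A" by (rule ring_iso_set_sym[OF A.ring_axioms h(1)])
  have "?k (r \<odot>\<^bsub>B\<^esub> y) = r \<odot>\<^bsub>A\<^esub> ?k y" if y: "y \<in> carrier B" for r y
  proof -
    have ky: "?k y \<in> carrier A" "h (?k y) = y"
      using h(3) y by (auto simp: bij_betw_def inv_into_into f_inv_into_f)
    then have "h (r \<odot>\<^bsub>A\<^esub> ?k y) = r \<odot>\<^bsub>B\<^esub> y" by (simp add: alg_homD(5)[OF h(2)])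
    then show ?thesis
      using inv_into_f_f[of h "carrier A" "r \<odot>\<^bsub>A\<^esub> ?k y"] h(3) ky by (auto simp: bij_betw_def)
  qed
  then show ?thesis using k by (simp add: alg_iso_def)
qed

lemma alg_hom_cong:
  assumes "ralg A" "f \<in> alg_hom A B" "\<And>x. x \<in> carrier A \<Longrightarrow> f x = g x"
  shows "g \<in> alg_hom A B"
proof -
  interpret A: ralg A by fact
  note f = alg_homD[OF assms(2)]
  show ?thesis
    by (rule alg_homI) (simp_all add: assms(3)[symmetric] f)
qed

lemma alg_iso_cong:
  assumes "ralg A" "f \<in> alg_iso A B" "\<And>x. x \<in> carrier A \<Longrightarrow> f x = g x"
  shows "g \<in> alg_iso A B"
  using alg_hom_cong[OF assms(1) _ assms(3)] assms(2) bij_betw_cong[of "carrier A" f g, OF assms(3)]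
  by (auto simp: alg_iso_def')

lemma alg_hom_subalgebra:
  assumes "h \<in> alg_hom A B" "C \<subseteq> carrier A"
  shows "h \<in> alg_hom (A\<lparr>carrier := C\<rparr>) B"
  using alg_homD[OF assms(1)] assms(2) by (intro alg_homI) (auto simp: subset_eq)

lemma alg_hom_corestrict:
  assumes "h \<in> alg_hom A B" "h ` carrier A = C"
  shows "h \<in> alg_hom A (B\<lparr>carrier := C\<rparr>)"
  using alg_homD[OF assms(1)] assms(2) by (intro alg_homI) auto

section \<open>The free algebra and its universal property\<close>

lemma poly_one_eq: "Poly_Mapping.single [] 1 = (1 :: 'x list \<Rightarrow>\<^sub>0 'r::comm_ring_1)"
  unfolding zero_list_def[symmetric] by (rule single_one)

lemma ralg_free_algebra: "ralg (free_algebra S :: ('r::comm_ring_1, 'x list \<Rightarrow>\<^sub>0 'r) module)"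
proof -
  interpret ring "free_algebra S :: ('r, 'x list \<Rightarrow>\<^sub>0 'r) module" by (rule ring_free_algebra)
  \<comment> \<open>Scalars are central: the empty word is neutral on both sides of a concatenation,
    and the coefficients commute.\<close>
  have comm: "x * (scal r * y) = scal r * (x * y)" for x y :: "'x list \<Rightarrow>\<^sub>0 'r" and r
  proof -
    have "x * scal r = scal r * x"
    proof (induction x rule: Poly_Mapping.update_induct)
      case (update f a b)
      have "Poly_Mapping.update a b f = f + Poly_Mapping.single a b"
        using update(1) by (intro poly_mapping_eqI)
          (auto simp: lookup_update lookup_add lookup_single in_keys_iff when_def)
      moreover have "Poly_Mapping.single a b * scal r = scal r * Poly_Mapping.single a b"
        by (simp only: Poly_Mapping.mult_single plus_list_def append_Nil append_Nil2 mult.commute)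
      ultimately show ?case
        using update(3) by (simp only: distrib_left distrib_right)
    qed simp
    then show ?thesis by (simp only: mult.assoc[symmetric])
  qed
  have keys: "Poly_Mapping.keys (scal r * x) \<subseteq> Poly_Mapping.keys x" for x :: "'x list \<Rightarrow>\<^sub>0 'r" and r
    using Poly_Mapping.keys_mult[of "scal r" x] by (auto simp: plus_list_def split: if_splits)
  have scal: "scal (r * s) = scal r * (scal s :: 'x list \<Rightarrow>\<^sub>0 'r)" "scal 1 = (1 :: 'x list \<Rightarrow>\<^sub>0 'r)" for r s
    by (simp_all add: Poly_Mapping.mult_single plus_list_def poly_one_eq)
  show ?thesis
  proof (rule ralg.intro[OF ring_axioms], rule ralg_axioms.intro)
    fix x r assume "x \<in> carrier (free_algebra S :: ('r, 'x list \<Rightarrow>\<^sub>0 'r) module)"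
    then show "r \<odot>\<^bsub>free_algebra S\<^esub> x \<in> carrier (free_algebra S)"
      using keys[of r x] by (auto simp: free_algebra_def)
  qed (simp_all add: free_algebra_def scal Poly_Mapping.single_add distrib_left distrib_right mult.assoc,
      (rule comm)?)
qed

lemma free_algebra_simps [simp]:
  "f \<otimes>\<^bsub>free_algebra S\<^esub> g = f * g" "f \<oplus>\<^bsub>free_algebra S\<^esub> g = f + g"
  "\<one>\<^bsub>free_algebra S\<^esub> = 1" "\<zero>\<^bsub>free_algebra S\<^esub> = 0" "r \<odot>\<^bsub>free_algebra S\<^esub> f = scal r * f"
  by (simp_all add: free_algebra_def)

lemma carrier_free_algebra: "f \<in> carrier (free_algebra S) \<longleftrightarrow> Poly_Mapping.keys f \<subseteq> lists S"
  by (simp add: free_algebra_def)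

lemma free_algebra_closed [simp]:
  fixes f g :: "'x list \<Rightarrow>\<^sub>0 'r::comm_ring_1"
  shows "(0 :: 'x list \<Rightarrow>\<^sub>0 'r) \<in> carrier (free_algebra S)"
    and "(1 :: 'x list \<Rightarrow>\<^sub>0 'r) \<in> carrier (free_algebra S)"
    and "f \<in> carrier (free_algebra S) \<Longrightarrow> g \<in> carrier (free_algebra S) \<Longrightarrow> f * g \<in> carrier (free_algebra S)"
    and "f \<in> carrier (free_algebra S) \<Longrightarrow> g \<in> carrier (free_algebra S) \<Longrightarrow> f + g \<in> carrier (free_algebra S)"
    and "f \<in> carrier (free_algebra S) \<Longrightarrow> g \<in> carrier (free_algebra S) \<Longrightarrow> f - g \<in> carrier (free_algebra S)"
    and "(scal r :: 'x list \<Rightarrow>\<^sub>0 'r) \<in> carrier (free_algebra S)"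
    and "x \<in> S \<Longrightarrow> (gen x :: 'x list \<Rightarrow>\<^sub>0 'r) \<in> carrier (free_algebra S)"
proof -
  show "f * g \<in> carrier (free_algebra S)"
    if "f \<in> carrier (free_algebra S)" "g \<in> carrier (free_algebra S)"
    using keys_mult[of f g] that by (fastforce simp: carrier_free_algebra plus_list_def)
  show "f + g \<in> carrier (free_algebra S)"
    if "f \<in> carrier (free_algebra S)" "g \<in> carrier (free_algebra S)"
    using that Poly_Mapping.keys_add[of f g] unfolding carrier_free_algebra by blast
  show "f - g \<in> carrier (free_algebra S)"
    if "f \<in> carrier (free_algebra S)" "g \<in> carrier (free_algebra S)"
    using that Poly_Mapping.keys_diff[of f g] unfolding carrier_free_algebra by blast
qed (auto simp: carrier_free_algebra zero_list_def split: if_splits)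

lemma free_algebra_minus:
  assumes "f \<in> carrier (free_algebra S)" "g \<in> carrier (free_algebra S)"
  shows "f \<ominus>\<^bsub>free_algebra S\<^esub> g = f - g"
proof -
  interpret ralg "free_algebra S :: ('b, 'a list \<Rightarrow>\<^sub>0 'b) module" by (rule ralg_free_algebra)
  have "\<ominus>\<^bsub>free_algebra S\<^esub> g = - g"
    using assms by (intro minus_equality) (auto simp: carrier_free_algebra)
  then show ?thesis by (simp add: a_minus_def)
qed

text \<open>A fresh key only enlarges the support, so membership in the free algebra on
  \<open>S\<close> passes to the word that is split off and to the remainder.\<close>

lemma poly_mapping_single_induct [consumes 1, case_names zero add]:
  fixes f :: "'x list \<Rightarrow>\<^sub>0 'r::comm_ring_1"
  assumes "f \<in> carrier (free_algebra S)" "P 0"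
    and "\<And>w r f. w \<in> lists S \<Longrightarrow> f \<in> carrier (free_algebra S) \<Longrightarrow> P f \<Longrightarrow> P (Poly_Mapping.single w r + f)"
  shows "P f"
  using assms(1)
proof (induction f rule: Poly_Mapping.update_induct)
  case (update f a b)
  have "Poly_Mapping.update a b f = Poly_Mapping.single a b + f"
    using update(1) by (intro poly_mapping_eqI)
      (auto simp: lookup_update lookup_add lookup_single in_keys_iff when_def)
  moreover have "a \<in> lists S" "f \<in> carrier (free_algebra S)"
    using update(2,4) by (auto simp: carrier_free_algebra Poly_Mapping.keys_update)
  ultimately show ?case using assms(3)[of a f b] update(3) by simp
qed (use assms(2) in auto)

definition ev :: "('r::comm_ring_1, 'b) module \<Rightarrow> ('x \<Rightarrow> 'b) \<Rightarrow> ('x list \<Rightarrow>\<^sub>0 'r) \<Rightarrow> 'b" where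
  "ev A \<phi> f = (\<Oplus>\<^bsub>A\<^esub>w\<in>Poly_Mapping.keys f. Poly_Mapping.lookup f w \<odot>\<^bsub>A\<^esub> mprod A (map \<phi> w))"

text \<open>Existence half of the universal property. The work lies in multiplicativity, which is
  reduced to concatenation of words by linearity in one factor after the other.\<close>

lemma (in ralg)
  fixes \<phi> :: "'x \<Rightarrow> 'b"
  assumes \<phi>: "\<And>x. x \<in> S \<Longrightarrow> \<phi> x \<in> carrier A"
  shows ev_alg_hom: "ev A \<phi> \<in> alg_hom (free_algebra S) A"
    and ev_gen: "x \<in> S \<Longrightarrow> ev A \<phi> (gen x) = \<phi> x"
proof -
  have mono [simp]: "mprod A (map \<phi> w) \<in> carrier A" if "w \<in> lists S" for w
    using that \<phi> by (intro mprod_closed) auto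
  \<comment> \<open>The sum may run over any finite set of words containing the support; this gives
    two polynomials a common index set.\<close>
  have sup: "ev A \<phi> f = (\<Oplus>w\<in>W. Poly_Mapping.lookup f w \<odot> mprod A (map \<phi> w))"
    if "finite W" "Poly_Mapping.keys f \<subseteq> W" "W \<subseteq> lists S" for f W
  proof -
    have "Poly_Mapping.lookup f i \<odot> mprod A (map \<phi> i) = \<zero>" if i: "i \<in> W - Poly_Mapping.keys f" for i
    proof -
      have "i \<in> lists S" "Poly_Mapping.lookup f i = 0"
        using that \<open>W \<subseteq> lists S\<close> by (auto simp: in_keys_iff)
      then show ?thesis by simp
    qed
    moreover have "Poly_Mapping.lookup f i \<odot> mprod A (map \<phi> i) \<in> carrier A" if "i \<in> W" for i
      using that \<open>W \<subseteq> lists S\<close> by (intro smult_closed mono) auto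
    ultimately show ?thesis
      unfolding ev_def by (intro add.finprod_mono_neutral_cong_left) (use that in auto)
  qed
  have add: "ev A \<phi> (f + g) = ev A \<phi> f \<oplus> ev A \<phi> g"
    if "f \<in> carrier (free_algebra S)" "g \<in> carrier (free_algebra S)" for f g
  proof -
    let ?W = "Poly_Mapping.keys f \<union> Poly_Mapping.keys g"
    have W: "finite ?W" "?W \<subseteq> lists S" using that by (auto simp: carrier_free_algebra)
    have tm: "r \<odot> mprod A (map \<phi> i) \<in> carrier A" if "i \<in> ?W" for r i
      using that W by (intro smult_closed mono) auto
    have "ev A \<phi> (f + g) = (\<Oplus>w\<in>?W. Poly_Mapping.lookup (f + g) w \<odot> mprod A (map \<phi> w))"
      using W Poly_Mapping.keys_add[of f g] by (intro sup) auto
    also have "\<dots> = (\<Oplus>w\<in>?W. Poly_Mapping.lookup f w \<odot> mprod A (map \<phi> w) \<oplus>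
                              Poly_Mapping.lookup g w \<odot> mprod A (map \<phi> w))"
    proof (rule add.finprod_cong')
      fix i assume "i \<in> ?W"
      then have "i \<in> lists S" using W by blast
      then show "Poly_Mapping.lookup (f + g) i \<odot> mprod A (map \<phi> i) =
         Poly_Mapping.lookup f i \<odot> mprod A (map \<phi> i) \<oplus> Poly_Mapping.lookup g i \<odot> mprod A (map \<phi> i)"
        by (simp add: lookup_add smult_l_distr)
    qed (use tm in auto)
    also have "\<dots> = (\<Oplus>w\<in>?W. Poly_Mapping.lookup f w \<odot> mprod A (map \<phi> w)) \<oplus>
                    (\<Oplus>w\<in>?W. Poly_Mapping.lookup g w \<odot> mprod A (map \<phi> w))"
      by (rule add.finprod_multf) (use tm in auto)
    also have "\<dots> = ev A \<phi> f \<oplus> ev A \<phi> g"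
      using W by (subst (1 2) sup[symmetric, of ?W]) auto
    finally show ?thesis .
  qed
  have single: "ev A \<phi> (Poly_Mapping.single w r) = r \<odot> mprod A (map \<phi> w)" if "w \<in> lists S" for w r
  proof -
    have "ev A \<phi> (Poly_Mapping.single w r) =
        (\<Oplus>v\<in>{w}. Poly_Mapping.lookup (Poly_Mapping.single w r) v \<odot> mprod A (map \<phi> v))"
      using that by (intro sup) auto
    then show ?thesis using mono[OF that] by (simp add: add.finprod_insert)
  qed
  have zero: "ev A \<phi> 0 = \<zero>" by (simp add: ev_def)
  have carr: "ev A \<phi> f \<in> carrier A" if "f \<in> carrier (free_algebra S)" for f
    using that
  proof (induction rule: poly_mapping_single_induct)
    case (add w r f)
    have "Poly_Mapping.single w r \<in> carrier (free_algebra S)" using add(1) by (auto simp: carrier_free_algebra)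
    then show ?case using add mono[OF add(1)] by (simp add: \<open>\<And>f g. _ \<Longrightarrow> _ \<Longrightarrow> ev A \<phi> (f + g) = _\<close> single)
  qed (simp add: zero)
  have sc: "Poly_Mapping.single w r \<in> carrier (free_algebra S)" if "w \<in> lists S" for w :: "'x list" and r :: 'r
    using that by (auto simp: carrier_free_algebra)
  \<comment> \<open>Multiplicativity with a monomial on the left, by splitting the right factor; the
    left factor is split afterwards.\<close>
  have mult1: "ev A \<phi> (Poly_Mapping.single w r * g) = (r \<odot> mprod A (map \<phi> w)) \<otimes> ev A \<phi> g"
    if "g \<in> carrier (free_algebra S)" "w \<in> lists S" for g w r
    using that(1)
  proof (induction rule: poly_mapping_single_induct)
    case (add v s g)
    have wv: "w @ v \<in> lists S" using that(2) add(1) by simp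
    have m: "mprod A (map \<phi> (w @ v)) = mprod A (map \<phi> w) \<otimes> mprod A (map \<phi> v)"
      unfolding map_append using that(2) add(1) \<phi> by (intro mprod_append) auto
    have "ev A \<phi> (Poly_Mapping.single w r * (Poly_Mapping.single v s + g)) =
      ev A \<phi> (Poly_Mapping.single (w @ v) (r * s) + Poly_Mapping.single w r * g)"
      by (simp add: distrib_left Poly_Mapping.mult_single plus_list_def)
    also have "\<dots> = (r * s) \<odot> mprod A (map \<phi> (w @ v)) \<oplus> (r \<odot> mprod A (map \<phi> w)) \<otimes> ev A \<phi> g"
      using \<open>\<And>f g. _ \<Longrightarrow> _ \<Longrightarrow> ev A \<phi> (f + g) = _\<close>[OF sc[OF wv] free_algebra_closed(3)[OF sc[OF that(2)] add(2)]]
      by (simp only: single[OF wv] add(3))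
    also have "\<dots> = (r \<odot> mprod A (map \<phi> w)) \<otimes> (s \<odot> mprod A (map \<phi> v) \<oplus> ev A \<phi> g)"
      using mono[OF that(2)] mono[OF add(1)] carr[OF add(2)]
      by (simp add: m r_distr smult_mult_l smult_mult_r smult_assoc smult_left_commute[of _ r s] del: map_append)
    also have "s \<odot> mprod A (map \<phi> v) \<oplus> ev A \<phi> g = ev A \<phi> (Poly_Mapping.single v s + g)"
      using \<open>\<And>f g. _ \<Longrightarrow> _ \<Longrightarrow> ev A \<phi> (f + g) = _\<close>[OF sc[OF add(1)] add(2)] by (simp only: single[OF add(1)])
    finally show ?case .
  qed (use that mono in \<open>simp add: zero\<close>)
  have mult: "ev A \<phi> (f * g) = ev A \<phi> f \<otimes> ev A \<phi> g"
    if "f \<in> carrier (free_algebra S)" "g \<in> carrier (free_algebra S)" for f g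
    using that(1)
  proof (induction rule: poly_mapping_single_induct)
    case (add w r f)
    have "ev A \<phi> ((Poly_Mapping.single w r + f) * g) =
        ev A \<phi> (Poly_Mapping.single w r * g) \<oplus> ev A \<phi> (f * g)"
      using \<open>\<And>f g. _ \<Longrightarrow> _ \<Longrightarrow> ev A \<phi> (f + g) = _\<close> sc[OF add(1)] add(2) that(2)
      by (simp add: distrib_right)
    also have "\<dots> = (ev A \<phi> (Poly_Mapping.single w r) \<oplus> ev A \<phi> f) \<otimes> ev A \<phi> g"
      using mult1[OF that(2) add(1)] add(3) carr that(2) add(2) mono[OF add(1)]
      by (simp add: single[OF add(1)] l_distr)
    also have "\<dots> = ev A \<phi> (Poly_Mapping.single w r + f) \<otimes> ev A \<phi> g"
      using \<open>\<And>f g. _ \<Longrightarrow> _ \<Longrightarrow> ev A \<phi> (f + g) = _\<close> sc[OF add(1)] add(2) by simp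
    finally show ?case .
  qed (use that carr in \<open>simp add: zero\<close>)
  have one: "ev A \<phi> 1 = \<one>"
    using single[of "[]" 1] by (simp add: poly_one_eq)
  show "ev A \<phi> \<in> alg_hom (free_algebra S) A"
  proof (rule alg_homI)
    fix r f assume f: "f \<in> carrier (free_algebra S :: ('r, 'x list \<Rightarrow>\<^sub>0 'r) module)"
    show "ev A \<phi> (r \<odot>\<^bsub>free_algebra S\<^esub> f) = r \<odot> ev A \<phi> f"
      using mult1[OF f, of "[]" r] carr[OF f] by (simp add: smult_mult_l)
  qed (use add mult carr one in auto)
  show "x \<in> S \<Longrightarrow> ev A \<phi> (gen x) = \<phi> x" using single[of "[x]" 1] \<phi> by simp
qed

text \<open>Uniqueness half of the universal property: each term is a scalar times a product of
  generators.\<close>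

lemma alg_hom_free_eqI:
  fixes f :: "'x list \<Rightarrow>\<^sub>0 'r::comm_ring_1"
  assumes "ralg B" "h \<in> alg_hom (free_algebra S) B" "k \<in> alg_hom (free_algebra S) B"
    and eq: "\<And>x. x \<in> S \<Longrightarrow> h (gen x) = k (gen x)" and "f \<in> carrier (free_algebra S)"
  shows "h f = k f"
  using assms(5)
proof (induction rule: poly_mapping_single_induct)
  case zero
  show ?case using alg_hom_zero[OF ralg_free_algebra assms(1)] assms(2,3) by (metis free_algebra_simps(4))
next
  case (add w r f)
  note h = alg_homD[OF assms(2)] and k = alg_homD[OF assms(3)]
  have w: "(Poly_Mapping.single w 1 :: 'x list \<Rightarrow>\<^sub>0 'r) \<in> carrier (free_algebra S) \<and> 
     h (Poly_Mapping.single w 1) = k (Poly_Mapping.single w 1)" using add(1)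
  proof (induction w)
    case Nil
    show ?case using h(4) k(4) by (simp add: poly_one_eq)
  next
    case (Cons x w)
    have e: "Poly_Mapping.single (x # w) (1::'r) = gen x * Poly_Mapping.single w 1"
      by (simp add: Poly_Mapping.mult_single plus_list_def)
    show ?case using Cons h(2)[of "gen x" "Poly_Mapping.single w 1"] k(2)[of "gen x" "Poly_Mapping.single w 1"] eq[of x]
      unfolding e by auto
  qed
  have e: "Poly_Mapping.single w r = scal r * Poly_Mapping.single w 1"
    by (simp add: Poly_Mapping.mult_single plus_list_def)
  have s: "h (scal r * Poly_Mapping.single w 1) = k (scal r * Poly_Mapping.single w 1)"
    using h(5)[of "Poly_Mapping.single w 1" r] k(5)[of "Poly_Mapping.single w 1" r] w by simp
  have c: "scal r * Poly_Mapping.single w 1 \<in> carrier (free_algebra S)" using w by simp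
  show ?case unfolding e
    using h(3)[OF c add(2)] k(3)[OF c add(2)] s add(3) by simp
qed

text \<open>\<open>pres_algebra\<close> repacks the fields of a quotient ring into a module record;
  the ring axioms depend on these fields only.\<close>

lemma ring_same_operations:
  assumes "ring Q" "carrier M = carrier Q" "mult M = mult Q" "one M = one Q" "zero M = zero Q"
    "add M = add Q"
  shows "ring M"
proof -
  interpret Q: ring Q by fact
  show ?thesis
  proof (rule ringI)
    show "abelian_group M"
    proof (rule abelian_groupI)
      fix x assume "x \<in> carrier M"
      then show "\<exists>y\<in>carrier M. y \<oplus>\<^bsub>M\<^esub> x = \<zero>\<^bsub>M\<^esub>"
        using Q.a_inv_closed[of x] Q.l_neg[of x] assms by auto
    qed (auto simp: assms Q.a_ac)
    show "monoid M" by (rule monoidI) (auto simp: assms Q.m_assoc)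
  qed (auto simp: assms Q.l_distr Q.r_distr)
qed

section \<open>Quotients of the free algebra by relations\<close>

context
  fixes S :: "'x set" and Rel :: "('x list \<Rightarrow>\<^sub>0 'r::comm_ring_1) set"
  assumes Rel: "Rel \<subseteq> carrier (free_algebra S)"
begin

interpretation FA: ralg "free_algebra S :: ('r, 'x list \<Rightarrow>\<^sub>0 'r) module"
  by (rule ralg_free_algebra)

interpretation I: ideal "pres_ideal S Rel" "free_algebra S"
  unfolding pres_ideal_def by (rule FA.genideal_ideal[OF Rel])

lemma pres_class_eq_iff:
  assumes "f \<in> carrier (free_algebra S)" "g \<in> carrier (free_algebra S)"
  shows "pres_class S Rel f = pres_class S Rel g \<longleftrightarrow> f - g \<in> pres_ideal S Rel"
  using FA.quotient_eq_iff_same_a_r_cos[OF I.ideal_axioms assms]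
  by (simp add: pres_class_def free_algebra_minus assms)

lemma pres_class_rep:
  assumes "f \<in> carrier (free_algebra S)" "g \<in> pres_class S Rel f"
  shows "g \<in> carrier (free_algebra S)" "pres_class S Rel g = pres_class S Rel f"
proof -
  from assms(2) obtain i where i: "i \<in> pres_ideal S Rel" "g = i + f"
    by (auto simp: pres_class_def a_r_coset_def' )
  have ic: "i \<in> carrier (free_algebra S)" using I.Icarr[OF i(1)] .
  show g: "g \<in> carrier (free_algebra S)" using ic i(2) assms(1) by simp
  show "pres_class S Rel g = pres_class S Rel f"
    using pres_class_eq_iff[OF g assms(1)] i by simp
qed

lemma pres_class_self:
  assumes "f \<in> carrier (free_algebra S)"
  shows "f \<in> pres_class S Rel f"
  unfolding pres_class_def by (rule I.a_rcos_self[OF assms])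

lemma pres_ideal_smult:
  assumes "f \<in> pres_ideal S Rel"
  shows "scal r * f \<in> pres_ideal S Rel"
  using I.I_l_closed[OF assms, of "scal r"] by simp

lemma carrier_pres_algebra:
  "carrier (pres_algebra S Rel) = pres_class S Rel ` carrier (free_algebra S)"
  by (auto simp: pres_algebra_def Let_def FactRing_def A_RCOSETS_def' pres_class_def)

lemma ring_pres_algebra: "ring (pres_algebra S Rel)"
  by (rule ring_same_operations[OF I.quotient_is_ring]) (simp_all add: pres_algebra_def Let_def)

lemma pres_class_alg_hom: "pres_class S Rel \<in> alg_hom (free_algebra S) (pres_algebra S Rel)"
proof (rule alg_homI)
  note h = I.rcos_ring_hom
  have e: "pres_class S Rel = (+>\<^bsub>free_algebra S\<^esub>) (pres_ideal S Rel)"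
    by (rule ext) (simp add: pres_class_def)
  show "pres_class S Rel f \<in> carrier (pres_algebra S Rel)" if "f \<in> carrier (free_algebra S)" for f
    using that by (auto simp: carrier_pres_algebra)
  show "pres_class S Rel (f \<otimes>\<^bsub>free_algebra S\<^esub> g) =
      pres_class S Rel f \<otimes>\<^bsub>pres_algebra S Rel\<^esub> pres_class S Rel g"
    if "f \<in> carrier (free_algebra S)" "g \<in> carrier (free_algebra S)" for f g
    using ring_hom_mult[OF h that] by (simp add: e pres_algebra_def Let_def)
  show "pres_class S Rel (f \<oplus>\<^bsub>free_algebra S\<^esub> g) =
      pres_class S Rel f \<oplus>\<^bsub>pres_algebra S Rel\<^esub> pres_class S Rel g"
    if "f \<in> carrier (free_algebra S)" "g \<in> carrier (free_algebra S)" for f g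
    using ring_hom_add[OF h that] by (simp add: e pres_algebra_def Let_def)
  show "pres_class S Rel \<one>\<^bsub>free_algebra S\<^esub> = \<one>\<^bsub>pres_algebra S Rel\<^esub>"
    using ring_hom_one[OF h] by (simp add: e pres_algebra_def Let_def)
  show "pres_class S Rel (r \<odot>\<^bsub>free_algebra S\<^esub> f) = r \<odot>\<^bsub>pres_algebra S Rel\<^esub> pres_class S Rel f"
    if f: "f \<in> carrier (free_algebra S)" for r f
  proof -
    \<comment> \<open>Scalar multiplication in the quotient is a union over all representatives. The
      ideal is closed under scalars, so all of them give the same class and the union is that
      class.\<close>
    have "pres_class S Rel (scal r * g) = pres_class S Rel (scal r * f)" if "g \<in> pres_class S Rel f" for g
    proof -
      have g: "g \<in> carrier (free_algebra S)" "g - f \<in> pres_ideal S Rel"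
        using pres_class_rep[OF f that] pres_class_eq_iff[of g f] f by auto
      show ?thesis
        using pres_ideal_smult[OF g(2), of r] g(1) f
        by (subst pres_class_eq_iff) (simp_all add: right_diff_distrib)
    qed
    then have "(\<Union>g\<in>pres_class S Rel f. pres_class S Rel (scal r * g)) = pres_class S Rel (scal r * f)"
      using pres_class_self[OF f] by blast
    then show ?thesis by (simp add: pres_algebra_def Let_def)
  qed
qed

lemma ralg_pres_algebra: "ralg (pres_algebra S Rel)"
proof -
  interpret ring "pres_algebra S Rel" by (rule ring_pres_algebra)
  note h = alg_homD[OF pres_class_alg_hom]
  have ex: "\<exists>f\<in>carrier (free_algebra S). x = pres_class S Rel f"
    if "x \<in> carrier (pres_algebra S Rel)" for x
    using that by (auto simp: carrier_pres_algebra)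
  show ?thesis
  proof (rule ralg.intro[OF ring_axioms], rule ralg_axioms.intro)
    fix r s x y
    assume x: "x \<in> carrier (pres_algebra S Rel)"
    obtain f where f: "f \<in> carrier (free_algebra S)" "x = pres_class S Rel f" using ex[OF x] by auto
    show "r \<odot>\<^bsub>pres_algebra S Rel\<^esub> x \<in> carrier (pres_algebra S Rel)"
      using h(1)[OF FA.smult_closed[OF f(1)], of r] h(5)[OF f(1), of r] f(2) by simp
    show "(r + s) \<odot>\<^bsub>pres_algebra S Rel\<^esub> x =
        r \<odot>\<^bsub>pres_algebra S Rel\<^esub> x \<oplus>\<^bsub>pres_algebra S Rel\<^esub> s \<odot>\<^bsub>pres_algebra S Rel\<^esub> x"
      unfolding f(2) using f(1) by (simp only: h(3,5)[symmetric] FA.smult_closed FA.smult_l_distr)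
    show "(r * s) \<odot>\<^bsub>pres_algebra S Rel\<^esub> x =
        r \<odot>\<^bsub>pres_algebra S Rel\<^esub> (s \<odot>\<^bsub>pres_algebra S Rel\<^esub> x)"
      unfolding f(2) using f(1) by (simp only: h(5)[symmetric] FA.smult_closed FA.smult_assoc)
    show "1 \<odot>\<^bsub>pres_algebra S Rel\<^esub> x = x"
      unfolding f(2) using f(1) by (simp only: h(5)[symmetric] FA.smult_one)
    assume y: "y \<in> carrier (pres_algebra S Rel)"
    obtain g where g: "g \<in> carrier (free_algebra S)" "y = pres_class S Rel g" using ex[OF y] by auto
    show "r \<odot>\<^bsub>pres_algebra S Rel\<^esub> (x \<oplus>\<^bsub>pres_algebra S Rel\<^esub> y) =
        r \<odot>\<^bsub>pres_algebra S Rel\<^esub> x \<oplus>\<^bsub>pres_algebra S Rel\<^esub> r \<odot>\<^bsub>pres_algebra S Rel\<^esub> y"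
      unfolding f(2) g(2) using f(1) g(1)
      by (simp only: h(3,5)[symmetric] FA.smult_closed FA.a_closed FA.smult_r_distr)
    show "(r \<odot>\<^bsub>pres_algebra S Rel\<^esub> x) \<otimes>\<^bsub>pres_algebra S Rel\<^esub> y =
        r \<odot>\<^bsub>pres_algebra S Rel\<^esub> (x \<otimes>\<^bsub>pres_algebra S Rel\<^esub> y)"
      unfolding f(2) g(2) using f(1) g(1)
      by (simp only: h(2,5)[symmetric] FA.smult_closed FA.m_closed FA.smult_mult_l)
    show "x \<otimes>\<^bsub>pres_algebra S Rel\<^esub> (r \<odot>\<^bsub>pres_algebra S Rel\<^esub> y) =
        r \<odot>\<^bsub>pres_algebra S Rel\<^esub> (x \<otimes>\<^bsub>pres_algebra S Rel\<^esub> y)"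
      unfolding f(2) g(2) using f(1) g(1)
      by (simp only: h(2,5)[symmetric] FA.smult_closed FA.m_closed FA.smult_mult_r)
  qed
qed

lemma pres_class_eq_zero_iff:
  assumes "f \<in> carrier (free_algebra S)"
  shows "pres_class S Rel f = \<zero>\<^bsub>pres_algebra S Rel\<^esub> \<longleftrightarrow> f \<in> pres_ideal S Rel"
proof -
  have "pres_class S Rel 0 = \<zero>\<^bsub>pres_algebra S Rel\<^esub>"
    using alg_hom_zero[OF ralg_free_algebra ralg_pres_algebra pres_class_alg_hom] by simp
  then show ?thesis using pres_class_eq_iff[OF assms free_algebra_closed(1)] by simp
qed

lemma pres_class_rel: "f \<in> Rel \<Longrightarrow> pres_class S Rel f = \<zero>\<^bsub>pres_algebra S Rel\<^esub>"
  using pres_class_eq_zero_iff[of f] Rel FA.genideal_self[OF Rel] by (auto simp: pres_ideal_def)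

lemma pres_class_rel_eq:
  assumes "f - g \<in> Rel" "f \<in> carrier (free_algebra S)" "g \<in> carrier (free_algebra S)"
  shows "pres_class S Rel f = pres_class S Rel g"
  using pres_class_eq_iff[OF assms(2,3)] pres_class_eq_zero_iff[of "f - g"] pres_class_rel[OF assms(1)] assms
  by simp

text \<open>The kernel of the evaluation is an ideal containing \<open>Rel\<close>, hence it
  contains \<open>pres_ideal S Rel\<close>. The value of \<open>h\<close> at a class is therefore
  independent of the representative picked by \<open>SOME\<close>.\<close>

lemma pres_algebra_universal:
  fixes \<phi> :: "'x \<Rightarrow> 'b"
  assumes B: "ralg B" and \<phi>: "\<And>x. x \<in> S \<Longrightarrow> \<phi> x \<in> carrier B"
    and rel: "\<And>f. f \<in> Rel \<Longrightarrow> ev B \<phi> f = \<zero>\<^bsub>B\<^esub>"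
  obtains h where "h \<in> alg_hom (pres_algebra S Rel) B"
    and "\<And>f. f \<in> carrier (free_algebra S) \<Longrightarrow> h (pres_class S Rel f) = ev B \<phi> f"
proof -
  interpret B: ralg B by fact
  note E = B.ev_alg_hom[of S \<phi>, OF \<phi>] note e = alg_homD[OF E]
  let ?K = "{f \<in> carrier (free_algebra S). ev B \<phi> f = \<zero>\<^bsub>B\<^esub>}"
  have sm: "ev B \<phi> (f - g) = ev B \<phi> f \<ominus>\<^bsub>B\<^esub> ev B \<phi> g"
    if "f \<in> carrier (free_algebra S)" "g \<in> carrier (free_algebra S)" for f g
    using alg_hom_minus[OF ralg_free_algebra B E that] free_algebra_minus[OF that] by simp
  have "ring_hom_ring (free_algebra S) B (ev B \<phi>)"
    using E by (intro ring_hom_ringI2[OF FA.ring_axioms B.ring_axioms]) (simp add: alg_hom_def)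
  then interpret H: ring_hom_ring "free_algebra S" B "ev B \<phi>" .
  have "ideal ?K (free_algebra S)"
    using H.kernel_is_ideal unfolding a_kernel_def' .
  moreover have "Rel \<subseteq> ?K" using rel Rel by auto
  ultimately have K: "pres_ideal S Rel \<subseteq> ?K"
    unfolding pres_ideal_def by (rule FA.genideal_minimal)
  define h where "h K = ev B \<phi> (SOME f. f \<in> carrier (free_algebra S) \<and> pres_class S Rel f = K)" for K
  have h: "h (pres_class S Rel f) = ev B \<phi> f" if f: "f \<in> carrier (free_algebra S)" for f
  proof -
    define g where "g = (SOME g. g \<in> carrier (free_algebra S) \<and> pres_class S Rel g = pres_class S Rel f)"
    have g: "g \<in> carrier (free_algebra S) \<and> pres_class S Rel g = pres_class S Rel f"
      unfolding g_def by (rule someI[of _ f]) (use f in auto)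
    then have "g - f \<in> ?K" using pres_class_eq_iff[of g f] f K by auto
    then have "ev B \<phi> g \<ominus>\<^bsub>B\<^esub> ev B \<phi> f = \<zero>\<^bsub>B\<^esub>" using sm[of g f] g f by simp
    then show ?thesis using e(1)[of g] e(1)[of f] g f B.r_right_minus_eq[of "ev B \<phi> g" "ev B \<phi> f"]
      unfolding h_def g_def[symmetric] by simp
  qed
  have "h \<in> alg_hom (pres_algebra S Rel) B"
  proof (rule alg_homI)
    note p = alg_homD[OF pres_class_alg_hom]
    show "h x \<in> carrier B" if "x \<in> carrier (pres_algebra S Rel)" for x
      using that h e(1) by (auto simp: carrier_pres_algebra)
    show "h (x \<otimes>\<^bsub>pres_algebra S Rel\<^esub> y) = h x \<otimes>\<^bsub>B\<^esub> h y"
      if xy: "x \<in> carrier (pres_algebra S Rel)" "y \<in> carrier (pres_algebra S Rel)" for x y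
    proof -
      obtain f g where "f \<in> carrier (free_algebra S)" "x = pres_class S Rel f"
        "g \<in> carrier (free_algebra S)" "y = pres_class S Rel g"
        using xy by (auto simp: carrier_pres_algebra)
      then show ?thesis using p(2)[of f g, symmetric] e(2)[of f g] h by simp
    qed
    show "h (x \<oplus>\<^bsub>pres_algebra S Rel\<^esub> y) = h x \<oplus>\<^bsub>B\<^esub> h y"
      if xy: "x \<in> carrier (pres_algebra S Rel)" "y \<in> carrier (pres_algebra S Rel)" for x y
    proof -
      obtain f g where "f \<in> carrier (free_algebra S)" "x = pres_class S Rel f"
        "g \<in> carrier (free_algebra S)" "y = pres_class S Rel g"
        using xy by (auto simp: carrier_pres_algebra)
      then show ?thesis using p(3)[of f g, symmetric] e(3)[of f g] h by simp
    qed
    show "h \<one>\<^bsub>pres_algebra S Rel\<^esub> = \<one>\<^bsub>B\<^esub>" using p(4) h[of 1] e(4) by simp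
    show "h (r \<odot>\<^bsub>pres_algebra S Rel\<^esub> x) = r \<odot>\<^bsub>B\<^esub> h x" if x: "x \<in> carrier (pres_algebra S Rel)" for r x
    proof -
      obtain f where f: "f \<in> carrier (free_algebra S)" "x = pres_class S Rel f"
        using x by (auto simp: carrier_pres_algebra)
      then show ?thesis using p(5)[of f r, symmetric] e(5)[of f r] h[of f] h[of "scal r * f"] by simp
    qed
  qed
  then show ?thesis using h that by blast
qed

lemma alg_hom_pres_eqI:
  assumes B: "ralg B" and h: "h \<in> alg_hom (pres_algebra S Rel) B" and k: "k \<in> alg_hom (pres_algebra S Rel) B"
    and eq: "\<And>x. x \<in> S \<Longrightarrow> h (pres_class S Rel (gen x)) = k (pres_class S Rel (gen x))"
    and x: "x \<in> carrier (pres_algebra S Rel)"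
  shows "h x = k x"
proof -
  obtain f where f: "f \<in> carrier (free_algebra S)" "x = pres_class S Rel f"
    using x by (auto simp: carrier_pres_algebra)
  have "(h \<circ> pres_class S Rel) f = (k \<circ> pres_class S Rel) f"
    by (rule alg_hom_free_eqI[OF B alg_hom_comp[OF pres_class_alg_hom h] alg_hom_comp[OF pres_class_alg_hom k] _ f(1)])
      (simp add: eq)
  then show ?thesis using f(2) by simp
qed

end

section \<open>Partial representations\<close>

locale par_rep = ralg A + G: group G
  for A :: "('r::comm_ring_1, 'b) module" (structure) and G :: "('g, 'm) monoid_scheme" +
  fixes u :: "'g \<Rightarrow> 'b"
  assumes u_closed [simp]: "g \<in> carrier G \<Longrightarrow> u g \<in> carrier A"
    and u_one: "u \<one>\<^bsub>G\<^esub> = \<one>"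
    and u_rel1: "g \<in> carrier G \<Longrightarrow> h \<in> carrier G \<Longrightarrow>
      u (inv\<^bsub>G\<^esub> g) \<otimes> u g \<otimes> u h = u (inv\<^bsub>G\<^esub> g) \<otimes> u (g \<otimes>\<^bsub>G\<^esub> h)"
    and u_rel2: "g \<in> carrier G \<Longrightarrow> h \<in> carrier G \<Longrightarrow>
      u g \<otimes> u h \<otimes> u (inv\<^bsub>G\<^esub> h) = u (g \<otimes>\<^bsub>G\<^esub> h) \<otimes> u (inv\<^bsub>G\<^esub> h)"
begin

definition e :: "'g \<Rightarrow> 'b" where "e g = u g \<otimes> u (inv\<^bsub>G\<^esub> g)"

lemma e_closed [simp]: "g \<in> carrier G \<Longrightarrow> e g \<in> carrier A"
  by (simp add: e_def)

lemma u_inv_u: "g \<in> carrier G \<Longrightarrow> e g \<otimes> u g = u g"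
  using u_rel1[of "inv\<^bsub>G\<^esub> g" g] by (simp add: e_def u_one)

lemma u_u_inv: "g \<in> carrier G \<Longrightarrow> u g \<otimes> e (inv\<^bsub>G\<^esub> g) = u g"
  using u_inv_u[of g] by (simp add: e_def m_assoc)

lemma e_idem: "g \<in> carrier G \<Longrightarrow> e g \<otimes> e g = e g"
  using u_inv_u[of g] m_assoc[of "e g" "u g" "u (inv\<^bsub>G\<^esub> g)"] by (simp add: e_def[of g])

lemma e_u: "g \<in> carrier G \<Longrightarrow> h \<in> carrier G \<Longrightarrow> e g \<otimes> u h = u g \<otimes> u (inv\<^bsub>G\<^esub> g \<otimes>\<^bsub>G\<^esub> h)"
  using u_rel1[of "inv\<^bsub>G\<^esub> g" h] by (simp add: e_def)

text \<open>Both sides equal \<open>u (gh) u (inv h)\<close>: the left one by the right-hand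
  relation, the right one by the left-hand relation, because \<open>inv h\<close> is
  \<open>inv (gh) g\<close>.\<close>

lemma u_e:
  assumes [simp]: "g \<in> carrier G" "h \<in> carrier G"
  shows "u g \<otimes> e h = e (g \<otimes>\<^bsub>G\<^esub> h) \<otimes> u g"
proof -
  have "u g \<otimes> e h = u (g \<otimes>\<^bsub>G\<^esub> h) \<otimes> u (inv\<^bsub>G\<^esub> h)"
    using u_rel2[of g h] by (simp add: e_def m_assoc)
  also have "inv\<^bsub>G\<^esub> h = inv\<^bsub>G\<^esub> (g \<otimes>\<^bsub>G\<^esub> h) \<otimes>\<^bsub>G\<^esub> g"
    by (simp add: G.inv_mult_group G.m_assoc)
  also have "u (g \<otimes>\<^bsub>G\<^esub> h) \<otimes> u \<dots> = e (g \<otimes>\<^bsub>G\<^esub> h) \<otimes> u g"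
    by (rule e_u[symmetric]) auto
  finally show ?thesis .
qed

text \<open>Moving \<open>e h\<close> to the left past the two factors of \<open>e g\<close>
  translates its index first by \<open>inv g\<close> and then by \<open>g\<close>, so it emerges
  unchanged.\<close>

lemma e_comm:
  assumes [simp]: "g \<in> carrier G" "h \<in> carrier G"
  shows "e g \<otimes> e h = e h \<otimes> e g"
proof -
  have "e g \<otimes> e h = u g \<otimes> (e (inv\<^bsub>G\<^esub> g \<otimes>\<^bsub>G\<^esub> h) \<otimes> u (inv\<^bsub>G\<^esub> g))"
    by (simp add: e_def[of g] m_assoc u_e)
  also have "\<dots> = u g \<otimes> e (inv\<^bsub>G\<^esub> g \<otimes>\<^bsub>G\<^esub> h) \<otimes> u (inv\<^bsub>G\<^esub> g)"
    by (simp add: m_assoc)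
  also have "\<dots> = e h \<otimes> e g"
    by (subst u_e) (auto simp: e_def[of g] m_assoc G.m_assoc[symmetric])
  finally show ?thesis .
qed

lemma u_mult:
  assumes [simp]: "g \<in> carrier G" "h \<in> carrier G"
  shows "u g \<otimes> u h = e g \<otimes> u (g \<otimes>\<^bsub>G\<^esub> h)"
  by (subst e_u) (auto simp: G.m_assoc[symmetric])

text \<open>For words \<open>\<beta>\<close> and \<open>\<alpha>\<close> in place of
  \<open>g\<close> and \<open>h\<close>, the left side is the shape of the third relation of the
  subshift algebra. The product on the right is taken in the group, so letters may cancel in
  it.\<close>

lemma conj_e:
  assumes "g \<in> carrier G" "h \<in> carrier G"
  shows "u g \<otimes> u (inv\<^bsub>G\<^esub> h) \<otimes> u h \<otimes> u (inv\<^bsub>G\<^esub> g) = e (g \<otimes>\<^bsub>G\<^esub> inv\<^bsub>G\<^esub> h) \<otimes> e g"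
proof -
  have "u g \<otimes> u (inv\<^bsub>G\<^esub> h) \<otimes> u h \<otimes> u (inv\<^bsub>G\<^esub> g) = u g \<otimes> e (inv\<^bsub>G\<^esub> h) \<otimes> u (inv\<^bsub>G\<^esub> g)"
    using assms by (simp add: e_def m_assoc)
  then show ?thesis using assms by (simp add: u_e e_def[of g] m_assoc)
qed

end

text \<open>The right-hand relation follows from the left-hand one and commuting idempotents.
  Writing \<open>k\<close> for \<open>gh\<close>, \<open>u k u (inv h) = e k u g = e k e g u g = e g
  e k u g = e g u k u (inv h)\<close>, and \<open>e g u k\<close> is \<open>u g u h\<close>.\<close>

lemma par_repI:
  assumes "ralg A" "group G"
    and u [simp]: "\<And>g. g \<in> carrier G \<Longrightarrow> u g \<in> carrier A"
    and u_one: "u \<one>\<^bsub>G\<^esub> = \<one>\<^bsub>A\<^esub>"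
    and rel1: "\<And>g h. g \<in> carrier G \<Longrightarrow> h \<in> carrier G \<Longrightarrow>
      u (inv\<^bsub>G\<^esub> g) \<otimes>\<^bsub>A\<^esub> u g \<otimes>\<^bsub>A\<^esub> u h = u (inv\<^bsub>G\<^esub> g) \<otimes>\<^bsub>A\<^esub> u (g \<otimes>\<^bsub>G\<^esub> h)"
    and comm: "\<And>g h. g \<in> carrier G \<Longrightarrow> h \<in> carrier G \<Longrightarrow>
      (u g \<otimes>\<^bsub>A\<^esub> u (inv\<^bsub>G\<^esub> g)) \<otimes>\<^bsub>A\<^esub> (u h \<otimes>\<^bsub>A\<^esub> u (inv\<^bsub>G\<^esub> h)) =
      (u h \<otimes>\<^bsub>A\<^esub> u (inv\<^bsub>G\<^esub> h)) \<otimes>\<^bsub>A\<^esub> (u g \<otimes>\<^bsub>A\<^esub> u (inv\<^bsub>G\<^esub> g))"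
  shows "par_rep A G u"
proof -
  interpret A: ralg A by fact
  interpret G: group G by fact
  define e where "e g = u g \<otimes>\<^bsub>A\<^esub> u (inv\<^bsub>G\<^esub> g)" for g
  have ec [simp]: "e g \<in> carrier A" if "g \<in> carrier G" for g using that by (simp add: e_def)
  have eu: "e g \<otimes>\<^bsub>A\<^esub> u h = u g \<otimes>\<^bsub>A\<^esub> u (inv\<^bsub>G\<^esub> g \<otimes>\<^bsub>G\<^esub> h)" if "g \<in> carrier G" "h \<in> carrier G" for g h
    using rel1[of "inv\<^bsub>G\<^esub> g" h] that by (simp add: e_def)
  have euu: "e g \<otimes>\<^bsub>A\<^esub> u g = u g" if "g \<in> carrier G" for g
    using eu[OF that that] that by (simp add: u_one)
  have "u g \<otimes>\<^bsub>A\<^esub> u h \<otimes>\<^bsub>A\<^esub> u (inv\<^bsub>G\<^esub> h) = u (g \<otimes>\<^bsub>G\<^esub> h) \<otimes>\<^bsub>A\<^esub> u (inv\<^bsub>G\<^esub> h)"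
    if g [simp]: "g \<in> carrier G" and h [simp]: "h \<in> carrier G" for g h
  proof -
    let ?k = "g \<otimes>\<^bsub>G\<^esub> h"
    have k: "inv\<^bsub>G\<^esub> ?k \<otimes>\<^bsub>G\<^esub> g = inv\<^bsub>G\<^esub> h"
      by (simp add: G.inv_mult_group G.m_assoc)
    have 1: "e ?k \<otimes>\<^bsub>A\<^esub> u g = u ?k \<otimes>\<^bsub>A\<^esub> u (inv\<^bsub>G\<^esub> h)"
      using eu[of ?k g] by (simp add: k)
    have "u ?k \<otimes>\<^bsub>A\<^esub> u (inv\<^bsub>G\<^esub> h) = e ?k \<otimes>\<^bsub>A\<^esub> (e g \<otimes>\<^bsub>A\<^esub> u g)"
      by (simp add: 1 euu)
    also have "\<dots> = e g \<otimes>\<^bsub>A\<^esub> (e ?k \<otimes>\<^bsub>A\<^esub> u g)"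
      using comm[of g ?k] unfolding e_def[symmetric] by (simp add: A.m_assoc[symmetric])
    also have "\<dots> = (e g \<otimes>\<^bsub>A\<^esub> u ?k) \<otimes>\<^bsub>A\<^esub> u (inv\<^bsub>G\<^esub> h)"
      by (simp add: 1 A.m_assoc)
    also have "e g \<otimes>\<^bsub>A\<^esub> u ?k = u g \<otimes>\<^bsub>A\<^esub> u h"
      by (subst eu) (auto simp: G.m_assoc[symmetric])
    finally show ?thesis by simp
  qed
  then show ?thesis
    by unfold_locales (use u_one rel1 in auto)
qed

section \<open>Reduced words\<close>

text \<open>The inverse is purely formal and thus available for every list of letters; on reduced
  words it is the group inverse by \<open>inv_free_group\<close>.\<close>

definition winv :: "('a \<times> bool) list \<Rightarrow> ('a \<times> bool) list" where
  "winv w = rev (map (\<lambda>(a, b). (a, \<not> b)) w)"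

lemma winv_simps [simp]:
  "winv [] = []" "winv ((a, b) # w) = winv w @ [(a, \<not> b)]" "winv (u @ v) = winv v @ winv u"
  "winv (winv w) = w" "winv (quot_word \<alpha> \<beta>) = quot_word \<beta> \<alpha>"
  by (simp_all add: winv_def quot_word_def rev_map comp_def case_prod_beta)

lemma reduced_append:
  "reduced (u @ v) \<longleftrightarrow> reduced u \<and> reduced v \<and>
     (u \<noteq> [] \<longrightarrow> v \<noteq> [] \<longrightarrow> \<not> (fst (last u) = fst (hd v) \<and> snd (last u) \<noteq> snd (hd v)))"
proof (induction u rule: reduced.induct)
  case ("2_2" l)
  then show ?case by (cases l; cases v) auto
qed auto

lemma last_winv: "w \<noteq> [] \<Longrightarrow> last (winv w) = (fst (hd w), \<not> snd (hd w))"
  by (cases w) (auto simp: winv_def last_rev)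

lemma reduced_winv [simp]: "reduced (winv w) \<longleftrightarrow> reduced w"
proof -
  have "reduced (winv w)" if "reduced w" for w :: "('a \<times> bool) list"
    using that
  proof (induction w)
    case (Cons l w)
    then show ?case
      by (cases l; cases w) (auto simp: reduced_append last_winv winv_def[of "_ # _"] dest: reduced_Cons_tl)
  qed simp
  from this[of w] this[of "winv w"] show ?thesis by auto
qed

lemma carrier_free_group [simp]: "w \<in> carrier free_group \<longleftrightarrow> reduced w"
  and mult_free_group: "u \<otimes>\<^bsub>free_group\<^esub> v = foldr red_cons u v"
  and one_free_group [simp]: "\<one>\<^bsub>free_group\<^esub> = []"
  by (simp_all add: free_group_def)

lemma inv_free_group [simp]:
  assumes "reduced w"
  shows "inv\<^bsub>free_group\<^esub> w = winv w"
proof -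
  interpret group free_group by (rule group_free_group)
  have "winv w \<otimes>\<^bsub>free_group\<^esub> w = \<one>\<^bsub>free_group\<^esub>"
    using foldr_red_cons_inverse[of "[]" w] assms
    by (simp add: mult_free_group winv_def foldr_red_cons_Nil)
  then show ?thesis
    by (intro inv_equality) (use assms in auto)
qed

lemma foldr_red_cons_append: "reduced (u @ v) \<Longrightarrow> foldr red_cons u v = u @ v"
proof (induction u)
  case (Cons l u)
  then show ?case using red_cons_reduced[of l "u @ v"] reduced_Cons_tl[of l "u @ v"] by simp
qed simp

lemma reduced_single [simp]: "reduced [l]"
  by (cases l) simp

lemma reduced_pos: "reduced (quot_word \<alpha> [])" and reduced_neg: "reduced (quot_word [] \<alpha>)"
proof -
  have "reduced (map (\<lambda>a. (a, b)) \<gamma>)" for \<gamma> :: "'a list" and b :: bool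
  proof (induction \<gamma>)
    case (Cons a \<gamma>)
    then show ?case by (cases \<gamma>) auto
  qed simp
  from this[of True \<alpha>] this[of False "rev \<alpha>"]
  show "reduced (quot_word \<alpha> [])" "reduced (quot_word [] \<alpha>)" by (simp_all add: quot_word_def)
qed

text \<open>The only obstruction to the form \<open>\<alpha> \<beta>^-1\<close> is an inverse letter
  standing directly before a positive one. In a reduced word the two letters differ, and there the
  product of letters will vanish.\<close>

lemma quot_word_cases:
  obtains (quot) \<alpha> \<beta> where "w = quot_word \<alpha> \<beta>"
    | (bad) u a b v where "w = u @ (a, False) # (b, True) # v"
proof -
  have "(\<exists>\<alpha> \<beta>. w = quot_word \<alpha> \<beta>) \<or> (\<exists>u a b v. w = u @ (a, False) # (b, True) # v)"
  proof (induction w)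
    case Nil
    have "[] = quot_word [] []" by (simp add: quot_word_def)
    then show ?case by blast
  next
    case (Cons l w)
    obtain c d where l: "l = (c, d)" by (cases l)
    from Cons show ?case
    proof (elim disjE exE)
      fix \<alpha> \<beta> assume w: "w = quot_word \<alpha> \<beta>"
      show ?thesis
      proof (cases d)
        case True
        then have "l # w = quot_word (c # \<alpha>) \<beta>" by (simp add: l w quot_word_def)
        then show ?thesis by blast
      next
        case False
        show ?thesis
        proof (cases \<alpha>)
          case Nil
          then have "l # w = quot_word [] (\<beta> @ [c])" using False by (simp add: l w quot_word_def)
          then show ?thesis by blast
        next
          case (Cons b \<alpha>')
          then have "l # w = [] @ (c, False) # (b, True) # quot_word \<alpha>' \<beta>"
            using False by (simp add: l w quot_word_def)
          then show ?thesis by blast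
        qed
      qed
    next
      fix u a b v assume "w = u @ (a, False) # (b, True) # v"
      then have "l # w = (l # u) @ (a, False) # (b, True) # v" by simp
      then show ?thesis by blast
    qed
  qed
  then show thesis using that by blast
qed

section \<open>Subshifts and the relations of the subshift algebra\<close>

lemma conc_append: "(u @ v) \<frown> x = u \<frown> (v \<frown> x)"
  by simp

text \<open>A factor of \<open>x\<close> is a factor of \<open>u \<frown> x\<close>, displaced by
  \<open>length u\<close>, so a tail avoids the same forbidden words.\<close>

lemma subshift_suffix:
  assumes "subshift X" "u \<frown> x \<in> X"
  shows "x \<in> X"
proof -
  obtain F where F: "X = {x. \<forall>i j. subsequence x i j \<notin> F}" using assms(1) by (auto simp: subshift_def)
  have "subsequence x i j = subsequence (u \<frown> x) (i + length u) (j + length u)" for i j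
    by (rule nth_equalityI) (auto simp: subsequence_def)
  then show ?thesis using assms(2) F by auto
qed

text \<open>By shift invariance a word that occurs somewhere also occurs at the start of a point.
  The empty word is listed separately because it belongs to the language even if \<open>X\<close> is
  empty.\<close>

lemma language_iff:
  assumes "subshift X"
  shows "\<alpha> \<in> language X \<longleftrightarrow> \<alpha> = [] \<or> (\<exists>x. \<alpha> \<frown> x \<in> X)"
proof
  assume "\<alpha> \<in> language X"
  then show "\<alpha> = [] \<or> (\<exists>x. \<alpha> \<frown> x \<in> X)"
  proof (cases "\<alpha> = []")
    case False
    with \<open>\<alpha> \<in> language X\<close> obtain x i j where x: "x \<in> X" "\<alpha> = subsequence x i j" by (auto simp: language_def)
    with False have ij: "i < j" by (auto simp: subsequence_def)
    have "suffix i x = subsequence x i j \<frown> suffix j x"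
      using ij by (intro ext) (auto simp: conc_def subsequence_def add.commute)
    moreover have "suffix i x \<in> X"
      using subshift_suffix[OF assms, of "prefix i x"] x(1) by simp
    ultimately show ?thesis using x(2) by auto
  qed simp
next
  assume "\<alpha> = [] \<or> (\<exists>x. \<alpha> \<frown> x \<in> X)"
  then show "\<alpha> \<in> language X"
  proof
    assume "\<exists>x. \<alpha> \<frown> x \<in> X"
    then obtain x where x: "\<alpha> \<frown> x \<in> X" ..
    have "\<alpha> = subsequence (\<alpha> \<frown> x) 0 (length \<alpha>)"
      by (rule nth_equalityI) (auto simp: subsequence_def)
    then show ?thesis using x unfolding language_def by blast
  qed (simp add: language_def)
qed

lemma Nil_in_language [simp]: "[] \<in> language X"
  by (simp add: language_def)

lemma language_appendD:
  assumes "subshift X" "u @ v \<in> language X"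
  shows "u \<in> language X" "v \<in> language X"
  using assms subshift_suffix[OF assms(1)] unfolding language_iff[OF assms(1)]
  by (metis append_is_Nil_conv conc_append)+

lemma cyl_Nil_Nil [simp]: "cyl X [] [] = X"
  by (auto simp: cyl_def)

lemma conc_eq_iff: "length u = length v \<Longrightarrow> u \<frown> x = v \<frown> y \<longleftrightarrow> u = v \<and> x = y"
proof
  assume l: "length u = length v" and e: "u \<frown> x = v \<frown> y"
  have "prefix (length u) (u \<frown> x) = u" "suffix (length u) (u \<frown> x) = x" for u and x :: "'a word"
    by simp_all
  then show "u = v \<and> x = y" using l e by metis
qed auto

lemma bool_alg_subset: "B \<in> bool_alg X \<Longrightarrow> B \<subseteq> X"
  by (induction rule: bool_alg.induct) (auto simp: cyl_def)

lemma bool_alg_space [simp]: "X \<in> bool_alg X"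
  using bool_alg.cyl[of "[]" X "[]"] by simp

lemma bool_alg_inter [simp]:
  assumes "B \<in> bool_alg X" "C \<in> bool_alg X"
  shows "B \<inter> C \<in> bool_alg X"
proof -
  have "B \<inter> C = X - ((X - B) \<union> (X - C))" using bool_alg_subset assms by blast
  then show ?thesis using assms by (simp add: bool_alg.union bool_alg.compl)
qed

text \<open>The relations in an arbitrary algebra. The locale serves the subshift algebra itself,
  the operators on functions on \<open>X\<close>, and the partial group algebra, where it yields the
  inverse of \<open>Xi\<close>.\<close>

locale subshift_family = ralg A for A :: "('r::comm_ring_1, 'b) module" (structure) +
  fixes X :: "'a word set" and p :: "'a word set \<Rightarrow> 'b" and s ss :: "'a \<Rightarrow> 'b"
  assumes subshift: "subshift X"
    and letters: "X \<noteq> {} \<Longrightarrow> [a] \<in> language X"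
    and p_closed [simp]: "B \<in> bool_alg X \<Longrightarrow> p B \<in> carrier A"
    and s_closed [simp]: "s a \<in> carrier A"
    and ss_closed [simp]: "ss a \<in> carrier A"
    and p_space: "p X = \<one>" and p_empty: "p {} = \<zero>"
    and p_inter: "B \<in> bool_alg X \<Longrightarrow> C \<in> bool_alg X \<Longrightarrow> p (B \<inter> C) = p B \<otimes> p C"
    and p_union: "B \<in> bool_alg X \<Longrightarrow> C \<in> bool_alg X \<Longrightarrow> p (B \<union> C) = p B \<oplus> p C \<ominus> p (B \<inter> C)"
    and s_ss_s: "s a \<otimes> ss a \<otimes> s a = s a" and ss_s_ss: "ss a \<otimes> s a \<otimes> ss a = ss a"
    and s_cyl: "\<alpha> \<in> language X \<Longrightarrow> \<beta> \<in> language X \<Longrightarrow>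
      mprod A (map s \<beta>) \<otimes> mprod A (map ss (rev \<alpha>)) \<otimes> mprod A (map s \<alpha>) \<otimes> mprod A (map ss (rev \<beta>))
        = p (cyl X \<alpha> \<beta>)"
begin

definition letter :: "'a \<times> bool \<Rightarrow> 'b" where
  "letter l = (if snd l then s (fst l) else ss (fst l))"

definition wprod :: "('a \<times> bool) list \<Rightarrow> 'b" where
  "wprod w = mprod A (map letter w)"

definition wproj :: "('a \<times> bool) list \<Rightarrow> 'b" where
  "wproj w = wprod w \<otimes> wprod (winv w)"

lemma letter_closed [simp]: "letter l \<in> carrier A"
  by (simp add: letter_def)

lemma wprod_closed [simp]: "wprod w \<in> carrier A"
  unfolding wprod_def by (intro mprod_closed) auto

lemma wproj_closed [simp]: "wproj w \<in> carrier A"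
  by (simp add: wproj_def)

lemma wprod_Nil [simp]: "wprod [] = \<one>" and wprod_Cons: "wprod (l # w) = letter l \<otimes> wprod w"
  by (simp_all add: wprod_def)

lemma wprod_append: "wprod (u @ v) = wprod u \<otimes> wprod v"
  unfolding wprod_def map_append by (intro mprod_append) auto

lemma wprod_quot_word: "wprod (quot_word \<alpha> \<beta>) = mprod A (map s \<alpha>) \<otimes> mprod A (map ss (rev \<beta>))"
  unfolding quot_word_def wprod_append by (simp add: wprod_def letter_def comp_def rev_map)

lemma sprod_closed [simp]: "mprod A (map s \<alpha>) \<in> carrier A" "mprod A (map ss \<alpha>) \<in> carrier A"
  by (intro mprod_closed; auto)+

lemma wproj_quot_word:
  "\<alpha> \<in> language X \<Longrightarrow> \<beta> \<in> language X \<Longrightarrow> wproj (quot_word \<alpha> \<beta>) = p (cyl X \<beta> \<alpha>)"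
  by (simp add: wproj_def wprod_quot_word s_cyl[symmetric] m_assoc)

lemma p_commute: "B \<in> bool_alg X \<Longrightarrow> C \<in> bool_alg X \<Longrightarrow> p B \<otimes> p C = p C \<otimes> p B"
  by (metis p_inter inf_commute)

text \<open>For empty \<open>X\<close> the elements \<open>\<one>\<close> and \<open>\<zero>\<close>
  are both \<open>p {}\<close>. This settles the case in which \<open>letters\<close> gives no
  information.\<close>

lemma trivial_if_empty:
  assumes "X = {}" "x \<in> carrier A"
  shows "x = \<zero>"
  using p_space p_empty assms r_null[of x] r_one[of x] by simp

definition proj_set :: "'b set" where "proj_set = p ` bool_alg X"

lemma zero_proj_set: "\<zero> \<in> proj_set"
  unfolding proj_set_def using p_empty bool_alg.empty by (metis imageI)

lemma proj_set_commute: "x \<in> proj_set \<Longrightarrow> y \<in> proj_set \<Longrightarrow> x \<otimes> y = y \<otimes> x"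
  unfolding proj_set_def using p_commute by auto

lemma wproj_letter: "wproj [l] \<in> proj_set"
proof (cases "X = {}")
  case True
  then show ?thesis using trivial_if_empty[of "wproj [l]"] zero_proj_set by simp
next
  case False
  obtain a b where l: "l = (a, b)" by (cases l)
  have "[l] = quot_word [a] [] \<or> [l] = quot_word [] [a]"
    by (cases b) (auto simp: l quot_word_def)
  then show ?thesis
    using wproj_quot_word letters[OF False, of a] bool_alg.cyl unfolding proj_set_def
    by (metis Nil_in_language imageI)
qed

lemma letter_cancel: "letter (a, b) \<otimes> letter (a, \<not> b) \<otimes> letter (a, b) = letter (a, b)"
  by (cases b) (simp_all add: letter_def s_ss_s ss_s_ss)

lemma wproj_single: "wproj [(a, b)] = letter (a, b) \<otimes> letter (a, \<not> b)"
  by (simp add: wproj_def wprod_Cons)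

text \<open>The word product is a partial isometry as soon as the idempotents of all its suffixes are projections
  \<open>p B\<close>: these commute with the range and source projections of the letters.\<close>

lemma wprod_partial_isometry:
  assumes "\<And>u v. w = u @ v \<Longrightarrow> wproj v \<in> proj_set"
  shows "wproj w \<otimes> wprod w = wprod w"
  using assms
proof (induction w)
  case (Cons l w)
  obtain a b where l: "l = (a, b)" by (cases l)
  have IH: "wproj w \<otimes> wprod w = wprod w" using Cons(1) Cons(2)[of "l # _"] by simp
  have c: "wproj w \<otimes> wproj [(a, \<not> b)] = wproj [(a, \<not> b)] \<otimes> wproj w"
    using proj_set_commute wproj_letter Cons(2)[of "[l]" w] by simp
  have "wproj (l # w) \<otimes> wprod (l # w) =
      letter l \<otimes> (wproj w \<otimes> wproj [(a, \<not> b)]) \<otimes> wprod w"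
    by (simp add: wproj_def wprod_Cons wprod_append l m_assoc)
  also have "\<dots> = letter (a, b) \<otimes> letter (a, \<not> b) \<otimes> letter (a, b) \<otimes> (wproj w \<otimes> wprod w)"
    unfolding c unfolding wproj_single by (simp add: m_assoc l)
  also have "\<dots> = wprod (l # w)" by (simp add: IH letter_cancel wprod_Cons l)
  finally show ?case .
qed (simp add: wproj_def)

text \<open>Every suffix of a word in the language is in the language, so all idempotents met along
  the word are projections of cylinders. This precedes the treatment of reduced words because
  \<open>sprod_zero\<close> depends on it.\<close>

lemma sprod_partial_isometry:
  assumes "\<alpha> \<in> language X"
  shows "mprod A (map s \<alpha>) \<otimes> mprod A (map ss (rev \<alpha>)) \<otimes> mprod A (map s \<alpha>) = mprod A (map s \<alpha>)"
    and "mprod A (map ss (rev \<alpha>)) \<otimes> mprod A (map s \<alpha>) \<otimes> mprod A (map ss (rev \<alpha>)) = mprod A (map ss (rev \<alpha>))"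
proof -
  have "wproj v \<in> proj_set" if uv: "quot_word \<alpha> [] = u @ v" for u v
  proof -
    obtain \<gamma> \<delta> where "\<alpha> = \<gamma> @ \<delta>" "v = quot_word \<delta> []"
      using uv by (auto simp: quot_word_def map_eq_append_conv)
    with assms language_appendD[OF subshift, of \<gamma> \<delta>] show ?thesis
      using wproj_quot_word[of \<delta> "[]"] bool_alg.cyl[of "[]" X \<delta>] by (simp add: proj_set_def)
  qed
  then have "wproj (quot_word \<alpha> []) \<otimes> wprod (quot_word \<alpha> []) = wprod (quot_word \<alpha> [])"
    by (intro wprod_partial_isometry) blast
  then show "mprod A (map s \<alpha>) \<otimes> mprod A (map ss (rev \<alpha>)) \<otimes> mprod A (map s \<alpha>) = mprod A (map s \<alpha>)"
    by (simp add: wproj_def wprod_quot_word)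
  have "wproj v \<in> proj_set" if uv: "quot_word [] \<alpha> = u @ v" for u v
  proof -
    obtain \<gamma> \<delta> where "rev \<alpha> = \<gamma> @ \<delta>" "v = map (\<lambda>b. (b, False)) \<delta>"
      using uv by (auto simp: quot_word_def map_eq_append_conv)
    then have "\<alpha> = rev \<delta> @ rev \<gamma>" "v = quot_word [] (rev \<delta>)"
      by (metis rev_append rev_rev_ident, simp add: quot_word_def)
    with assms language_appendD[OF subshift, of "rev \<delta>" "rev \<gamma>"] show ?thesis
      using wproj_quot_word[of "[]" "rev \<delta>"] bool_alg.cyl[of "rev \<delta>" X "[]"] by (simp add: proj_set_def)
  qed
  then have "wproj (quot_word [] \<alpha>) \<otimes> wprod (quot_word [] \<alpha>) = wprod (quot_word [] \<alpha>)"
    by (intro wprod_partial_isometry) blast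
  then show "mprod A (map ss (rev \<alpha>)) \<otimes> mprod A (map s \<alpha>) \<otimes> mprod A (map ss (rev \<alpha>)) = mprod A (map ss (rev \<alpha>))"
    by (simp add: wproj_def wprod_quot_word)
qed

section \<open>Vanishing of products of letters outside the language\<close>

lemma source_proj: "\<alpha> \<in> language X \<Longrightarrow> mprod A (map ss (rev \<alpha>)) \<otimes> mprod A (map s \<alpha>) = p (cyl X \<alpha> [])"
  using s_cyl[of \<alpha> "[]"] by simp

lemma range_proj: "\<alpha> \<in> language X \<Longrightarrow> mprod A (map s \<alpha>) \<otimes> mprod A (map ss (rev \<alpha>)) = p (cyl X [] \<alpha>)"
  using s_cyl[of "[]" \<alpha>] by simp

text \<open>No sequence starts with both letters, so the range projections of \<open>s a\<close> and
  \<open>s b\<close> are orthogonal. The partial isometry relations, inserted on both sides, bring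
  these projections next to each other.\<close>

lemma ss_s_zero:
  assumes "a \<noteq> b"
  shows "ss a \<otimes> s b = \<zero>"
proof (cases "X = {}")
  case False
  note L = letters[OF False]
  have "cyl X [] [a] \<inter> cyl X [] [b] = {}"
    using assms conc_eq_iff[of "[a]" "[b]"] by (auto simp: cyl_def)
  then have 0: "(s a \<otimes> ss a) \<otimes> (s b \<otimes> ss b) = \<zero>"
    using range_proj[OF L[of a]] range_proj[OF L[of b]]
      p_inter[OF bool_alg.cyl[OF Nil_in_language L] bool_alg.cyl[OF Nil_in_language L], of a b] p_empty
    by simp
  have "ss a \<otimes> s b = (ss a \<otimes> s a \<otimes> ss a) \<otimes> (s b \<otimes> ss b \<otimes> s b)" by (simp add: s_ss_s ss_s_ss)
  also have "\<dots> = ss a \<otimes> ((s a \<otimes> ss a) \<otimes> (s b \<otimes> ss b)) \<otimes> s b" by (simp add: m_assoc)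
  finally show ?thesis by (simp add: 0)
qed (auto intro: trivial_if_empty)

text \<open>Cut the word where it leaves the language: the source projection of the part before the
  cut is orthogonal to the range projection of the next letter.\<close>

lemma sprod_zero:
  assumes "\<alpha> \<notin> language X"
  shows "mprod A (map s \<alpha>) = \<zero>" "mprod A (map ss (rev \<alpha>)) = \<zero>"
proof -
  have "X = {} \<or> mprod A (map s \<alpha>) = \<zero> \<and> mprod A (map ss (rev \<alpha>)) = \<zero>"
    using assms
  proof (induction \<alpha> rule: rev_induct)
    case (snoc a \<alpha>)
    have m: "mprod A (map s (\<alpha> @ [a])) = mprod A (map s \<alpha>) \<otimes> s a"
      unfolding map_append by (subst mprod_append) auto
    show ?case
    proof (cases "X = {} \<or> \<alpha> \<notin> language X")
      case True
      with snoc show ?thesis by (auto simp: m simp del: map_append)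
    next
      case False
      then have \<alpha>: "\<alpha> \<in> language X" and a: "[a] \<in> language X" using letters by auto
      \<comment> \<open>A common point would be some \<open>a x\<close> with
        \<open>\<alpha> a x\<close> in \<open>X\<close>, which would put
        \<open>\<alpha> @ [a]\<close> into the language.\<close>
      have "cyl X \<alpha> [] \<inter> cyl X [] [a] = {}"
        using snoc(2) language_iff[OF subshift, of "\<alpha> @ [a]"] by (auto simp: cyl_def)
      then have 0: "p (cyl X \<alpha> []) \<otimes> p (cyl X [] [a]) = \<zero>" "p (cyl X [] [a]) \<otimes> p (cyl X \<alpha> []) = \<zero>"
        using p_inter[of "cyl X \<alpha> []" "cyl X [] [a]"] p_commute[of "cyl X \<alpha> []" "cyl X [] [a]"] p_empty \<alpha> a
        by (auto simp: bool_alg.cyl)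
      have pa: "p (cyl X [] [a]) = s a \<otimes> ss a" using range_proj[OF a] by simp
      let ?S = "mprod A (map s \<alpha>)" and ?T = "mprod A (map ss (rev \<alpha>))"
      have "?S \<otimes> s a = (?S \<otimes> ?T \<otimes> ?S) \<otimes> (s a \<otimes> ss a \<otimes> s a)"
        using sprod_partial_isometry(1)[OF \<alpha>] by (simp add: s_ss_s)
      also have "\<dots> = ?S \<otimes> (p (cyl X \<alpha> []) \<otimes> p (cyl X [] [a])) \<otimes> s a"
        unfolding pa source_proj[OF \<alpha>, symmetric] by (simp add: m_assoc)
      finally have 1: "?S \<otimes> s a = \<zero>" by (simp add: 0)
      have "ss a \<otimes> ?T = (ss a \<otimes> s a \<otimes> ss a) \<otimes> (?T \<otimes> ?S \<otimes> ?T)"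
        using sprod_partial_isometry(2)[OF \<alpha>] by (simp add: ss_s_ss)
      also have "\<dots> = ss a \<otimes> (p (cyl X [] [a]) \<otimes> p (cyl X \<alpha> [])) \<otimes> ?T"
        unfolding pa source_proj[OF \<alpha>, symmetric] by (simp add: m_assoc)
      finally have "ss a \<otimes> ?T = \<zero>" by (simp add: 0)
      with 1 show ?thesis by (simp add: m del: map_append)
    qed
  qed simp
  then show "mprod A (map s \<alpha>) = \<zero>" "mprod A (map ss (rev \<alpha>)) = \<zero>"
    using trivial_if_empty by auto
qed

text \<open>This makes the product of letters agree with \<open>spi\<close> on all reduced words:
  either one of the two words lies outside the language, or an inverse letter meets a different
  positive letter.\<close>

lemma wprod_not_simple:
  assumes "reduced w" "\<not> simple_elt X w"
  shows "wprod w = \<zero>"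
proof (cases w rule: quot_word_cases)
  case (quot \<alpha> \<beta>)
  then have "\<alpha> \<notin> language X \<or> \<beta> \<notin> language X" using assms by (auto simp: simple_elt_def)
  then show ?thesis using sprod_zero by (auto simp: quot wprod_quot_word)
next
  case (bad u a b v)
  then have "a \<noteq> b" using assms(1) by (auto simp: reduced_append)
  moreover have "wprod w = wprod u \<otimes> (ss a \<otimes> s b) \<otimes> wprod v"
    by (simp add: bad wprod_append wprod_Cons letter_def m_assoc)
  ultimately show ?thesis using ss_s_zero[of a b] by simp
qed

lemma wproj_proj_set:
  assumes "reduced w"
  shows "wproj w \<in> proj_set"
proof (cases "simple_elt X w")
  case True
  then obtain \<alpha> \<beta> where "\<alpha> \<in> language X" "\<beta> \<in> language X" "w = quot_word \<alpha> \<beta>"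
    by (auto simp: simple_elt_def)
  then show ?thesis using wproj_quot_word bool_alg.cyl by (auto simp: proj_set_def intro!: imageI)
next
  case False
  then show ?thesis using wprod_not_simple[OF assms False] zero_proj_set by (simp add: wproj_def)
qed

lemma wproj_wprod:
  assumes "reduced w"
  shows "wproj w \<otimes> wprod w = wprod w"
  using assms by (intro wprod_partial_isometry wproj_proj_set) (auto simp: reduced_append)

text \<open>A cancellation at the front of \<open>k\<close> is invisible behind the inverse letter:
  if \<open>k\<close> starts with that inverse, the three letters in front of the rest collapse to
  one by the partial isometry relation.\<close>

lemma letter_red_cons:
  assumes "reduced k"
  shows "letter (a, \<not> b) \<otimes> (letter (a, b) \<otimes> wprod k) = letter (a, \<not> b) \<otimes> wprod (red_cons (a, b) k)"
proof (cases k)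
  case Nil
  then show ?thesis by (simp add: wprod_Cons)
next
  case (Cons l v)
  obtain c d where l: "l = (c, d)" by (cases l)
  show ?thesis
  proof (cases "a = c \<and> b \<noteq> d")
    case True
    then have "d = (\<not> b)" "c = a" by auto
    then have "letter (a, \<not> b) \<otimes> (letter (a, b) \<otimes> wprod k) =
        (letter (a, \<not> b) \<otimes> letter (a, \<not> \<not> b) \<otimes> letter (a, \<not> b)) \<otimes> wprod v"
      by (simp add: Cons l wprod_Cons m_assoc)
    also have "\<dots> = letter (a, \<not> b) \<otimes> wprod v" by (simp only: letter_cancel)
    finally show ?thesis using True by (simp add: Cons l)
  next
    case False
    then show ?thesis by (auto simp: Cons l wprod_Cons)
  qed
qed

lemma wprod_rel1:
  assumes "reduced g" "reduced h"
  shows "wprod (winv g) \<otimes> wprod g \<otimes> wprod h = wprod (winv g) \<otimes> wprod (foldr red_cons g h)"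
  using assms(1)
proof (induction g)
  case Nil
  then show ?case by simp
next
  case (Cons l g)
  obtain a b where l: "l = (a, b)" by (cases l)
  have g: "reduced g" using Cons.prems by (rule reduced_Cons_tl)
  define k where "k = foldr red_cons g h"
  have k: "reduced k" unfolding k_def by (rule reduced_foldr_red_cons[OF assms(2)])
  have IH: "wprod (winv g) \<otimes> wprod g \<otimes> wprod h = wprod (winv g) \<otimes> wprod k"
    using Cons.IH[OF g] by (simp add: k_def)
  define E where "E = letter (a, \<not> b) \<otimes> letter (a, b)"
  have E: "E \<in> carrier A" by (simp add: E_def)
  have comm: "E \<otimes> wproj g = wproj g \<otimes> E"
    using proj_set_commute[OF wproj_letter wproj_proj_set[OF g], of "(a, \<not> b)"] by (simp add: wproj_single E_def)
  \<comment> \<open>The idempotent \<open>wproj g\<close> is inserted before \<open>wprod g\<close>;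
    its second half completes the product to which the induction hypothesis applies.\<close>
  have "wprod (winv (l # g)) \<otimes> wprod (l # g) \<otimes> wprod h =
      wprod (winv g) \<otimes> E \<otimes> (wproj g \<otimes> wprod g) \<otimes> wprod h"
    using wproj_wprod[OF g] by (simp add: l wprod_append wprod_Cons m_assoc E_def)
  also have "\<dots> = wprod (winv g) \<otimes> E \<otimes> wprod g \<otimes> (wprod (winv g) \<otimes> wprod g \<otimes> wprod h)"
    using E by (simp add: wproj_def m_assoc)
  also have "\<dots> = wprod (winv g) \<otimes> (E \<otimes> wproj g) \<otimes> wprod k"
    unfolding IH using E by (simp add: wproj_def m_assoc)
  \<comment> \<open>Once \<open>E\<close> has passed it, \<open>wproj g\<close> stands next to
    \<open>wprod (winv g)\<close> and is absorbed there, which leaves the effect of a single letter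
    on \<open>k\<close>.\<close>
  also have "\<dots> = wproj (winv g) \<otimes> wprod (winv g) \<otimes> E \<otimes> wprod k"
    unfolding comm using E by (simp add: wproj_def m_assoc)
  also have "\<dots> = wprod (winv g) \<otimes> (letter (a, \<not> b) \<otimes> (letter (a, b) \<otimes> wprod k))"
    using wproj_wprod[of "winv g"] g by (simp add: E_def m_assoc)
  also have "\<dots> = wprod (winv (l # g)) \<otimes> wprod (red_cons l k)"
    unfolding letter_red_cons[OF k] by (simp add: l wprod_append wprod_Cons m_assoc)
  finally show ?case by (simp add: k_def)
qed

lemma par_rep_wprod: "par_rep A free_group wprod"
proof (rule par_repI[OF ralg_axioms group_free_group])
  fix g h :: "('a \<times> bool) list"
  assume "g \<in> carrier free_group" "h \<in> carrier free_group"
  then have g: "reduced g" and h: "reduced h" by auto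
  show "wprod (inv\<^bsub>free_group\<^esub> g) \<otimes> wprod g \<otimes> wprod h = wprod (inv\<^bsub>free_group\<^esub> g) \<otimes> wprod (g \<otimes>\<^bsub>free_group\<^esub> h)"
    using wprod_rel1[OF g h] g by (simp add: mult_free_group)
  show "wprod g \<otimes> wprod (inv\<^bsub>free_group\<^esub> g) \<otimes> (wprod h \<otimes> wprod (inv\<^bsub>free_group\<^esub> h)) =
      wprod h \<otimes> wprod (inv\<^bsub>free_group\<^esub> h) \<otimes> (wprod g \<otimes> wprod (inv\<^bsub>free_group\<^esub> g))"
    using proj_set_commute[OF wproj_proj_set[OF g] wproj_proj_set[OF h]] g h by (simp add: wproj_def)
qed auto

end

section \<open>The subshift algebra as a universal family\<close>

lemma alg_hom_prod_list:
  fixes fs :: "('x list \<Rightarrow>\<^sub>0 'r::comm_ring_1) list"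
  assumes "h \<in> alg_hom (free_algebra S) B" "set fs \<subseteq> carrier (free_algebra S)"
  shows "prod_list fs \<in> carrier (free_algebra S)" "h (prod_list fs) = mprod B (map h fs)"
proof -
  note h = alg_homD[OF assms(1)]
  have "prod_list fs \<in> carrier (free_algebra S) \<and> h (prod_list fs) = mprod B (map h fs)"
    using assms(2)
  proof (induction fs)
    case Nil
    show ?case using h(4) by simp
  next
    case (Cons f fs)
    then show ?case using h(2)[of f "prod_list fs"] by simp
  qed
  then show "prod_list fs \<in> carrier (free_algebra S)" "h (prod_list fs) = mprod B (map h fs)" by auto
qed

lemma prod_list_closed:
  fixes fs :: "('x list \<Rightarrow>\<^sub>0 'r::comm_ring_1) list"
  shows "set fs \<subseteq> carrier (free_algebra S) \<Longrightarrow> prod_list fs \<in> carrier (free_algebra S)"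
  by (induction fs) auto

lemma sgens_mem [simp]:
  "B \<in> bool_alg X \<Longrightarrow> Proj B \<in> sgens X" "Gen a \<in> sgens X" "Gen_star a \<in> sgens X"
  by (auto simp: sgens_def)

lemma s_word_closed [simp]:
  "(s_word \<alpha> :: 'a sgen list \<Rightarrow>\<^sub>0 'r::comm_ring_1) \<in> carrier (free_algebra (sgens X))"
  "(s_star_word \<alpha> :: 'a sgen list \<Rightarrow>\<^sub>0 'r::comm_ring_1) \<in> carrier (free_algebra (sgens X))"
  unfolding s_word_def s_star_word_def by (rule prod_list_closed; auto)+

lemma bool_alg_closed [simp]:
  "{} \<in> bool_alg X" "B \<in> bool_alg X \<Longrightarrow> C \<in> bool_alg X \<Longrightarrow> B \<union> C \<in> bool_alg X"
  "B \<in> bool_alg X \<Longrightarrow> X - B \<in> bool_alg X"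
  "\<alpha> \<in> language X \<Longrightarrow> \<beta> \<in> language X \<Longrightarrow> cyl X \<alpha> \<beta> \<in> bool_alg X"
  by (auto intro: bool_alg.intros)

lemma srels_closed: "(srels X :: ('a sgen list \<Rightarrow>\<^sub>0 'r::comm_ring_1) set) \<subseteq> carrier (free_algebra (sgens X))"
  unfolding srels_def by auto

fun sgen_map :: "('a word set \<Rightarrow> 'b) \<Rightarrow> ('a \<Rightarrow> 'b) \<Rightarrow> ('a \<Rightarrow> 'b) \<Rightarrow> 'a sgen \<Rightarrow> 'b" where
  "sgen_map p s ss (Proj B) = p B"
| "sgen_map p s ss (Gen a) = s a"
| "sgen_map p s ss (Gen_star a) = ss a"

lemma ralg_subshift_algebra: "ralg (subshift_algebra X)"
  unfolding subshift_algebra_def by (rule ralg_pres_algebra[OF srels_closed])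

lemma sclass_alg_hom: "sclass X \<in> alg_hom (free_algebra (sgens X)) (subshift_algebra X)"
  unfolding subshift_algebra_def by (rule pres_class_alg_hom[OF srels_closed])

lemma alg_hom_s_word:
  assumes "h \<in> alg_hom (free_algebra (sgens X)) B"
  shows "h (s_word \<alpha>) = mprod B (map (\<lambda>a. h (gen (Gen a))) \<alpha>)"
    and "h (s_star_word \<alpha>) = mprod B (map (\<lambda>a. h (gen (Gen_star a))) (rev \<alpha>))"
  unfolding s_word_def s_star_word_def
  by (subst alg_hom_prod_list(2)[OF assms]; auto simp: comp_def)+

lemma subshift_family_subshift_algebra:
  assumes "subshift X" "\<And>a. X \<noteq> {} \<Longrightarrow> [a] \<in> language X"
  shows "subshift_family (subshift_algebra X) X (\<lambda>B. sclass X (gen (Proj B)))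
    (\<lambda>a. sclass X (gen (Gen a))) (\<lambda>a. sclass X (gen (Gen_star a)) :: ('a sgen list \<Rightarrow>\<^sub>0 'r::comm_ring_1) set)"
proof -
  let ?S = "sgens X" and ?A = "subshift_algebra X :: ('r, ('a sgen list \<Rightarrow>\<^sub>0 'r) set) module"
  let ?c = "sclass X :: ('a sgen list \<Rightarrow>\<^sub>0 'r) \<Rightarrow> _"
  interpret A: ralg ?A by (rule ralg_subshift_algebra)
  note h = alg_homD[OF sclass_alg_hom[of X, where ?'b = 'r], simplified]
  have hm: "?c (f - g) = ?c f \<ominus>\<^bsub>?A\<^esub> ?c g"
    if "f \<in> carrier (free_algebra ?S)" "g \<in> carrier (free_algebra ?S)" for f g
    using alg_hom_minus[OF ralg_free_algebra ralg_subshift_algebra sclass_alg_hom that] free_algebra_minus[OF that]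
    by simp
  have rel: "?c f = ?c g" if "f - g \<in> srels X" "f \<in> carrier (free_algebra ?S)" "g \<in> carrier (free_algebra ?S)"
    for f g
    by (rule pres_class_rel_eq[OF srels_closed that])
  note w = alg_hom_s_word[OF sclass_alg_hom[of X, where ?'b = 'r]]
  show ?thesis
  proof (rule subshift_family.intro[OF A.ralg_axioms], rule subshift_family_axioms.intro)
    show "?c (gen (Proj X)) = \<one>\<^bsub>?A\<^esub>"
      unfolding h(4)[symmetric] by (rule rel) (auto simp: srels_def)
    show "?c (gen (Proj {})) = \<zero>\<^bsub>?A\<^esub>"
      unfolding subshift_algebra_def
      by (rule pres_class_rel[OF srels_closed]) (auto simp: srels_def)
    show "?c (gen (Proj (B \<inter> C))) = ?c (gen (Proj B)) \<otimes>\<^bsub>?A\<^esub> ?c (gen (Proj C))"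
      if B: "B \<in> bool_alg X" "C \<in> bool_alg X" for B C
    proof -
      have "?c (gen (Proj (B \<inter> C))) = ?c (gen (Proj B) * gen (Proj C))"
        by (rule rel) (use B in \<open>(unfold srels_def, blast)\<close>, simp_all add: B)
      then show ?thesis using B by (simp add: h(2))
    qed
    show "?c (gen (Proj (B \<union> C))) = ?c (gen (Proj B)) \<oplus>\<^bsub>?A\<^esub> ?c (gen (Proj C)) \<ominus>\<^bsub>?A\<^esub> ?c (gen (Proj (B \<inter> C)))"
      if B: "B \<in> bool_alg X" "C \<in> bool_alg X" for B C
    proof -
      have "?c (gen (Proj (B \<union> C))) = ?c (gen (Proj B) + gen (Proj C) - gen (Proj (B \<inter> C)))"
        by (rule rel) (use B in \<open>(unfold srels_def, blast)\<close>, simp_all add: B)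
      then show ?thesis using B by (simp add: h(3) hm)
    qed
    show "?c (gen (Gen a)) \<otimes>\<^bsub>?A\<^esub> ?c (gen (Gen_star a)) \<otimes>\<^bsub>?A\<^esub> ?c (gen (Gen a)) = ?c (gen (Gen a))" for a
    proof -
      have "?c (gen (Gen a) * gen (Gen_star a) * gen (Gen a)) = ?c (gen (Gen a))"
        by (rule rel) ((unfold srels_def, blast), (intro free_algebra_closed(3,7) sgens_mem)+)
      then show ?thesis by (simp only: h(2) free_algebra_closed(3,7) sgens_mem)
    qed
    show "?c (gen (Gen_star a)) \<otimes>\<^bsub>?A\<^esub> ?c (gen (Gen a)) \<otimes>\<^bsub>?A\<^esub> ?c (gen (Gen_star a)) = ?c (gen (Gen_star a))" for a
    proof -
      have "?c (gen (Gen_star a) * gen (Gen a) * gen (Gen_star a)) = ?c (gen (Gen_star a))"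
        by (rule rel) ((unfold srels_def, blast), (intro free_algebra_closed(3,7) sgens_mem)+)
      then show ?thesis by (simp only: h(2) free_algebra_closed(3,7) sgens_mem)
    qed
    show "mprod ?A (map (\<lambda>a. ?c (gen (Gen a))) \<beta>) \<otimes>\<^bsub>?A\<^esub> mprod ?A (map (\<lambda>a. ?c (gen (Gen_star a))) (rev \<alpha>)) \<otimes>\<^bsub>?A\<^esub>
        mprod ?A (map (\<lambda>a. ?c (gen (Gen a))) \<alpha>) \<otimes>\<^bsub>?A\<^esub> mprod ?A (map (\<lambda>a. ?c (gen (Gen_star a))) (rev \<beta>)) =
        ?c (gen (Proj (cyl X \<alpha> \<beta>)))" if L: "\<alpha> \<in> language X" "\<beta> \<in> language X" for \<alpha> \<beta>
    proof -
      have "?c (s_word \<beta> * s_star_word \<alpha> * s_word \<alpha> * s_star_word \<beta>) = ?c (gen (Proj (cyl X \<alpha> \<beta>)))"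
        by (rule rel) (use L in \<open>(unfold srels_def, blast)\<close>, simp_all add: L)
      then show ?thesis by (simp add: h(2) w)
    qed
  qed (use assms h(1) in auto)
qed

lemma subshift_algebra_universal:
  assumes "subshift_family B X p s ss"
  obtains h where "h \<in> alg_hom (subshift_algebra X) B"
    and "\<And>C. C \<in> bool_alg X \<Longrightarrow> h (sclass X (gen (Proj C))) = p C"
    and "\<And>a. h (sclass X (gen (Gen a))) = s a" "\<And>a. h (sclass X (gen (Gen_star a))) = ss a"
proof -
  interpret B: subshift_family B X p s ss by fact
  have carr: "sgen_map p s ss x \<in> carrier B" if "x \<in> sgens X" for x
    using that by (auto simp: sgens_def)
  note E = B.ev_alg_hom[of "sgens X" "sgen_map p s ss", OF carr]
  note h = alg_homD[OF E, simplified]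
  note w = alg_hom_s_word[OF E]
  have g: "ev B (sgen_map p s ss) (gen x) = sgen_map p s ss x" if "x \<in> sgens X" for x
    using B.ev_gen[of "sgens X" "sgen_map p s ss", OF carr that] by simp
  have hm: "ev B (sgen_map p s ss) (f - g) = ev B (sgen_map p s ss) f \<ominus>\<^bsub>B\<^esub> ev B (sgen_map p s ss) g"
    if "f \<in> carrier (free_algebra (sgens X))" "g \<in> carrier (free_algebra (sgens X))" for f g
    using alg_hom_minus[OF ralg_free_algebra B.ralg_axioms E that] free_algebra_minus[OF that] by simp
  have sub0: "x \<ominus>\<^bsub>B\<^esub> x = \<zero>\<^bsub>B\<^esub>" if "x \<in> carrier B" for x
    using that by (simp add: B.r_right_minus_eq)
  have "ev B (sgen_map p s ss) f = \<zero>\<^bsub>B\<^esub>" if "f \<in> srels X" for f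
    using that unfolding srels_def
    by (elim UnE insertE CollectE exE conjE emptyE)
      (simp_all add: hm h(2,3,4) g w free_algebra_closed(3) B.p_space B.p_empty B.p_inter B.p_union B.s_ss_s B.ss_s_ss
        B.s_cyl sub0 del: Poly_Mapping.mult_single)
  from pres_algebra_universal[OF srels_closed B.ralg_axioms carr this]
  obtain k where k: "k \<in> alg_hom (subshift_algebra X) B"
    "\<And>f. f \<in> carrier (free_algebra (sgens X)) \<Longrightarrow> k (sclass X f) = ev B (sgen_map p s ss) f"
    unfolding subshift_algebra_def by blast
  show thesis
    by (rule that[OF k(1)]) (simp_all add: k(2) g)
qed

section \<open>The representation on functions\<close>

text \<open>Functions on \<open>X\<close> are total functions on all sequences. The last two
  conditions say that an operator is unchanged by multiplication with the indicator of
  \<open>X\<close> after or before it; this makes it an endomorphism of the functions on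
  \<open>X\<close> and that multiplication the unit.\<close>

definition end_algebra :: "'x set \<Rightarrow> ('r::comm_ring_1, ('x \<Rightarrow> 'r) \<Rightarrow> 'x \<Rightarrow> 'r) module" where
  "end_algebra X =
    \<lparr>carrier = {T. (\<forall>f g. T (\<lambda>x. f x + g x) = (\<lambda>x. T f x + T g x)) \<and>
        (\<forall>r f. T (\<lambda>x. r * f x) = (\<lambda>x. r * T f x)) \<and> (\<forall>f x. x \<notin> X \<longrightarrow> T f x = 0) \<and>
        (\<forall>f. T (\<lambda>x. indicator X x * f x) = T f)},
     mult = (\<lambda>S T f. S (T f)), one = (\<lambda>f x. indicator X x * f x), zero = (\<lambda>f x. 0),
     add = (\<lambda>S T f x. S f x + T f x), smult = (\<lambda>r T f x. r * T f x)\<rparr>"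

lemma ralg_end_algebra: "ralg (end_algebra X :: ('r::comm_ring_1, ('x \<Rightarrow> 'r) \<Rightarrow> 'x \<Rightarrow> 'r) module)"
proof -
  let ?E = "end_algebra X :: ('r, ('x \<Rightarrow> 'r) \<Rightarrow> 'x \<Rightarrow> 'r) module"
  have supp: "(\<lambda>x. indicator X x * T f x) = T f" if "T \<in> carrier ?E" for T f
    using that by (auto simp: end_algebra_def indicator_def fun_eq_iff)
  have "ring ?E"
  proof (rule ringI)
    show "abelian_group ?E"
    proof (rule abelian_groupI)
      fix T assume T: "T \<in> carrier ?E"
      show "\<exists>S\<in>carrier ?E. S \<oplus>\<^bsub>?E\<^esub> T = \<zero>\<^bsub>?E\<^esub>"
        by (rule bexI[of _ "\<lambda>f x. - T f x"]) (use T in \<open>auto simp: end_algebra_def\<close>)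
    qed (auto simp: end_algebra_def algebra_simps)
    show "monoid ?E"
    proof (rule monoidI)
      fix T assume T: "T \<in> carrier ?E"
      show "\<one>\<^bsub>?E\<^esub> \<otimes>\<^bsub>?E\<^esub> T = T" using supp[OF T] by (simp add: end_algebra_def)
      show "T \<otimes>\<^bsub>?E\<^esub> \<one>\<^bsub>?E\<^esub> = T" using T by (simp add: end_algebra_def)
    next
      show "\<one>\<^bsub>?E\<^esub> \<in> carrier ?E"
        by (auto simp: end_algebra_def indicator_def fun_eq_iff algebra_simps)
      fix S T assume S: "S \<in> carrier ?E" and T: "T \<in> carrier ?E"
      show "S \<otimes>\<^bsub>?E\<^esub> T \<in> carrier ?E" using S T by (simp add: end_algebra_def)
    qed (simp add: end_algebra_def)
  qed (auto simp: end_algebra_def)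
  then interpret ring ?E .
  show ?thesis
  proof (rule ralg.intro[OF ring_axioms], rule ralg_axioms.intro)
    show "r \<odot>\<^bsub>?E\<^esub> T \<in> carrier ?E" if "T \<in> carrier ?E" for r T
      using that by (simp add: end_algebra_def algebra_simps)
  qed (auto simp: end_algebra_def algebra_simps)
qed

definition proj_op :: "'a word set \<Rightarrow> ('a word \<Rightarrow> 'r::comm_ring_1) \<Rightarrow> 'a word \<Rightarrow> 'r" where
  "proj_op B f x = (if x \<in> B then f x else 0)"

text \<open>Pullback along the removal of a leading \<open>a\<close>. This is \<open>tau\<close> at
  the letter \<open>a\<close>, which acts on functions through the inverse of prefixing.\<close>

definition s_op :: "'a word set \<Rightarrow> 'a \<Rightarrow> ('a word \<Rightarrow> 'r::comm_ring_1) \<Rightarrow> 'a word \<Rightarrow> 'r" where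
  "s_op X a f x = (if x \<in> X \<and> x 0 = a then f (suffix 1 x) else 0)"

definition s_star_op :: "'a word set \<Rightarrow> 'a \<Rightarrow> ('a word \<Rightarrow> 'r::comm_ring_1) \<Rightarrow> 'a word \<Rightarrow> 'r" where
  "s_star_op X a f x = (if [a] \<frown> x \<in> X then f ([a] \<frown> x) else 0)"

lemma end_algebra_simps:
  "S \<otimes>\<^bsub>end_algebra X\<^esub> T = (\<lambda>f. S (T f))" "\<one>\<^bsub>end_algebra X\<^esub> = (\<lambda>f x. indicator X x * f x)"
  "\<zero>\<^bsub>end_algebra X\<^esub> = (\<lambda>f x. 0)" "S \<oplus>\<^bsub>end_algebra X\<^esub> T = (\<lambda>f x. S f x + T f x)"
  "r \<odot>\<^bsub>end_algebra X\<^esub> T = (\<lambda>f x. r * T f x)"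
  by (simp_all add: end_algebra_def)

lemma suffix_Suc_build [simp]: "suffix (Suc 0) (a ## x) = x"
  by (simp add: fun_eq_iff)

lemma head_conc_suffix: "[x 0] \<frown> suffix 1 x = x"
  by (auto simp: conc_def fun_eq_iff)

lemma mprod_s_op:
  assumes "subshift X"
  shows "mprod (end_algebra X) (map (s_op X) \<alpha>) f y =
    (if y \<in> X \<and> prefix (length \<alpha>) y = \<alpha> then f (suffix (length \<alpha>) y) else 0)"
proof (induction \<alpha> arbitrary: y)
  case Nil
  show ?case by (simp add: end_algebra_simps indicator_def)
next
  case (Cons a \<alpha>)
  have "suffix 1 y \<in> X" if "y \<in> X" using subshift_suffix[OF assms, of "[y 0]"] that head_conc_suffix[of y] by metis
  moreover have "prefix (Suc n) y = y 0 # prefix n (suffix 1 y)" for n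
    by (rule nth_equalityI) (auto simp: nth_Cons' subsequence_def simp del: upt_Suc)
  moreover have "mprod (end_algebra X) (map (s_op X) (a # \<alpha>)) f y =
      s_op X a (mprod (end_algebra X) (map (s_op X) \<alpha>) f) y"
    by (simp add: end_algebra_simps)
  ultimately show ?case unfolding s_op_def[of X a _ y] Cons by (auto simp del: suffix_nth)
qed

lemma mprod_s_star_op:
  assumes "subshift X"
  shows "mprod (end_algebra X) (map (s_star_op X) (rev \<alpha>)) f y = (if \<alpha> \<frown> y \<in> X then f (\<alpha> \<frown> y) else 0)"
proof (induction \<alpha> arbitrary: f y rule: rev_induct)
  case Nil
  show ?case by (simp add: end_algebra_simps indicator_def)
next
  case (snoc a \<alpha>)
  then show ?case using subshift_suffix[OF assms] by (auto simp: end_algebra_simps s_star_op_def)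
qed

lemma mem_cyl_iff:
  "y \<in> cyl X \<alpha> \<beta> \<longleftrightarrow> y \<in> X \<and> prefix (length \<beta>) y = \<beta> \<and> \<alpha> \<frown> suffix (length \<beta>) y \<in> X"
proof
  assume *: "y \<in> X \<and> prefix (length \<beta>) y = \<beta> \<and> \<alpha> \<frown> suffix (length \<beta>) y \<in> X"
  then have "\<beta> \<frown> suffix (length \<beta>) y = y"
    using prefix_suffix[of y "length \<beta>"] by simp
  with * show "y \<in> cyl X \<alpha> \<beta>" unfolding cyl_def by (metis (mono_tags, lifting) mem_Collect_eq)
qed (auto simp: cyl_def)

lemma alg_minus_end_algebra:
  assumes "T \<in> carrier (end_algebra X)"
  shows "S \<ominus>\<^bsub>end_algebra X\<^esub> T = (\<lambda>f x. S f x - T f x)"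
proof -
  interpret ralg "end_algebra X" by (rule ralg_end_algebra)
  show ?thesis using smult_minus_one[OF assms, symmetric] by (simp add: a_minus_def end_algebra_simps)
qed

lemma subshift_family_end_algebra:
  assumes "subshift X" "\<And>a. X \<noteq> {} \<Longrightarrow> [a] \<in> language X"
  shows "subshift_family (end_algebra X :: ('r::comm_ring_1, _) module) X proj_op (s_op X) (s_star_op X)"
proof -
  let ?E = "end_algebra X :: ('r, ('a word \<Rightarrow> 'r) \<Rightarrow> 'a word \<Rightarrow> 'r) module"
  have suf: "suffix 1 y \<in> X" if "y \<in> X" for y
    using subshift_suffix[OF assms(1), of "[y 0]"] that head_conc_suffix[of y] by metis
  have p: "proj_op B \<in> carrier ?E" if "B \<in> bool_alg X" for B
    using bool_alg_subset[OF that] by (auto simp: end_algebra_def proj_op_def fun_eq_iff)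
  show ?thesis
  proof (rule subshift_family.intro[OF ralg_end_algebra], rule subshift_family_axioms.intro)
    show "s_op X a \<in> carrier ?E" for a
      using suf by (auto simp: end_algebra_def s_op_def fun_eq_iff indicator_def)
    show "s_star_op X a \<in> carrier ?E" for a
      using subshift_suffix[OF assms(1), of "[a]"] by (auto simp: end_algebra_def s_star_op_def fun_eq_iff)
    show "s_op X a \<otimes>\<^bsub>?E\<^esub> s_star_op X a \<otimes>\<^bsub>?E\<^esub> s_op X a = s_op X a" for a
      using head_conc_suffix by (fastforce simp: end_algebra_simps s_op_def s_star_op_def fun_eq_iff)
    show "s_star_op X a \<otimes>\<^bsub>?E\<^esub> s_op X a \<otimes>\<^bsub>?E\<^esub> s_star_op X a = s_star_op X a" for a
      by (intro ext) (simp add: end_algebra_simps s_op_def s_star_op_def suffix_Suc_build)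
    show "mprod ?E (map (s_op X) \<beta>) \<otimes>\<^bsub>?E\<^esub> mprod ?E (map (s_star_op X) (rev \<alpha>)) \<otimes>\<^bsub>?E\<^esub>
        mprod ?E (map (s_op X) \<alpha>) \<otimes>\<^bsub>?E\<^esub> mprod ?E (map (s_star_op X) (rev \<beta>)) = proj_op (cyl X \<alpha> \<beta>)"
      for \<alpha> \<beta>
    proof (intro ext)
      fix f y
      have "y \<in> cyl X \<alpha> \<beta> \<longleftrightarrow> y \<in> X \<and> prefix (length \<beta>) y = \<beta> \<and> \<alpha> \<frown> suffix (length \<beta>) y \<in> X"
        by (rule mem_cyl_iff)
      moreover have "\<beta> \<frown> suffix (length \<beta>) y = y" if "prefix (length \<beta>) y = \<beta>"
        using prefix_suffix[of y "length \<beta>"] that by simp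
      ultimately show "(mprod ?E (map (s_op X) \<beta>) \<otimes>\<^bsub>?E\<^esub> mprod ?E (map (s_star_op X) (rev \<alpha>)) \<otimes>\<^bsub>?E\<^esub>
        mprod ?E (map (s_op X) \<alpha>) \<otimes>\<^bsub>?E\<^esub> mprod ?E (map (s_star_op X) (rev \<beta>))) f y = proj_op (cyl X \<alpha> \<beta>) f y"
        by (auto simp: end_algebra_simps mprod_s_op[OF assms(1)] mprod_s_star_op[OF assms(1)] proj_op_def)
    qed
  qed (use assms p in \<open>auto simp: end_algebra_simps proj_op_def fun_eq_iff alg_minus_end_algebra\<close>)
qed

lemma ralg_fun_algebra: "ralg (fun_algebra X :: ('r::comm_ring_1, 'a word \<Rightarrow> 'r) module)"
proof -
  let ?E = "fun_algebra X :: ('r, 'a word \<Rightarrow> 'r) module"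
  have "ring ?E"
  proof (rule ringI)
    show "abelian_group ?E"
    proof (rule abelian_groupI)
      fix f assume f: "f \<in> carrier ?E"
      show "\<exists>g\<in>carrier ?E. g \<oplus>\<^bsub>?E\<^esub> f = \<zero>\<^bsub>?E\<^esub>"
        by (rule bexI[of _ "\<lambda>x. - f x"]) (use f in \<open>auto simp: fun_algebra_def\<close>)
    qed (auto simp: fun_algebra_def algebra_simps)
    show "monoid ?E"
      by (rule monoidI) (auto simp: fun_algebra_def indicator_def fun_eq_iff mult.assoc)
  qed (auto simp: fun_algebra_def algebra_simps)
  then interpret ring ?E .
  show ?thesis
    by (rule ralg.intro[OF ring_axioms], rule ralg_axioms.intro) (auto simp: fun_algebra_def algebra_simps)
qed

lemma fun_algebra_simps:
  "f \<otimes>\<^bsub>fun_algebra X\<^esub> g = (\<lambda>x. f x * g x)" "\<one>\<^bsub>fun_algebra X\<^esub> = indicator X"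
  "\<zero>\<^bsub>fun_algebra X\<^esub> = (\<lambda>x. 0)" "f \<oplus>\<^bsub>fun_algebra X\<^esub> g = (\<lambda>x. f x + g x)"
  "r \<odot>\<^bsub>fun_algebra X\<^esub> f = (\<lambda>x. r * f x)"
  by (simp_all add: fun_algebra_def)

section \<open>Linear combinations of projections versus indicator functions\<close>

context subshift_family
begin

definition cyl_projs :: "'b set" where
  "cyl_projs = {p (cyl X \<alpha> \<beta>) | \<alpha> \<beta>. \<alpha> \<in> language X \<and> \<beta> \<in> language X}"

lemma cyl_projs_closed: "cyl_projs \<subseteq> carrier A"
  by (auto simp: cyl_projs_def)

lemma p_compl: "B \<in> bool_alg X \<Longrightarrow> C \<in> bool_alg X \<Longrightarrow> p B = p (B \<inter> C) \<oplus> p (B - C)"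
proof -
  assume B: "B \<in> bool_alg X" "C \<in> bool_alg X"
  have e: "B - C = B \<inter> (X - C)" using bool_alg_subset[OF B(1)] by auto
  have D: "B - C \<in> bool_alg X" unfolding e using B by auto
  have 1: "(B \<inter> C) \<union> (B - C) = B" by auto
  have 2: "(B \<inter> C) \<inter> (B - C) = {}" by auto
  show ?thesis using p_union[of "B \<inter> C" "B - C", unfolded 1 2] B D by (simp add: p_empty minus_eq)
qed

text \<open>Boolean operations are polynomial in projections: union is \<open>p + q - p q\<close>
  and complement is \<open>1 - p\<close>. Hence the cylinders already generate the projections of
  all sets in the Boolean algebra.\<close>

lemma p_diag:
  assumes "B \<in> bool_alg X"
  shows "p B \<in> gen_subalgebra A cyl_projs"
  using assms
proof induction
  note cl = gen_subalgebra_closed[OF cyl_projs_closed] gen_subalgebra_smult[OF cyl_projs_closed]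
  have minus: "x \<ominus> y \<in> gen_subalgebra A cyl_projs"
    if "x \<in> gen_subalgebra A cyl_projs" "y \<in> gen_subalgebra A cyl_projs" for x y
    using that cl(4)[of x "(-1) \<odot> y"] cl(6)[of y "-1"] cl(1)[of y] by (simp add: smult_minus_one minus_eq)
  {
    case (cyl \<alpha> \<beta>)
    then show ?case using gen_subalgebra_gen[OF cyl_projs_closed] by (auto simp: cyl_projs_def)
  next
    case empty
    then show ?case using cl by (simp add: p_empty)
  next
    case (union B C)
    then show ?case by (simp add: p_union p_inter minus cl)
  next
    case (compl B)
    have "p X = p (X \<inter> B) \<oplus> p (X - B)" by (rule p_compl) (use compl in auto)
    moreover have "X \<inter> B = B" using bool_alg_subset[OF compl(1)] by auto
    ultimately have "p (X - B) = \<one> \<ominus> p B"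
      using compl by (simp add: p_space minus_eq a_ac r_neg2 flip: minus_eq)
        (metis add.inv_solve_right' a_comm bool_alg.compl minus_eq p_closed add.m_closed)
    then show ?case using compl(2) cl(2) minus by simp
  }
qed

lemma mprod_cyl_projs:
  assumes "xs \<in> lists cyl_projs"
  shows "\<exists>C\<in>bool_alg X. mprod A xs = p C"
  using assms
proof (induction xs)
  case Nil
  show ?case using p_space by (intro bexI[of _ X]) auto
next
  case (Cons x xs)
  then obtain C \<alpha> \<beta> where "C \<in> bool_alg X" "mprod A xs = p C" "\<alpha> \<in> language X" "\<beta> \<in> language X" "x = p (cyl X \<alpha> \<beta>)"
    by (auto simp: cyl_projs_def)
  then show ?case by (intro bexI[of _ "cyl X \<alpha> \<beta> \<inter> C"]) (auto simp: p_inter)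
qed

text \<open>A linear combination of projections is determined by the corresponding linear combination of indicator
  functions: cut \<open>X\<close> into pieces on which the latter is constant.\<close>

lemma diag_kernel:
  assumes hom: "d \<in> alg_hom (A\<lparr>carrier := gen_subalgebra A cyl_projs\<rparr>) (fun_algebra X)"
    and dp: "\<And>C. C \<in> bool_alg X \<Longrightarrow> d (p C) = indicator C"
    and x: "x \<in> mspan cyl_projs"
  shows "\<lbrakk>B \<in> bool_alg X; \<forall>y\<in>B. \<mu> + d x y = 0\<rbrakk> \<Longrightarrow> (\<mu> \<odot> \<one> \<oplus> x) \<otimes> p B = \<zero>"
  using x
proof (induction arbitrary: B \<mu>)
  note D = alg_homD[OF hom, simplified]
  interpret DA: ralg "A\<lparr>carrier := gen_subalgebra A cyl_projs\<rparr>"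
    by (rule ralg_gen_subalgebra[OF cyl_projs_closed])
  {
    case zero
    have "d \<zero> = (\<lambda>y. 0)"
      using alg_hom_zero[OF DA.ralg_axioms ralg_fun_algebra hom] by (simp add: fun_algebra_simps)
    \<comment> \<open>At any point of \<open>B\<close> the hypothesis reads
      \<open>\<mu> = 0\<close>.\<close>
    then have "B = {} \<or> \<mu> = 0" using zero by auto
    then show ?case using zero by (auto simp: p_empty)
  next
    case (step xs x r)
    obtain C where C: "C \<in> bool_alg X" "mprod A xs = p C" using mprod_cyl_projs[OF step(1)] by auto
    have xd: "x \<in> gen_subalgebra A cyl_projs"
      using step(2) by (simp add: gen_subalgebra_eq_mspan[OF cyl_projs_closed])
    note xc = gen_subalgebra_closed(1)[OF cyl_projs_closed xd]
    have dx: "d (r \<odot> mprod A xs \<oplus> x) y = r * indicator C y + d x y" for y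
      using p_diag[OF C(1)] xd gen_subalgebra_smult[OF cyl_projs_closed]
      by (simp add: C D fun_algebra_simps dp)
    have e: "B - C = B \<inter> (X - C)" using bool_alg_subset[OF step(4)] by auto
    have BC: "B \<inter> C \<in> bool_alg X" "B - C \<in> bool_alg X" unfolding e using C(1) step(4) by auto
    \<comment> \<open>On \<open>B \<inter> C\<close> the leading term is the constant
      \<open>r\<close>, which moves into \<open>\<mu>\<close>; on \<open>B - C\<close> it vanishes.
      This is why the claim carries both a constant and a set.\<close>
    have 1: "((\<mu> + r) \<odot> \<one> \<oplus> x) \<otimes> p (B \<inter> C) = \<zero>"
      by (rule step(3)[OF BC(1)]) (use step(5) in \<open>auto simp: dx indicator_def add.assoc\<close>)
    have 2: "(\<mu> \<odot> \<one> \<oplus> x) \<otimes> p (B - C) = \<zero>"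
      by (rule step(3)[OF BC(2)]) (use step(5) in \<open>auto simp: dx indicator_def\<close>)
    have 3: "p C \<otimes> p (B \<inter> C) = p (B \<inter> C)"
      using p_inter[OF C(1) BC(1)] by (simp add: Int_absorb1)
    have "C \<inter> (B - C) = {}" by auto
    then have 4: "p C \<otimes> p (B - C) = \<zero>"
      using p_inter[OF C(1) BC(2)] p_empty by simp
    let ?y = "\<mu> \<odot> \<one> \<oplus> (r \<odot> p C \<oplus> x)"
    have "?y \<otimes> p (B \<inter> C) = ((\<mu> + r) \<odot> \<one> \<oplus> x) \<otimes> p (B \<inter> C)"
      using xc C(1) BC(1) by (simp add: l_distr smult_mult_l smult_l_distr 3 a_assoc)
    moreover have "?y \<otimes> p (B - C) = (\<mu> \<odot> \<one> \<oplus> x) \<otimes> p (B - C)"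
      using xc C(1) BC(2) by (simp add: l_distr smult_mult_l 4)
    ultimately have "?y \<otimes> (p (B \<inter> C) \<oplus> p (B - C)) = \<zero>"
      using xc C(1) BC 1 2 by (simp add: r_distr)
    then show ?case using p_compl[OF step(4) C(1)] C(2) by simp
  }
qed

lemma diag_inj:
  assumes hom: "d \<in> alg_hom (A\<lparr>carrier := gen_subalgebra A cyl_projs\<rparr>) (fun_algebra X)"
    and dp: "\<And>C. C \<in> bool_alg X \<Longrightarrow> d (p C) = indicator C"
  shows "inj_on d (gen_subalgebra A cyl_projs)"
proof (rule inj_onI)
  let ?D = "A\<lparr>carrier := gen_subalgebra A cyl_projs\<rparr>"
  interpret DA: ralg ?D
    by (rule ralg_gen_subalgebra[OF cyl_projs_closed])
  note cl = gen_subalgebra_closed[OF cyl_projs_closed] gen_subalgebra_smult[OF cyl_projs_closed]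
  note D = alg_homD[OF hom, simplified]
  fix x y assume x: "x \<in> gen_subalgebra A cyl_projs" and y: "y \<in> gen_subalgebra A cyl_projs" and eq: "d x = d y"
  let ?z = "x \<oplus> (-1) \<odot> y"
  have z: "?z \<in> gen_subalgebra A cyl_projs" using x y cl by auto
  have "d ?z = (\<lambda>u. 0)" using x y cl(6) by (simp add: D fun_algebra_simps eq)
  \<comment> \<open>The kernel statement on the whole space with constant \<open>0\<close>.\<close>
  then have "(0 \<odot> \<one> \<oplus> ?z) \<otimes> p X = \<zero>"
    by (intro diag_kernel[OF hom dp]) (use z in \<open>simp_all add: gen_subalgebra_eq_mspan[OF cyl_projs_closed]\<close>)
  then have "x \<ominus> y = \<zero>" using x y cl(1) by (simp add: p_space smult_minus_one minus_eq)
  then show "x = y" using x y cl(1) by (simp add: r_right_minus_eq)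
qed

end

section \<open>The diagonal as an algebra of functions\<close>

text \<open>The parameter \<open>ty\<close> carries the scalar ring, a type that occurs in neither
  assumption.\<close>

locale shift_space =
  fixes X :: "'a word set" and ty :: "'r::comm_ring_1 itself"
  assumes subshift: "subshift X" and letters: "\<And>a. X \<noteq> {} \<Longrightarrow> [a] \<in> language X"
begin

abbreviation SA :: "('r, ('a sgen list \<Rightarrow>\<^sub>0 'r) set) module" where "SA \<equiv> subshift_algebra X"

abbreviation EA :: "('r, ('a word \<Rightarrow> 'r) \<Rightarrow> 'a word \<Rightarrow> 'r) module" where "EA \<equiv> end_algebra X"

abbreviation pg :: "'a word set \<Rightarrow> ('a sgen list \<Rightarrow>\<^sub>0 'r) set" where "pg C \<equiv> sclass X (gen (Proj C))"

sublocale S: subshift_family SA X pg "\<lambda>a. sclass X (gen (Gen a))" "\<lambda>a. sclass X (gen (Gen_star a))"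
  by (rule subshift_family_subshift_algebra[OF subshift letters])

sublocale E: subshift_family EA X proj_op "s_op X" "s_star_op X"
  by (rule subshift_family_end_algebra[OF subshift letters])

definition rho :: "('a sgen list \<Rightarrow>\<^sub>0 'r) set \<Rightarrow> ('a word \<Rightarrow> 'r) \<Rightarrow> 'a word \<Rightarrow> 'r" where
  "rho = (SOME h. h \<in> alg_hom SA EA \<and> (\<forall>C\<in>bool_alg X. h (pg C) = proj_op C) \<and>
     (\<forall>a. h (sclass X (gen (Gen a))) = s_op X a) \<and> (\<forall>a. h (sclass X (gen (Gen_star a))) = s_star_op X a))"

lemma rho:
  shows rho_hom: "rho \<in> alg_hom SA EA"
    and rho_proj: "C \<in> bool_alg X \<Longrightarrow> rho (pg C) = proj_op C"
    and rho_s: "rho (sclass X (gen (Gen a))) = s_op X a"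
    and rho_s_star: "rho (sclass X (gen (Gen_star a))) = s_star_op X a"
proof -
  obtain h where "h \<in> alg_hom SA EA" "\<And>C. C \<in> bool_alg X \<Longrightarrow> h (pg C) = proj_op C"
    "\<And>a. h (sclass X (gen (Gen a))) = s_op X a" "\<And>a. h (sclass X (gen (Gen_star a))) = s_star_op X a"
    by (rule subshift_algebra_universal[OF E.subshift_family_axioms]) blast
  then have ex: "\<exists>h. h \<in> alg_hom SA EA \<and> (\<forall>C\<in>bool_alg X. h (pg C) = proj_op C) \<and>
     (\<forall>a. h (sclass X (gen (Gen a))) = s_op X a) \<and> (\<forall>a. h (sclass X (gen (Gen_star a))) = s_star_op X a)"
    by blast
  from someI_ex[OF ex, folded rho_def]
  show "rho \<in> alg_hom SA EA" "C \<in> bool_alg X \<Longrightarrow> rho (pg C) = proj_op C"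
    "rho (sclass X (gen (Gen a))) = s_op X a" "rho (sclass X (gen (Gen_star a))) = s_star_op X a"
    by auto
qed

lemma rho_wprod: "rho (S.wprod w) = E.wprod w"
proof -
  have "rho (mprod SA (map S.letter w)) = mprod EA (map rho (map S.letter w))"
    by (rule alg_hom_mprod[OF rho_hom S.ralg_axioms]) auto
  also have "map rho (map S.letter w) = map E.letter w"
    by (simp add: S.letter_def E.letter_def rho_s rho_s_star)
  finally show ?thesis by (simp add: S.wprod_def E.wprod_def)
qed

lemma spi_eq_wprod:
  assumes "reduced g"
  shows "spi X g = S.wprod g"
proof (cases "simple_elt X g")
  case True
  then obtain \<alpha> \<beta> where g: "g = quot_word \<alpha> \<beta>" by (auto simp: simple_elt_def)
  note h = sclass_alg_hom[of X, where ?'b = 'r]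
  show ?thesis using True
    by (simp add: spi_def g alg_homD(2)[OF h, simplified] alg_hom_s_word[OF h] S.wprod_quot_word)
next
  case False
  then show ?thesis using S.wprod_not_simple[OF assms] by (simp add: spi_def)
qed

text \<open>Pullbacks compose in reverse order: the argument first loses \<open>\<alpha>\<close> and
  then receives \<open>\<beta>\<close>, which is the map inside \<open>tau\<close> at
  \<open>\<alpha> \<beta>^-1\<close>. If \<open>g\<close> is not simple, both sides are
  zero.\<close>

lemma rho_spi:
  assumes "reduced g"
  shows "rho (spi X g) f = tau X g f"
proof (cases "simple_elt X g")
  case True
  then obtain \<alpha> \<beta> where g: "g = quot_word \<alpha> \<beta>" by (auto simp: simple_elt_def)
  show ?thesis
  proof
    fix y
    have "rho (spi X g) f y = (if y \<in> X \<and> prefix (length \<alpha>) y = \<alpha>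
        then (if \<beta> \<frown> suffix (length \<alpha>) y \<in> X then f (\<beta> \<frown> suffix (length \<alpha>) y) else 0) else 0)"
      unfolding spi_eq_wprod[OF assms] rho_wprod unfolding g E.wprod_quot_word
      by (simp add: end_algebra_simps mprod_s_op[OF subshift] mprod_s_star_op[OF subshift])
    also have "\<dots> = tau X g f y"
      using True by (simp add: tau_def g mem_cyl_iff tau_hat_def)
    finally show "rho (spi X g) f y = tau X g f y" .
  qed
next
  case False
  then show ?thesis
    using E.wprod_not_simple[OF assms] by (simp add: spi_eq_wprod[OF assms] rho_wprod tau_def end_algebra_simps)
qed

section \<open>Diagonal elements as multiplication operators\<close>

abbreviation DA :: "('r, ('a sgen list \<Rightarrow>\<^sub>0 'r) set) module" where "DA \<equiv> diag_subalgebra X"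

abbreviation FA :: "('r, 'a word \<Rightarrow> 'r) module" where "FA \<equiv> diag_algebra X"

lemma DA_eq: "DA = SA\<lparr>carrier := gen_subalgebra SA S.cyl_projs\<rparr>"
  by (simp add: diag_subalgebra_def S.cyl_projs_def)

lemma carrier_DA: "carrier DA = gen_subalgebra SA S.cyl_projs"
  by (simp add: DA_eq)

sublocale D: ralg DA
  unfolding DA_eq by (rule S.ralg_gen_subalgebra[OF S.cyl_projs_closed])

lemma DA_simps [simp]:
  "x \<otimes>\<^bsub>DA\<^esub> y = x \<otimes>\<^bsub>SA\<^esub> y" "x \<oplus>\<^bsub>DA\<^esub> y = x \<oplus>\<^bsub>SA\<^esub> y" "\<one>\<^bsub>DA\<^esub> = \<one>\<^bsub>SA\<^esub>" "\<zero>\<^bsub>DA\<^esub> = \<zero>\<^bsub>SA\<^esub>"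
  "r \<odot>\<^bsub>DA\<^esub> x = r \<odot>\<^bsub>SA\<^esub> x"
  by (simp_all add: DA_eq)

lemma DA_carrier_SA: "x \<in> carrier DA \<Longrightarrow> x \<in> carrier SA"
  unfolding carrier_DA by (rule S.gen_subalgebra_closed(1)[OF S.cyl_projs_closed])

text \<open>A multiplication operator is recovered from its value at the unit function; this yields
  the function identified with a diagonal element.\<close>

definition delta :: "('a sgen list \<Rightarrow>\<^sub>0 'r) set \<Rightarrow> 'a word \<Rightarrow> 'r" where
  "delta x = rho x (indicator X)"

lemma delta_proj: "C \<in> bool_alg X \<Longrightarrow> delta (pg C) = indicator C"
  using bool_alg_subset[of C X] by (auto simp: delta_def rho_proj proj_op_def indicator_def fun_eq_iff)

text \<open>The induction covers all \<open>f\<close> at once, since for a product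
  \<open>rho x\<close> acts on the function \<open>rho y f\<close>.\<close>

lemma rho_diag:
  assumes "x \<in> carrier DA"
  shows "rho x f = (\<lambda>y. delta x y * f y)"
  using S.cyl_projs_closed assms[unfolded carrier_DA]
proof (induction arbitrary: f rule: S.gen_subalgebra_induct)
  case (gen x)
  then obtain C where C: "C \<in> bool_alg X" "x = pg C"
    unfolding S.cyl_projs_def using bool_alg_closed(4) by blast
  show ?case by (simp add: C delta_proj) (auto simp: rho_proj C proj_op_def)
next
  case one
  show ?case by (auto simp: delta_def alg_homD(4)[OF rho_hom] end_algebra_simps indicator_def)
next
  case (add x y)
  then have "x \<in> carrier SA" "y \<in> carrier SA" using S.gen_subalgebra_closed(1)[OF S.cyl_projs_closed] by auto
  then have r: "rho (x \<oplus>\<^bsub>SA\<^esub> y) f = (\<lambda>u. rho x f u + rho y f u)" for f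
    by (simp add: alg_homD(3)[OF rho_hom] end_algebra_simps)
  show ?case by (simp add: r delta_def add(3)[of f] add(4)[of f] distrib_right)
next
  case (mult x y)
  then have "x \<in> carrier SA" "y \<in> carrier SA" using S.gen_subalgebra_closed(1)[OF S.cyl_projs_closed] by auto
  then have r: "rho (x \<otimes>\<^bsub>SA\<^esub> y) f = rho x (rho y f)" for f
    by (simp add: alg_homD(2)[OF rho_hom] end_algebra_simps)
  have "delta (x \<otimes>\<^bsub>SA\<^esub> y) = (\<lambda>u. delta x u * delta y u)"
    unfolding delta_def[of "x \<otimes>\<^bsub>SA\<^esub> y"] r mult(3)[of "rho y _"] by (simp add: delta_def)
  then show ?case by (simp add: r mult(4)[of f] mult(3)[of "\<lambda>u. delta y u * f u"] mult.assoc)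
next
  case (smult r x)
  then have "x \<in> carrier SA" using S.gen_subalgebra_closed(1)[OF S.cyl_projs_closed] by auto
  then have r: "rho (r \<odot>\<^bsub>SA\<^esub> x) f = (\<lambda>u. r * rho x f u)" for f
    by (simp add: alg_homD(5)[OF rho_hom] end_algebra_simps)
  show ?case by (simp add: r delta_def smult(2)[of f] mult.assoc)
qed

lemma delta_hom: "delta \<in> alg_hom DA (fun_algebra X)"
proof (rule alg_homI)
  note h = alg_homD[OF rho_hom]
  fix x assume x: "x \<in> carrier DA"
  have "rho x \<in> carrier EA" using h(1) DA_carrier_SA[OF x] .
  then show "delta x \<in> carrier (fun_algebra X)"
    by (auto simp: delta_def end_algebra_def fun_algebra_def)
  show "delta (r \<odot>\<^bsub>DA\<^esub> x) = r \<odot>\<^bsub>fun_algebra X\<^esub> delta x" for r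
    using DA_carrier_SA[OF x] by (simp add: delta_def h(5) end_algebra_simps fun_algebra_simps)
  fix y assume y: "y \<in> carrier DA"
  show "delta (x \<oplus>\<^bsub>DA\<^esub> y) = delta x \<oplus>\<^bsub>fun_algebra X\<^esub> delta y"
    using DA_carrier_SA[OF x] DA_carrier_SA[OF y] by (simp add: delta_def h(3) end_algebra_simps fun_algebra_simps)
  have "delta (x \<otimes>\<^bsub>DA\<^esub> y) = rho x (rho y (indicator X))"
    using DA_carrier_SA[OF x] DA_carrier_SA[OF y] by (simp add: delta_def h(2) end_algebra_simps)
  then show "delta (x \<otimes>\<^bsub>DA\<^esub> y) = delta x \<otimes>\<^bsub>fun_algebra X\<^esub> delta y"
    by (simp add: rho_diag[OF x] fun_algebra_simps flip: delta_def)
next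
  show "delta \<one>\<^bsub>DA\<^esub> = \<one>\<^bsub>fun_algebra X\<^esub>"
    by (auto simp: delta_def alg_homD(4)[OF rho_hom] end_algebra_simps fun_algebra_simps indicator_def)
qed

lemma delta_image: "delta ` carrier DA = carrier FA"
proof -
  have "delta ` gen_subalgebra SA S.cyl_projs = gen_subalgebra (fun_algebra X) (delta ` S.cyl_projs)"
    by (rule alg_hom_image_gen_subalgebra[OF S.ralg_axioms ralg_fun_algebra S.cyl_projs_closed delta_hom[unfolded DA_eq]])
  also have "delta ` S.cyl_projs = {indicator (cyl X \<alpha> \<beta>) | \<alpha> \<beta>. \<alpha> \<in> language X \<and> \<beta> \<in> language X}"
    (is "_ = ?I")
  proof
    show "delta ` S.cyl_projs \<subseteq> ?I" by (force simp: S.cyl_projs_def delta_proj)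
    show "?I \<subseteq> delta ` S.cyl_projs"
    proof
      fix f assume "f \<in> ?I"
      then obtain \<alpha> \<beta> where f: "f = indicator (cyl X \<alpha> \<beta>)" "\<alpha> \<in> language X" "\<beta> \<in> language X" by auto
      then have "f = delta (pg (cyl X \<alpha> \<beta>))" by (simp add: delta_proj)
      then show "f \<in> delta ` S.cyl_projs" using f unfolding S.cyl_projs_def by blast
    qed
  qed
  finally show ?thesis by (simp add: carrier_DA diag_algebra_def)
qed

lemma delta_iso: "delta \<in> alg_iso DA FA"
  using alg_hom_corestrict[OF delta_hom delta_image]
    S.diag_inj[OF delta_hom[unfolded DA_eq] delta_proj] delta_image
  by (simp add: alg_iso_def' diag_algebra_def carrier_DA bij_betw_def)

lemma ralg_FA: "ralg FA"
  unfolding diag_algebra_def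
  by (rule ralg.ralg_gen_subalgebra[OF ralg_fun_algebra])
    (auto simp: fun_algebra_def cyl_def indicator_def)

text \<open>The inverse of \<open>delta\<close> meets the description. It is the only candidate
  because a homomorphism on the diagonal is fixed by its values at the indicators of cylinders, and
  outside the diagonal extensionality leaves no choice.\<close>

lemma diag_ident_eq: "diag_ident X = restrict (inv_into (carrier DA) delta) (carrier FA)"
  unfolding diag_ident_def
proof (rule the_equality)
  let ?k = "inv_into (carrier DA) delta"
  note ki = alg_iso_inv_into[OF D.ralg_axioms delta_iso]
  have inj: "inj_on delta (carrier DA)" using delta_iso by (simp add: alg_iso_def' bij_betw_def)
  have kp: "?k (indicator (cyl X \<alpha> \<beta>)) = pg (cyl X \<alpha> \<beta>)" "indicator (cyl X \<alpha> \<beta>) \<in> carrier FA"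
    if "\<alpha> \<in> language X" "\<beta> \<in> language X" for \<alpha> \<beta>
  proof -
    have c: "pg (cyl X \<alpha> \<beta>) \<in> carrier DA" using that S.p_diag by (simp add: carrier_DA)
    then show "?k (indicator (cyl X \<alpha> \<beta>)) = pg (cyl X \<alpha> \<beta>)"
      using inv_into_f_f[OF inj c] that by (simp add: delta_proj)
    show "indicator (cyl X \<alpha> \<beta>) \<in> carrier FA"
      using c delta_image that by (force simp: delta_proj)
  qed
  show "restrict ?k (carrier FA) \<in> extensional (carrier FA) \<and> restrict ?k (carrier FA) \<in> alg_iso FA DA \<and>
    (\<forall>\<alpha>\<in>language X. \<forall>\<beta>\<in>language X. restrict ?k (carrier FA) (indicator (cyl X \<alpha> \<beta>)) = pg (cyl X \<alpha> \<beta>))"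
    using alg_iso_cong[OF ralg_FA ki, of "restrict ?k (carrier FA)"] kp by auto
  fix j assume j: "j \<in> extensional (carrier FA) \<and> j \<in> alg_iso FA DA \<and>
    (\<forall>\<alpha>\<in>language X. \<forall>\<beta>\<in>language X. j (indicator (cyl X \<alpha> \<beta>)) = pg (cyl X \<alpha> \<beta>))"
  let ?I = "{indicator (cyl X \<alpha> \<beta>) | \<alpha> \<beta>. \<alpha> \<in> language X \<and> \<beta> \<in> language X} :: ('a word \<Rightarrow> 'r) set"
  have I: "?I \<subseteq> carrier (fun_algebra X)" by (auto simp: fun_algebra_def cyl_def indicator_def)
  have FAe: "FA = (fun_algebra X)\<lparr>carrier := gen_subalgebra (fun_algebra X) ?I\<rparr>" by (simp add: diag_algebra_def)
  have "j f = ?k f" if f: "f \<in> carrier FA" for f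
  proof (rule alg_hom_eq_on_gen_subalgebra[OF ralg_fun_algebra I])
    show "f \<in> gen_subalgebra (fun_algebra X) ?I" using f by (simp add: FAe)
    show "j \<in> alg_hom ((fun_algebra X)\<lparr>carrier := gen_subalgebra (fun_algebra X) ?I\<rparr>) DA"
      using j unfolding FAe[symmetric] by (simp add: alg_iso_def')
    show "?k \<in> alg_hom ((fun_algebra X)\<lparr>carrier := gen_subalgebra (fun_algebra X) ?I\<rparr>) DA"
      using ki unfolding FAe[symmetric] by (simp add: alg_iso_def')
  qed (use j kp in auto)
  then show "j = restrict ?k (carrier FA)"
    using j by (intro extensionalityI[of j "carrier FA"]) auto
qed

lemma inv_diag_ident:
  assumes "x \<in> carrier DA"
  shows "inv_into (carrier FA) (diag_ident X) x = delta x"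
proof -
  have inj: "inj_on delta (carrier DA)" using delta_iso by (simp add: alg_iso_def' bij_betw_def)
  have dx: "delta x \<in> carrier FA" using delta_image assms by auto
  have "inj_on (diag_ident X) (carrier FA)"
    unfolding diag_ident_eq delta_image[symmetric] by (auto simp: inj_on_def inv_into_f_f[OF inj])
  moreover have "diag_ident X (delta x) = x"
    using dx by (simp add: diag_ident_eq inv_into_f_f[OF inj assms])
  ultimately show ?thesis using dx by (metis inv_into_f_f)
qed

end

section \<open>Partial group algebras\<close>

context par_rep
begin

definition diag :: "'b set" where "diag = gen_subalgebra A (e ` carrier G)"

lemma e_image_closed: "e ` carrier G \<subseteq> carrier A"
  by auto

lemmas diag_closed = gen_subalgebra_closed[OF e_image_closed, folded diag_def]
  gen_subalgebra_smult[OF e_image_closed, folded diag_def]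

lemma e_diag [simp]: "g \<in> carrier G \<Longrightarrow> e g \<in> diag"
  using gen_subalgebra_gen[OF e_image_closed] by (auto simp: diag_def)

lemma diag_induct [consumes 1, case_names gen one add mult smult]:
  assumes "x \<in> diag"
    and "\<And>g. g \<in> carrier G \<Longrightarrow> P (e g)" "P \<one>"
    and "\<And>x y. x \<in> diag \<Longrightarrow> y \<in> diag \<Longrightarrow> P x \<Longrightarrow> P y \<Longrightarrow> P (x \<oplus> y)"
    and "\<And>x y. x \<in> diag \<Longrightarrow> y \<in> diag \<Longrightarrow> P x \<Longrightarrow> P y \<Longrightarrow> P (x \<otimes> y)"
    and "\<And>r x. x \<in> diag \<Longrightarrow> P x \<Longrightarrow> P (r \<odot> x)"
  shows "P x"
  using e_image_closed assms(1)[unfolded diag_def]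
  by (induction rule: gen_subalgebra_induct) (use assms(2-) in \<open>auto simp: diag_def\<close>)

lemma diag_commute_e:
  assumes "x \<in> diag" "g \<in> carrier G"
  shows "x \<otimes> e g = e g \<otimes> x"
  using assms(1)
proof (induction rule: diag_induct)
  case (mult x y)
  note c = diag_closed(1)[OF mult(1)] diag_closed(1)[OF mult(2)]
  have "x \<otimes> y \<otimes> e g = x \<otimes> (y \<otimes> e g)" using c assms(2) by (simp add: m_assoc)
  also have "\<dots> = x \<otimes> e g \<otimes> y" unfolding mult(4) using c assms(2) by (simp add: m_assoc)
  also have "\<dots> = e g \<otimes> (x \<otimes> y)" unfolding mult(3) using c assms(2) by (simp add: m_assoc)
  finally show ?case .
qed (use assms(2) in \<open>auto simp: e_comm l_distr r_distr smult_mult_l smult_mult_r diag_closed(1)\<close>)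

text \<open>The element \<open>z\<close> arises from \<open>x\<close> by translating the index of
  every idempotent by \<open>g\<close>, as in \<open>u_e\<close>. Some such \<open>z\<close> is
  enough for \<open>corner_conj\<close>.\<close>

lemma u_diag:
  assumes "x \<in> diag" "g \<in> carrier G"
  shows "\<exists>z\<in>diag. u g \<otimes> x = z \<otimes> u g"
  using assms(1)
proof (induction rule: diag_induct)
  case (gen h)
  then show ?case using assms(2) by (intro bexI[of _ "e (g \<otimes>\<^bsub>G\<^esub> h)"]) (auto simp: u_e)
next
  case one
  then show ?case using assms(2) diag_closed(2) by (intro bexI[of _ \<one>]) auto
next
  case (add x y)
  then obtain z w where zw: "z \<in> diag" "w \<in> diag" "u g \<otimes> x = z \<otimes> u g" "u g \<otimes> y = w \<otimes> u g" by auto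
  then show ?case
    using add(1,2) assms(2) by (intro bexI[of _ "z \<oplus> w"]) (auto simp: l_distr r_distr diag_closed)
next
  case (mult x y)
  then obtain z w where zw: "z \<in> diag" "w \<in> diag" "u g \<otimes> x = z \<otimes> u g" "u g \<otimes> y = w \<otimes> u g" by auto
  have c: "x \<in> carrier A" "y \<in> carrier A" "z \<in> carrier A" "w \<in> carrier A" using mult(1,2) zw(1,2) diag_closed(1) by auto
  have "u g \<otimes> (x \<otimes> y) = (u g \<otimes> x) \<otimes> y" using c assms(2) by (simp add: m_assoc)
  also have "\<dots> = z \<otimes> (u g \<otimes> y)" unfolding zw(3) using c assms(2) by (simp add: m_assoc)
  also have "\<dots> = (z \<otimes> w) \<otimes> u g" unfolding zw(4) using c assms(2) by (simp add: m_assoc)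
  finally show ?case using diag_closed(5)[OF zw(1,2)] by blast
next
  case (smult r x)
  then obtain z where z: "z \<in> diag" "u g \<otimes> x = z \<otimes> u g" by auto
  then show ?case
    using smult(1) assms(2)
    by (intro bexI[of _ "r \<odot> z"]) (auto simp: smult_mult_l smult_mult_r diag_closed)
qed

definition corner :: "'g \<Rightarrow> ('r, 'b) module" where
  "corner g = idem_ideal (A\<lparr>carrier := diag\<rparr>) (e g)"

lemma corner_simps [simp]:
  "x \<otimes>\<^bsub>corner g\<^esub> y = x \<otimes> y" "x \<oplus>\<^bsub>corner g\<^esub> y = x \<oplus> y" "\<one>\<^bsub>corner g\<^esub> = e g" "r \<odot>\<^bsub>corner g\<^esub> x = r \<odot> x"
  by (simp_all add: corner_def idem_ideal_def)

lemma carrier_corner: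
  assumes "g \<in> carrier G"
  shows "x \<in> carrier (corner g) \<longleftrightarrow> x \<in> diag \<and> x \<otimes> e g = x"
proof
  assume "x \<in> carrier (corner g)"
  then obtain y where "y \<in> diag" "x = y \<otimes> e g" by (auto simp: corner_def idem_ideal_def)
  then show "x \<in> diag \<and> x \<otimes> e g = x" using assms by (simp add: diag_closed m_assoc e_idem)
next
  assume "x \<in> diag \<and> x \<otimes> e g = x"
  then show "x \<in> carrier (corner g)" unfolding corner_def idem_ideal_def by simp metis
qed

text \<open>With \<open>z\<close> from \<open>u_diag\<close> the conjugate is \<open>z\<close> times
  \<open>e g\<close>. Conjugating back multiplies \<open>x\<close> on both sides by the idempotent
  of \<open>inv g\<close>, which is the unit of the corner containing \<open>x\<close>.\<close>

lemma corner_conj: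
  assumes g: "g \<in> carrier G" and x: "x \<in> carrier (corner (inv\<^bsub>G\<^esub> g))"
  shows "u g \<otimes> x \<otimes> u (inv\<^bsub>G\<^esub> g) \<in> carrier (corner g)"
    and "u (inv\<^bsub>G\<^esub> g) \<otimes> (u g \<otimes> x \<otimes> u (inv\<^bsub>G\<^esub> g)) \<otimes> u g = x"
proof -
  have xd: "x \<in> diag" and xe: "x \<otimes> e (inv\<^bsub>G\<^esub> g) = x" using x carrier_corner[of "inv\<^bsub>G\<^esub> g"] g by auto
  have ex: "e (inv\<^bsub>G\<^esub> g) \<otimes> x = x" using diag_commute_e[OF xd, of "inv\<^bsub>G\<^esub> g"] xe g by simp
  obtain z where z: "z \<in> diag" "u g \<otimes> x = z \<otimes> u g" using u_diag[OF xd g] by auto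
  have c: "x \<in> carrier A" "z \<in> carrier A" using xd z(1) diag_closed(1) by auto
  have "u g \<otimes> x \<otimes> u (inv\<^bsub>G\<^esub> g) = z \<otimes> e g" using c g by (simp add: z(2) e_def m_assoc)
  then show "u g \<otimes> x \<otimes> u (inv\<^bsub>G\<^esub> g) \<in> carrier (corner g)"
    using z(1) c g by (simp add: carrier_corner diag_closed m_assoc e_idem)
  have "u (inv\<^bsub>G\<^esub> g) \<otimes> (u g \<otimes> x \<otimes> u (inv\<^bsub>G\<^esub> g)) \<otimes> u g = e (inv\<^bsub>G\<^esub> g) \<otimes> x \<otimes> e (inv\<^bsub>G\<^esub> g)"
    using c g by (simp add: e_def m_assoc)
  then show "u (inv\<^bsub>G\<^esub> g) \<otimes> (u g \<otimes> x \<otimes> u (inv\<^bsub>G\<^esub> g)) \<otimes> u g = x" by (simp add: ex xe)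
qed

lemma conj_alg_iso:
  assumes g: "g \<in> carrier G"
  shows "(\<lambda>x. u g \<otimes> x \<otimes> u (inv\<^bsub>G\<^esub> g)) \<in> alg_iso (corner (inv\<^bsub>G\<^esub> g)) (corner g)"
    and "h \<in> carrier G \<Longrightarrow> u g \<otimes> (e h \<otimes> e (inv\<^bsub>G\<^esub> g)) \<otimes> u (inv\<^bsub>G\<^esub> g) = e (g \<otimes>\<^bsub>G\<^esub> h) \<otimes> e g"
proof -
  let ?f = "\<lambda>x. u g \<otimes> x \<otimes> u (inv\<^bsub>G\<^esub> g)"
  let ?D = "corner (inv\<^bsub>G\<^esub> g)"
  have D: "x \<in> carrier A" "x \<otimes> e (inv\<^bsub>G\<^esub> g) = x" if "x \<in> carrier ?D" for x
    using that carrier_corner[of "inv\<^bsub>G\<^esub> g" x] g diag_closed(1) by auto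
  have "?f \<in> alg_hom ?D (corner g)"
  proof (rule alg_homI)
    fix x assume x: "x \<in> carrier ?D"
    show "?f x \<in> carrier (corner g)" by (rule corner_conj(1)[OF g x])
    show "?f (r \<odot>\<^bsub>?D\<^esub> x) = r \<odot>\<^bsub>corner g\<^esub> ?f x" for r
      using D(1)[OF x] g by (simp add: smult_mult_l smult_mult_r)
    fix y assume y: "y \<in> carrier ?D"
    show "?f (x \<oplus>\<^bsub>?D\<^esub> y) = ?f x \<oplus>\<^bsub>corner g\<^esub> ?f y"
      using D(1)[OF x] D(1)[OF y] g by (simp add: l_distr r_distr)
    \<comment> \<open>The two inner factors form the unit of the source corner, which
      \<open>x\<close> absorbs.\<close>
    have "?f x \<otimes> ?f y = u g \<otimes> (x \<otimes> e (inv\<^bsub>G\<^esub> g)) \<otimes> y \<otimes> u (inv\<^bsub>G\<^esub> g)"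
      using D(1)[OF x] D(1)[OF y] g by (simp add: e_def m_assoc)
    then show "?f (x \<otimes>\<^bsub>?D\<^esub> y) = ?f x \<otimes>\<^bsub>corner g\<^esub> ?f y"
      using D(1)[OF x] D(1)[OF y] g by (simp add: D(2)[OF x] m_assoc)
  next
    show "?f \<one>\<^bsub>?D\<^esub> = \<one>\<^bsub>corner g\<^esub>" using g u_u_inv[OF g] by (simp add: e_def[of g])
  qed
  moreover have "bij_betw ?f (carrier ?D) (carrier (corner g))"
  proof (rule bij_betwI)
    show "?f \<in> carrier ?D \<rightarrow> carrier (corner g)" using corner_conj(1)[OF g] by auto
    show "(\<lambda>x. u (inv\<^bsub>G\<^esub> g) \<otimes> x \<otimes> u g) \<in> carrier (corner g) \<rightarrow> carrier ?D"
      using corner_conj(1)[of "inv\<^bsub>G\<^esub> g"] g by auto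
    show "u (inv\<^bsub>G\<^esub> g) \<otimes> ?f x \<otimes> u g = x" if "x \<in> carrier ?D" for x
      by (rule corner_conj(2)[OF g that])
    show "?f (u (inv\<^bsub>G\<^esub> g) \<otimes> y \<otimes> u g) = y" if "y \<in> carrier (corner g)" for y
      using corner_conj(2)[of "inv\<^bsub>G\<^esub> g" y] g that by simp
  qed
  ultimately show "?f \<in> alg_iso ?D (corner g)" by (simp add: alg_iso_def')
  show "u g \<otimes> (e h \<otimes> e (inv\<^bsub>G\<^esub> g)) \<otimes> u (inv\<^bsub>G\<^esub> g) = e (g \<otimes>\<^bsub>G\<^esub> h) \<otimes> e g" if h: "h \<in> carrier G"
  proof -
    have "u g \<otimes> (e h \<otimes> e (inv\<^bsub>G\<^esub> g)) \<otimes> u (inv\<^bsub>G\<^esub> g) = (u g \<otimes> e h) \<otimes> (e (inv\<^bsub>G\<^esub> g) \<otimes> u (inv\<^bsub>G\<^esub> g))"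
      using g h by (simp add: m_assoc)
    also have "\<dots> = e (g \<otimes>\<^bsub>G\<^esub> h) \<otimes> e g"
      using g h by (simp add: u_e u_inv_u m_assoc e_def[of g])
    finally show ?thesis .
  qed
qed

text \<open>Elements of the corner have the form \<open>y ?e\<close> with \<open>y\<close> diagonal,
  and \<open>y \<mapsto> y ?e\<close> is multiplicative because \<open>?e\<close> is idempotent and
  commutes with the diagonal. Agreement thus spreads from the idempotents \<open>e h\<close> to all
  \<open>y\<close>.\<close>

lemma corner_hom_unique:
  assumes g: "g \<in> carrier G"
    and f: "f \<in> alg_hom (corner (inv\<^bsub>G\<^esub> g)) B" and k: "k \<in> alg_hom (corner (inv\<^bsub>G\<^esub> g)) B"
    and eq: "\<And>h. h \<in> carrier G \<Longrightarrow> f (e h \<otimes> e (inv\<^bsub>G\<^esub> g)) = k (e h \<otimes> e (inv\<^bsub>G\<^esub> g))"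
    and x: "x \<in> carrier (corner (inv\<^bsub>G\<^esub> g))"
  shows "f x = k x"
proof -
  let ?e = "e (inv\<^bsub>G\<^esub> g)"
  note F = alg_homD[OF f, simplified] and K = alg_homD[OF k, simplified]
  have gi [simp]: "inv\<^bsub>G\<^esub> g \<in> carrier G" using g by simp
  have cc: "y \<otimes> ?e \<in> carrier (corner (inv\<^bsub>G\<^esub> g))" if "y \<in> diag" for y
    using that diag_closed by (simp add: carrier_corner m_assoc e_idem)
  have "f (y \<otimes> ?e) = k (y \<otimes> ?e)" if "y \<in> diag" for y
    using that
  proof (induction rule: diag_induct)
    case one
    then show ?case using F(4) K(4) by simp
  next
    case (add x y)
    then show ?case using F(3)[OF cc cc] K(3)[OF cc cc] by (simp add: l_distr diag_closed)
  next
    case (mult x y)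
    note c = diag_closed(1)[OF mult(1)] diag_closed(1)[OF mult(2)]
    have "x \<otimes> y \<otimes> ?e = x \<otimes> (?e \<otimes> (y \<otimes> ?e))"
      using c diag_commute_e[OF mult(2), of "inv\<^bsub>G\<^esub> g"] e_idem[OF gi] by (simp add: m_assoc[symmetric]) (simp add: m_assoc)
    also have "\<dots> = (x \<otimes> ?e) \<otimes> (y \<otimes> ?e)" using c by (simp add: m_assoc)
    finally show ?case using F(2)[OF cc cc] K(2)[OF cc cc] mult by simp
  next
    case (smult r x)
    then show ?case using F(5)[OF cc] K(5)[OF cc] by (simp add: smult_mult_l diag_closed)
  qed (use eq in auto)
  then show ?thesis using x carrier_corner[of "inv\<^bsub>G\<^esub> g" x] by (metis gi)
qed

end

section \<open>The universal partial representation and the action \<open>theta\<close>\<close>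

context
  fixes G :: "('g, 'm) monoid_scheme" and Rel :: "('g list \<Rightarrow>\<^sub>0 'r::comm_ring_1) set"
  assumes G: "group G" and Rel: "Rel \<subseteq> carrier (free_algebra (carrier G))"
begin

interpretation G: group G by (rule G)

lemma par_rels_closed: "par_rels G \<union> Rel \<subseteq> carrier (free_algebra (carrier G))"
  using Rel unfolding par_rels_def
  by (auto simp del: Poly_Mapping.mult_single intro!: free_algebra_closed)

lemma ralg_par_algebra: "ralg (par_algebra G Rel)"
  unfolding par_algebra_def by (rule ralg_pres_algebra[OF par_rels_closed])

lemma par_class_hom: "pres_class (carrier G) (par_rels G \<union> Rel) \<in> alg_hom (free_algebra (carrier G)) (par_algebra G Rel)"
  unfolding par_algebra_def by (rule pres_class_alg_hom[OF par_rels_closed])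

lemma par_rep_par_elt: "par_rep (par_algebra G Rel) G (par_elt G Rel)"
proof -
  interpret A: ralg "par_algebra G Rel" by (rule ralg_par_algebra)
  note h = alg_homD[OF par_class_hom, simplified]
  have rel: "pres_class (carrier G) (par_rels G \<union> Rel) f = pres_class (carrier G) (par_rels G \<union> Rel) f'"
    if "f - f' \<in> par_rels G" "f \<in> carrier (free_algebra (carrier G))" "f' \<in> carrier (free_algebra (carrier G))" for f f'
    using pres_class_rel_eq[OF par_rels_closed _ that(2,3)] that(1) by blast
  note cl = free_algebra_closed(3,7) G.inv_closed G.m_closed
  show ?thesis
  proof (intro par_rep.intro A.ralg_axioms G par_rep_axioms.intro)
    show "par_elt G Rel g \<in> carrier (par_algebra G Rel)" if "g \<in> carrier G" for g
      unfolding par_elt_def using that by (simp add: h(1))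
    show "par_elt G Rel \<one>\<^bsub>G\<^esub> = \<one>\<^bsub>par_algebra G Rel\<^esub>"
      unfolding par_elt_def h(4)[symmetric] by (rule rel) (simp_all add: par_rels_def)
    fix g k assume g: "g \<in> carrier G" "k \<in> carrier G"
    have "pres_class (carrier G) (par_rels G \<union> Rel) (gen (inv\<^bsub>G\<^esub> g) * gen g * gen k) =
      pres_class (carrier G) (par_rels G \<union> Rel) (gen (inv\<^bsub>G\<^esub> g) * gen (g \<otimes>\<^bsub>G\<^esub> k))"
      by (rule rel) (use g in \<open>(unfold par_rels_def, blast)\<close>, (intro cl g)+)
    then show "par_elt G Rel (inv\<^bsub>G\<^esub> g) \<otimes>\<^bsub>par_algebra G Rel\<^esub> par_elt G Rel g \<otimes>\<^bsub>par_algebra G Rel\<^esub> par_elt G Rel k =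
      par_elt G Rel (inv\<^bsub>G\<^esub> g) \<otimes>\<^bsub>par_algebra G Rel\<^esub> par_elt G Rel (g \<otimes>\<^bsub>G\<^esub> k)"
      using g by (simp only: par_elt_def h(2) cl)
    have "pres_class (carrier G) (par_rels G \<union> Rel) (gen g * gen k * gen (inv\<^bsub>G\<^esub> k)) =
      pres_class (carrier G) (par_rels G \<union> Rel) (gen (g \<otimes>\<^bsub>G\<^esub> k) * gen (inv\<^bsub>G\<^esub> k))"
      by (rule rel) (use g in \<open>(unfold par_rels_def, blast)\<close>, (intro cl g)+)
    then show "par_elt G Rel g \<otimes>\<^bsub>par_algebra G Rel\<^esub> par_elt G Rel k \<otimes>\<^bsub>par_algebra G Rel\<^esub> par_elt G Rel (inv\<^bsub>G\<^esub> k) =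
      par_elt G Rel (g \<otimes>\<^bsub>G\<^esub> k) \<otimes>\<^bsub>par_algebra G Rel\<^esub> par_elt G Rel (inv\<^bsub>G\<^esub> k)"
      using g by (simp only: par_elt_def h(2) cl)
  qed
qed

lemma par_eps_eq:
  "g \<in> carrier G \<Longrightarrow> par_eps G Rel g = par_rep.e (par_algebra G Rel) G (par_elt G Rel) g"
  unfolding par_rep.e_def[OF par_rep_par_elt] par_eps_def par_elt_def eps_sym_def
  by (simp only: alg_homD(2)[OF par_class_hom, simplified] free_algebra_closed(7) G.inv_closed)

lemma par_diag_eq:
  "par_diag G Rel = (par_algebra G Rel)\<lparr>carrier := par_rep.diag (par_algebra G Rel) G (par_elt G Rel)\<rparr>"
proof -
  have "par_eps G Rel ` carrier G = par_rep.e (par_algebra G Rel) G (par_elt G Rel) ` carrier G"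
    using par_eps_eq by auto
  then show ?thesis by (simp add: par_diag_def par_rep.diag_def[OF par_rep_par_elt])
qed

text \<open>Conjugation is an isomorphism of the corners with the prescribed values, and
  \<open>corner_hom_unique\<close> excludes any other. The candidate is restricted to the corner
  because the description asks for an extensional map.\<close>

lemma theta_eq:
  assumes g: "g \<in> carrier G"
    and x: "x \<in> carrier (idem_ideal (par_diag G Rel) (par_eps G Rel (inv\<^bsub>G\<^esub> g)))"
  shows "theta G Rel g x = par_elt G Rel g \<otimes>\<^bsub>par_algebra G Rel\<^esub> x \<otimes>\<^bsub>par_algebra G Rel\<^esub> par_elt G Rel (inv\<^bsub>G\<^esub> g)"
proof -
  interpret U: par_rep "par_algebra G Rel" G "par_elt G Rel" by (rule par_rep_par_elt)
  have D: "idem_ideal (par_diag G Rel) (par_eps G Rel h) = U.corner h" if "h \<in> carrier G" for h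
    using that by (simp add: U.corner_def par_diag_eq par_eps_eq)
  let ?A = "par_algebra G Rel" and ?gi = "inv\<^bsub>G\<^esub> g"
  define k where "k x = par_elt G Rel g \<otimes>\<^bsub>?A\<^esub> x \<otimes>\<^bsub>?A\<^esub> par_elt G Rel ?gi" for x
  have gi: "?gi \<in> carrier G" using g by simp
  have m: "y \<otimes>\<^bsub>par_diag G Rel\<^esub> z = y \<otimes>\<^bsub>?A\<^esub> z" for y z by (simp add: par_diag_eq)
  let ?C = "carrier (U.corner ?gi)"
  have kiso: "k \<in> alg_iso (U.corner ?gi) (U.corner g)"
    unfolding k_def by (rule U.conj_alg_iso(1)[OF g])
  have kr: "restrict k ?C \<in> alg_iso (U.corner ?gi) (U.corner g)"
  proof -
    have cl: "a \<otimes>\<^bsub>?A\<^esub> b \<in> ?C" "a \<oplus>\<^bsub>?A\<^esub> b \<in> ?C" "r \<odot>\<^bsub>?A\<^esub> a \<in> ?C" if "a \<in> ?C" "b \<in> ?C" for a b r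
      using that U.diag_closed gi by (auto simp: U.carrier_corner U.m_assoc U.l_distr U.smult_mult_l)
    have one: "U.e ?gi \<in> ?C" using gi by (simp add: U.carrier_corner U.e_idem)
    have "k \<in> alg_hom (U.corner ?gi) (U.corner g)" using kiso by (simp add: alg_iso_def')
    note kh = alg_homD[OF this, simplified]
    have "restrict k ?C \<in> alg_hom (U.corner ?gi) (U.corner g)"
      by (rule alg_homI) (simp_all add: kh cl one)
    moreover have "bij_betw (restrict k ?C) ?C (carrier (U.corner g))"
      using kiso by (simp add: alg_iso_def' bij_betw_restrict_eq)
    ultimately show ?thesis by (simp add: alg_iso_def')
  qed
  have "theta G Rel g = (THE f. f \<in> extensional ?C \<and> f \<in> alg_iso (U.corner ?gi) (U.corner g) \<and>
      (\<forall>h\<in>carrier G. f (U.e h \<otimes>\<^bsub>?A\<^esub> U.e ?gi) = U.e (g \<otimes>\<^bsub>G\<^esub> h) \<otimes>\<^bsub>?A\<^esub> U.e g))"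
    unfolding theta_def Let_def m D[OF g] D[OF gi] using g by (simp add: par_eps_eq cong: ball_cong)
  also have "\<dots> = restrict k ?C"
  proof (rule the_equality)
    have in_C: "U.e h \<otimes>\<^bsub>?A\<^esub> U.e ?gi \<in> ?C" if "h \<in> carrier G" for h
      using that gi U.diag_closed by (simp add: U.carrier_corner U.m_assoc U.e_idem)
    show *: "restrict k ?C \<in> extensional ?C \<and> restrict k ?C \<in> alg_iso (U.corner ?gi) (U.corner g) \<and>
      (\<forall>h\<in>carrier G. restrict k ?C (U.e h \<otimes>\<^bsub>?A\<^esub> U.e ?gi) = U.e (g \<otimes>\<^bsub>G\<^esub> h) \<otimes>\<^bsub>?A\<^esub> U.e g)"
      using kr in_C U.conj_alg_iso(2)[OF g] by (simp add: k_def)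
    fix f assume f: "f \<in> extensional ?C \<and> f \<in> alg_iso (U.corner ?gi) (U.corner g) \<and>
      (\<forall>h\<in>carrier G. f (U.e h \<otimes>\<^bsub>?A\<^esub> U.e ?gi) = U.e (g \<otimes>\<^bsub>G\<^esub> h) \<otimes>\<^bsub>?A\<^esub> U.e g)"
    have "f y = restrict k ?C y" if "y \<in> ?C" for y
    proof (rule U.corner_hom_unique[OF g _ _ _ that])
      show "f \<in> alg_hom (U.corner ?gi) (U.corner g)" "restrict k ?C \<in> alg_hom (U.corner ?gi) (U.corner g)"
        using f kr unfolding alg_iso_def' by blast+
    qed (use f * in metis)
    then show "f = restrict k ?C"
      using f by (intro extensionalityI[of f ?C]) auto
  qed
  finally show ?thesis using x by (simp add: D[OF gi] k_def)
qed

lemma par_algebra_universal: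
  assumes u: "par_rep B G u" and rel: "\<And>f. f \<in> Rel \<Longrightarrow> ev B u f = \<zero>\<^bsub>B\<^esub>"
  obtains h where "h \<in> alg_hom (par_algebra G Rel) B" "\<And>g. g \<in> carrier G \<Longrightarrow> h (par_elt G Rel g) = u g"
proof -
  interpret B: par_rep B G u by fact
  note E = B.ev_alg_hom[of "carrier G" u, OF B.u_closed]
  note h = alg_homD[OF E, simplified]
  note g = B.ev_gen[of "carrier G" u, OF B.u_closed]
  have hm: "ev B u (f - f') = ev B u f \<ominus>\<^bsub>B\<^esub> ev B u f'"
    if "f \<in> carrier (free_algebra (carrier G))" "f' \<in> carrier (free_algebra (carrier G))" for f f'
    using alg_hom_minus[OF ralg_free_algebra B.ralg_axioms E that] free_algebra_minus[OF that] by simp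
  have sub0: "x \<ominus>\<^bsub>B\<^esub> x = \<zero>\<^bsub>B\<^esub>" if "x \<in> carrier B" for x
    using that by (simp add: B.r_right_minus_eq)
  have "ev B u f = \<zero>\<^bsub>B\<^esub>" if "f \<in> par_rels G \<union> Rel" for f
    using that unfolding par_rels_def
    by (elim UnE insertE CollectE exE conjE emptyE)
      (simp_all add: hm h(2,3,4) g free_algebra_closed(3) B.u_one B.u_rel1 B.u_rel2 sub0 rel
        del: Poly_Mapping.mult_single)
  from pres_algebra_universal[OF par_rels_closed B.ralg_axioms B.u_closed this]
  obtain k where k: "k \<in> alg_hom (par_algebra G Rel) B"
    "\<And>f. f \<in> carrier (free_algebra (carrier G)) \<Longrightarrow> k (pres_class (carrier G) (par_rels G \<union> Rel) f) = ev B u f"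
    unfolding par_algebra_def by blast
  show thesis
    by (rule that[OF k(1)]) (simp add: k(2) g par_elt_def)
qed

lemma alg_hom_par_eqI:
  assumes "ralg B" "h \<in> alg_hom (par_algebra G Rel) B" "k \<in> alg_hom (par_algebra G Rel) B"
    and "\<And>g. g \<in> carrier G \<Longrightarrow> h (par_elt G Rel g) = k (par_elt G Rel g)" "x \<in> carrier (par_algebra G Rel)"
  shows "h x = k x"
  using alg_hom_pres_eqI[OF par_rels_closed assms(1), of h k x] assms(2-)
  unfolding par_algebra_def par_elt_def by blast

end

section \<open>The isomorphism\<close>

text \<open>Evaluates one formal expression in different algebras. This is how a relation among
  projections is compared with the same relation among the idempotents of the partial group
  algebra.\<close>

definition lincomb :: "('r, 'b) module \<Rightarrow> ('q \<Rightarrow> 'b) \<Rightarrow> ('r \<times> 'q list) list \<Rightarrow> 'b" where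
  "lincomb A \<phi> c = foldr (\<lambda>(r, qs) y. r \<odot>\<^bsub>A\<^esub> mprod A (map \<phi> qs) \<oplus>\<^bsub>A\<^esub> y) c \<zero>\<^bsub>A\<^esub>"

lemma lincomb_simps [simp]:
  "lincomb A \<phi> [] = \<zero>\<^bsub>A\<^esub>"
  "lincomb A \<phi> ((r, qs) # c) = r \<odot>\<^bsub>A\<^esub> mprod A (map \<phi> qs) \<oplus>\<^bsub>A\<^esub> lincomb A \<phi> c"
  by (simp_all add: lincomb_def)

lemma lincomb_cong:
  "(\<And>r qs q. (r, qs) \<in> set c \<Longrightarrow> q \<in> set qs \<Longrightarrow> \<phi> q = \<psi> q) \<Longrightarrow> lincomb A \<phi> c = lincomb A \<psi> c"
proof (induction c)
  case (Cons rq c)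
  obtain r qs where rq: "rq = (r, qs)" by (cases rq)
  have "map \<phi> qs = map \<psi> qs" using Cons.prems[of r qs] by (auto simp: rq)
  moreover have "lincomb A \<phi> c = lincomb A \<psi> c" using Cons.prems by (intro Cons.IH) auto
  ultimately show ?case by (simp only: rq lincomb_simps)
qed simp

lemma free_lincomb:
  fixes \<phi> :: "'q \<Rightarrow> 'x list \<Rightarrow>\<^sub>0 'r::comm_ring_1"
  assumes h: "h \<in> alg_hom (free_algebra S) B" and B: "ralg B"
    and "\<And>r qs q. (r, qs) \<in> set c \<Longrightarrow> q \<in> set qs \<Longrightarrow> \<phi> q \<in> carrier (free_algebra S)"
  shows "(\<Sum>(r, qs)\<leftarrow>c. scal r * (\<Prod>q\<leftarrow>qs. \<phi> q)) \<in> carrier (free_algebra S) \<and>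
    h (\<Sum>(r, qs)\<leftarrow>c. scal r * (\<Prod>q\<leftarrow>qs. \<phi> q)) = lincomb B (\<lambda>q. h (\<phi> q)) c"
  using assms(3)
proof (induction c)
  case Nil
  then show ?case using alg_hom_zero[OF ralg_free_algebra B h] by simp
next
  case (Cons rq c)
  obtain r qs where rq: "rq = (r, qs)" by (cases rq)
  let ?s = "\<Sum>(r, qs)\<leftarrow>c. scal r * (\<Prod>q\<leftarrow>qs. \<phi> q)"
  have IH: "?s \<in> carrier (free_algebra S)" "h ?s = lincomb B (\<lambda>q. h (\<phi> q)) c"
    using Cons.prems by (auto intro!: Cons.IH[THEN conjunct1] Cons.IH[THEN conjunct2])
  have q: "set (map \<phi> qs) \<subseteq> carrier (free_algebra S)" using Cons.prems[of r qs] by (auto simp: rq)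
  note p = alg_hom_prod_list[OF h q]
  have "h (scal r * prod_list (map \<phi> qs)) = r \<odot>\<^bsub>B\<^esub> mprod B (map (\<lambda>q. h (\<phi> q)) qs)"
    using alg_homD(5)[OF h p(1), of r] by (simp add: p(2) comp_def)
  moreover have c: "scal r * prod_list (map \<phi> qs) \<in> carrier (free_algebra S)" using p(1) by simp
  ultimately show ?case
    using IH alg_homD(3)[OF h c IH(1)] by (simp add: rq)
qed

context ralg
begin

lemma lincomb_closed:
  "(\<And>r qs q. (r, qs) \<in> set c \<Longrightarrow> q \<in> set qs \<Longrightarrow> \<phi> q \<in> carrier A) \<Longrightarrow> lincomb A \<phi> c \<in> carrier A"
proof (induction c)
  case (Cons rq c)
  obtain r qs where rq: "rq = (r, qs)" by (cases rq)
  have "set (map \<phi> qs) \<subseteq> carrier A" using Cons.prems[of r qs] by (auto simp: rq)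
  moreover have "lincomb A \<phi> c \<in> carrier A" using Cons.prems by (intro Cons.IH) auto
  ultimately show ?case unfolding rq lincomb_simps by (intro a_closed smult_closed mprod_closed)
qed simp

end

lemma alg_hom_lincomb:
  assumes h: "h \<in> alg_hom A B" and A: "ralg A" and B: "ralg B"
    and "\<And>r qs q. (r, qs) \<in> set c \<Longrightarrow> q \<in> set qs \<Longrightarrow> \<phi> q \<in> carrier A"
  shows "h (lincomb A \<phi> c) = lincomb B (\<lambda>q. h (\<phi> q)) c"
  using assms(4)
proof (induction c)
  case Nil
  then show ?case using alg_hom_zero[OF A B h] by simp
next
  case (Cons rq c)
  interpret A: ralg A by fact
  obtain r qs where rq: "rq = (r, qs)" by (cases rq)
  have IH: "lincomb A \<phi> c \<in> carrier A" "h (lincomb A \<phi> c) = lincomb B (\<lambda>q. h (\<phi> q)) c"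
    using Cons.prems by (auto intro!: Cons.IH A.lincomb_closed)
  have q: "set (map \<phi> qs) \<subseteq> carrier A" using Cons.prems[of r qs] by (auto simp: rq)
  have m: "mprod A (map \<phi> qs) \<in> carrier A" using q by (rule A.mprod_closed)
  show ?case
    using alg_homD(3)[OF h A.smult_closed[OF m] IH(1)] alg_homD(5)[OF h m] alg_hom_mprod[OF h A q] IH(2)
    by (simp add: rq comp_def)
qed

section \<open>The homomorphism \<open>Xi\<close> and its injectivity on the diagonal\<close>

context shift_space
begin

abbreviation FG :: "('a \<times> bool) list monoid" where "FG \<equiv> free_group"

abbreviation RR :: "(('a \<times> bool) list list \<Rightarrow>\<^sub>0 'r) set" where "RR \<equiv> subshift_rels X"

abbreviation PA :: "('r, (('a \<times> bool) list list \<Rightarrow>\<^sub>0 'r) set) module" where "PA \<equiv> par_algebra FG RR"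

abbreviation pe :: "('a \<times> bool) list \<Rightarrow> (('a \<times> bool) list list \<Rightarrow>\<^sub>0 'r) set" where "pe \<equiv> par_elt FG RR"

lemma eps_sym_closed: "reduced g \<Longrightarrow> (eps_sym FG g :: _ \<Rightarrow>\<^sub>0 'r) \<in> carrier (free_algebra (carrier FG))"
  unfolding eps_sym_def by (rule free_algebra_closed(3)) (simp_all add: free_algebra_closed(7))

definition admissible :: "('r \<times> ('a list \<times> 'a list) list) list \<Rightarrow> bool" where
  "admissible c \<longleftrightarrow> (\<forall>(r, ps)\<in>set c. \<forall>(\<beta>, \<gamma>)\<in>set ps.
     \<beta> \<in> language X \<and> \<gamma> \<in> language X \<and> reduced (quot_word \<beta> \<gamma>))"

lemma admissibleD:
  "admissible c \<Longrightarrow> (r, ps) \<in> set c \<Longrightarrow> q \<in> set ps \<Longrightarrow>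
    fst q \<in> language X \<and> snd q \<in> language X \<and> reduced (quot_word (fst q) (snd q))"
  by (fastforce simp: admissible_def)

definition epoly :: "('r \<times> ('a list \<times> 'a list) list) list \<Rightarrow> ('a \<times> bool) list list \<Rightarrow>\<^sub>0 'r" where
  "epoly c = (\<Sum>(r, ps)\<leftarrow>c. scal r * (\<Prod>q\<leftarrow>ps. eps_sym FG (quot_word (fst q) (snd q))))"

definition ppoly :: "('r \<times> ('a list \<times> 'a list) list) list \<Rightarrow> 'a sgen list \<Rightarrow>\<^sub>0 'r" where
  "ppoly c = (\<Sum>(r, ps)\<leftarrow>c. scal r * (\<Prod>q\<leftarrow>ps. gen (Proj (cyl X (snd q) (fst q)))))"

lemma subshift_rels_eq:
  "RR = {epoly c | c. admissible c \<and> sclass X (ppoly c) = \<zero>\<^bsub>SA\<^esub>} \<union>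
    {eps_sym FG g | g. reduced g \<and> spi X g = (\<zero>\<^bsub>SA\<^esub> :: ('a sgen list \<Rightarrow>\<^sub>0 'r) set)}"
  by (simp add: subshift_rels_def epoly_def ppoly_def admissible_def split_def)

lemma epoly_hom:
  assumes "admissible c" "h \<in> alg_hom (free_algebra (carrier FG)) B" "ralg B"
  shows "epoly c \<in> carrier (free_algebra (carrier FG))"
    and "h (epoly c) = lincomb B (\<lambda>q. h (eps_sym FG (quot_word (fst q) (snd q)))) c"
  using free_lincomb[OF assms(2,3), of c "\<lambda>q. eps_sym FG (quot_word (fst q) (snd q))"] admissibleD[OF assms(1)]
    eps_sym_closed
  unfolding epoly_def by auto

lemma sclass_ppoly:
  assumes "admissible c"
  shows "sclass X (ppoly c) = lincomb SA (\<lambda>q. pg (cyl X (snd q) (fst q))) c"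
  using free_lincomb[OF sclass_alg_hom S.ralg_axioms, of c "\<lambda>q. gen (Proj (cyl X (snd q) (fst q)))"] admissibleD[OF assms]
  unfolding ppoly_def by (auto simp: free_algebra_closed(7))

lemma RR_closed: "RR \<subseteq> carrier (free_algebra (carrier FG))"
  unfolding subshift_rels_eq
  \<comment> \<open>\<open>epoly_hom\<close> asks for some homomorphism out of the free algebra. The
    one onto the partial group algebra without extra relations is available before \<open>RR\<close>
    is known to lie in the free algebra.\<close>
  using epoly_hom(1)[OF _ par_class_hom[OF group_free_group, of "{}"] ralg_par_algebra[OF group_free_group, of "{}"]]
    eps_sym_closed by auto

lemmas FGRR = group_free_group RR_closed

sublocale U: par_rep PA FG pe
  by (rule par_rep_par_elt[OF FGRR])

lemma par_eps_e: "reduced g \<Longrightarrow> par_eps FG RR g = U.e g"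
  using par_eps_eq[OF FGRR, of g] by simp

lemma ev_eps:
  assumes "reduced g"
  shows "ev SA S.wprod (eps_sym FG g) = S.wproj g"
proof -
  note E = S.ev_alg_hom[of "carrier FG" S.wprod, OF S.wprod_closed]
  have c: "gen g \<in> carrier (free_algebra (carrier FG))" "gen (winv g) \<in> carrier (free_algebra (carrier FG))"
    using assms by (simp_all add: free_algebra_closed(7))
  have "ev SA S.wprod (gen g * gen (winv g)) = ev SA S.wprod (gen g) \<otimes>\<^bsub>SA\<^esub> ev SA S.wprod (gen (winv g))"
    using alg_homD(2)[OF E c] by simp
  then show ?thesis
    using S.ev_gen[of "carrier FG" S.wprod, OF S.wprod_closed] assms
    by (simp add: eps_sym_def S.wproj_def del: Poly_Mapping.mult_single)
qed

lemma wproj_pg: "admissible c \<Longrightarrow> (r, ps) \<in> set c \<Longrightarrow> q \<in> set ps \<Longrightarrow>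
    S.wproj (quot_word (fst q) (snd q)) = pg (cyl X (snd q) (fst q))"
  using admissibleD S.wproj_quot_word by blast

text \<open>On reduced language pairs each symbol for \<open>\<epsilon>\<close> evaluates to the
  projection paired with it, so a relation of the first family turns into its own side condition.
  The second family is immediate since \<open>spi\<close> is the product of letters.\<close>

lemma Xi_exists: "\<exists>h. h \<in> alg_hom PA SA \<and> (\<forall>g. reduced g \<longrightarrow> h (pe g) = S.wprod g)"
proof -
  note E = S.ev_alg_hom[of "carrier FG" S.wprod, OF S.wprod_closed]
  have "ev SA S.wprod f = \<zero>\<^bsub>SA\<^esub>" if "f \<in> RR" for f
    using that unfolding subshift_rels_eq
  proof (elim UnE CollectE exE conjE)
    fix c assume c: "f = epoly c" "admissible c" "sclass X (ppoly c) = \<zero>\<^bsub>SA\<^esub>"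
    have "ev SA S.wprod f = lincomb SA (\<lambda>q. ev SA S.wprod (eps_sym FG (quot_word (fst q) (snd q)))) c"
      unfolding c(1) by (rule epoly_hom(2)[OF c(2) E S.ralg_axioms])
    also have "\<dots> = lincomb SA (\<lambda>q. pg (cyl X (snd q) (fst q))) c"
      using ev_eps admissibleD[OF c(2)] wproj_pg[OF c(2)] by (intro lincomb_cong) metis
    finally show ?thesis using c(3) sclass_ppoly[OF c(2)] by simp
  next
    fix g assume "f = eps_sym FG g" "reduced g" "spi X g = (\<zero>\<^bsub>SA\<^esub> :: ('a sgen list \<Rightarrow>\<^sub>0 'r) set)"
    then show ?thesis by (simp add: ev_eps S.wproj_def spi_eq_wprod)
  qed
  from par_algebra_universal[OF FGRR S.par_rep_wprod this]
  obtain h where "h \<in> alg_hom PA SA" "\<And>g. g \<in> carrier FG \<Longrightarrow> h (pe g) = S.wprod g" by blast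
  then show ?thesis by auto
qed

definition Xi :: "(('a \<times> bool) list list \<Rightarrow>\<^sub>0 'r) set \<Rightarrow> ('a sgen list \<Rightarrow>\<^sub>0 'r) set" where
  "Xi = (SOME h. h \<in> alg_hom PA SA \<and> (\<forall>g. reduced g \<longrightarrow> h (pe g) = S.wprod g))"

lemma Xi_hom: "Xi \<in> alg_hom PA SA" and Xi_pe: "reduced g \<Longrightarrow> Xi (pe g) = S.wprod g"
  using someI_ex[OF Xi_exists] unfolding Xi_def by auto

lemma Xi_e: "reduced g \<Longrightarrow> Xi (U.e g) = S.wproj g"
  by (simp add: U.e_def alg_homD(2)[OF Xi_hom] Xi_pe S.wproj_def)

lemma e_class: "reduced g \<Longrightarrow> pres_class (carrier FG) (par_rels FG \<union> RR) (eps_sym FG g) = U.e g"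
  using par_eps_e by (simp add: par_eps_def)

text \<open>Comes from the second family of relations; the first family speaks about simple words
  only.\<close>

lemma e_not_simple:
  assumes "reduced g" "\<not> simple_elt X g"
  shows "U.e g = \<zero>\<^bsub>PA\<^esub>"
proof -
  have "spi X g = (\<zero>\<^bsub>SA\<^esub> :: ('a sgen list \<Rightarrow>\<^sub>0 'r) set)" using assms by (simp add: spi_def)
  then have "eps_sym FG g \<in> par_rels FG \<union> RR" using assms(1) unfolding subshift_rels_eq by blast
  then show ?thesis
    using pres_class_rel[OF par_rels_closed[OF FGRR]] e_class[OF assms(1)] by (simp add: par_algebra_def)
qed

text \<open>One factor at a word that is not simple kills the product. Otherwise all factors are
  named by reduced pairs of language words, as the first family of relations demands.\<close>

lemma mprod_e:
  assumes "xs \<in> lists (U.e ` carrier FG)"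
  shows "mprod PA xs = \<zero>\<^bsub>PA\<^esub> \<or> (\<exists>ps. (\<forall>q\<in>set ps. fst q \<in> language X \<and> snd q \<in> language X \<and>
      reduced (quot_word (fst q) (snd q))) \<and> mprod PA xs = mprod PA (map (\<lambda>q. U.e (quot_word (fst q) (snd q))) ps))"
  using assms
proof (induction xs)
  case Nil
  show ?case by (rule disjI2, rule exI[of _ "[]"]) simp
next
  case (Cons x xs)
  then obtain g where g: "reduced g" "x = U.e g" by auto
  have m: "mprod PA xs \<in> carrier PA" using Cons(2) by (intro U.mprod_closed) auto
  show ?case
  proof (cases "simple_elt X g \<and> mprod PA xs \<noteq> \<zero>\<^bsub>PA\<^esub>")
    case False
    then show ?thesis using e_not_simple[OF g(1)] m g by auto
  next
    case True
    then obtain \<alpha> \<beta> where ab: "\<alpha> \<in> language X" "\<beta> \<in> language X" "g = quot_word \<alpha> \<beta>" by (auto simp: simple_elt_def)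
    from True Cons obtain ps where "\<forall>q\<in>set ps. fst q \<in> language X \<and> snd q \<in> language X \<and>
      reduced (quot_word (fst q) (snd q))" "mprod PA xs = mprod PA (map (\<lambda>q. U.e (quot_word (fst q) (snd q))) ps)"
      by auto
    then show ?thesis using ab g by (intro disjI2 exI[of _ "(\<alpha>, \<beta>) # ps"]) simp
  qed
qed

text \<open>Brings a diagonal element into the shape over which \<open>subshift_rels\<close>
  quantifies, so that the vanishing of its image becomes a relation.\<close>

lemma diag_lincomb:
  assumes "x \<in> U.diag"
  shows "\<exists>c. admissible c \<and> x = lincomb PA (\<lambda>q. U.e (quot_word (fst q) (snd q))) c"
  using assms unfolding U.diag_def U.gen_subalgebra_eq_mspan[OF U.e_image_closed]
proof induction
  case zero
  show ?case by (rule exI[of _ "[]"]) (simp add: admissible_def)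
next
  case (step xs y r)
  then obtain c where c: "admissible c" "y = lincomb PA (\<lambda>q. U.e (quot_word (fst q) (snd q))) c" by auto
  have y: "y \<in> carrier PA"
    using step(2) U.diag_closed(1)[unfolded U.diag_def U.gen_subalgebra_eq_mspan[OF U.e_image_closed]] by auto
  from mprod_e[OF step(1)] show ?case
  proof (elim disjE exE conjE)
    assume "mprod PA xs = \<zero>\<^bsub>PA\<^esub>"
    then show ?thesis using c y by auto
  next
    fix ps assume ps: "\<forall>q\<in>set ps. fst q \<in> language X \<and> snd q \<in> language X \<and> reduced (quot_word (fst q) (snd q))"
      "mprod PA xs = mprod PA (map (\<lambda>q. U.e (quot_word (fst q) (snd q))) ps)"
    then show ?thesis using c by (intro exI[of _ "(r, ps) # c"]) (auto simp: admissible_def)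
  qed
qed

lemma Xi_diag_kernel:
  assumes "x \<in> U.diag" "Xi x = \<zero>\<^bsub>SA\<^esub>"
  shows "x = \<zero>\<^bsub>PA\<^esub>"
proof -
  obtain c where c: "admissible c" "x = lincomb PA (\<lambda>q. U.e (quot_word (fst q) (snd q))) c"
    using diag_lincomb[OF assms(1)] by auto
  let ?cl = "pres_class (carrier FG) (par_rels FG \<union> RR)"
  have "Xi x = lincomb SA (\<lambda>q. Xi (U.e (quot_word (fst q) (snd q)))) c"
    unfolding c(2) using admissibleD[OF c(1)] by (intro alg_hom_lincomb[OF Xi_hom U.ralg_axioms S.ralg_axioms]) simp
  also have "\<dots> = lincomb SA (\<lambda>q. pg (cyl X (snd q) (fst q))) c"
    using Xi_e admissibleD[OF c(1)] wproj_pg[OF c(1)] by (intro lincomb_cong) metis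
  finally have "sclass X (ppoly c) = \<zero>\<^bsub>SA\<^esub>" using assms(2) sclass_ppoly[OF c(1)] by simp
  then have "epoly c \<in> par_rels FG \<union> RR" unfolding subshift_rels_eq using c(1) by blast
  then have 0: "?cl (epoly c) = \<zero>\<^bsub>PA\<^esub>"
    using pres_class_rel[OF par_rels_closed[OF FGRR]] by (simp add: par_algebra_def)
  have "?cl (epoly c) = lincomb PA (\<lambda>q. ?cl (eps_sym FG (quot_word (fst q) (snd q)))) c"
    by (rule epoly_hom(2)[OF c(1) par_class_hom[OF FGRR] U.ralg_axioms])
  also have "\<dots> = x"
    unfolding c(2) using e_class admissibleD[OF c(1)] by (intro lincomb_cong) metis
  finally show ?thesis using 0 by simp
qed

lemma Xi_diag_inj:
  assumes "x \<in> U.diag" "y \<in> U.diag" "Xi x = Xi y"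
  shows "x = y"
proof -
  note c = U.diag_closed(1)[OF assms(1)] U.diag_closed(1)[OF assms(2)]
  have "(-1) \<odot>\<^bsub>PA\<^esub> y = \<ominus>\<^bsub>PA\<^esub> y" by (rule U.smult_minus_one[OF c(2)])
  then have d: "x \<ominus>\<^bsub>PA\<^esub> y \<in> U.diag" using U.diag_closed(4)[OF assms(1) U.diag_closed(6)[OF assms(2), of "-1"]]
    by (simp add: a_minus_def)
  have "Xi (x \<ominus>\<^bsub>PA\<^esub> y) = \<zero>\<^bsub>SA\<^esub>"
    using alg_hom_minus[OF U.ralg_axioms S.ralg_axioms Xi_hom c] assms(3) alg_homD(1)[OF Xi_hom c(2)]
    by (simp add: S.r_right_minus_eq)
  from Xi_diag_kernel[OF d this] show ?thesis using c by (simp add: U.r_right_minus_eq)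
qed

section \<open>The image of the diagonal\<close>

lemma cyl_proj_conj:
  assumes "\<alpha> \<in> language X" "\<beta> \<in> language X"
  shows "pg (cyl X \<alpha> \<beta>) = S.wprod (quot_word \<beta> []) \<otimes>\<^bsub>SA\<^esub> S.wprod (quot_word [] \<alpha>) \<otimes>\<^bsub>SA\<^esub>
      S.wprod (quot_word \<alpha> []) \<otimes>\<^bsub>SA\<^esub> S.wprod (quot_word [] \<beta>)"
  using S.s_cyl[OF assms] by (simp add: S.wprod_quot_word)

text \<open>By \<open>conj_e\<close> the element is the idempotent at the group product of
  \<open>\<beta>\<close> and the inverse of \<open>\<alpha>\<close>, times the idempotent at
  \<open>\<beta>\<close>. This reaches cylinders whose word \<open>\<beta> \<alpha>^-1\<close> is
  not reduced.\<close>

lemma cyl_word_diag: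
  assumes "\<alpha> \<in> language X" "\<beta> \<in> language X"
  shows "pe (quot_word \<beta> []) \<otimes>\<^bsub>PA\<^esub> pe (quot_word [] \<alpha>) \<otimes>\<^bsub>PA\<^esub> pe (quot_word \<alpha> []) \<otimes>\<^bsub>PA\<^esub> pe (quot_word [] \<beta>) \<in> U.diag"
  using U.conj_e[of "quot_word \<beta> []" "quot_word \<alpha> []"]
    U.diag_closed(5)[OF U.e_diag[of "quot_word \<beta> [] \<otimes>\<^bsub>FG\<^esub> quot_word [] \<alpha>"] U.e_diag[of "quot_word \<beta> []"]]
  by (simp add: reduced_pos reduced_neg mult_free_group reduced_foldr_red_cons)

lemma Xi_cyl_word:
  assumes "\<alpha> \<in> language X" "\<beta> \<in> language X"
  shows "Xi (pe (quot_word \<beta> []) \<otimes>\<^bsub>PA\<^esub> pe (quot_word [] \<alpha>) \<otimes>\<^bsub>PA\<^esub> pe (quot_word \<alpha> []) \<otimes>\<^bsub>PA\<^esub> pe (quot_word [] \<beta>)) =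
    pg (cyl X \<alpha> \<beta>)"
  by (simp add: alg_homD(2)[OF Xi_hom] Xi_pe reduced_pos reduced_neg cyl_proj_conj[OF assms])

lemma Xi_diag_image: "Xi ` U.diag = carrier DA"
proof -
  have "Xi ` U.diag = gen_subalgebra SA (Xi ` U.e ` carrier FG)"
    unfolding U.diag_def
    by (rule alg_hom_image_gen_subalgebra[OF U.ralg_axioms S.ralg_axioms U.e_image_closed
          alg_hom_subalgebra[OF Xi_hom]])
      (use U.diag_closed(1) U.diag_def in auto)
  also have "\<dots> = gen_subalgebra SA S.cyl_projs"
  proof
    have im: "Xi ` U.e ` carrier FG = S.wproj ` {g. reduced g}" by (force simp: Xi_e image_iff)
    have w: "Xi ` U.e ` carrier FG \<subseteq> carrier SA" unfolding im by auto
    show "gen_subalgebra SA (Xi ` U.e ` carrier FG) \<subseteq> gen_subalgebra SA S.cyl_projs"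
    proof (rule S.gen_subalgebra_mono_gen[OF S.cyl_projs_closed], unfold im, rule image_subsetI)
      fix g :: "('a \<times> bool) list" assume "g \<in> {g. reduced g}"
      then obtain C where "C \<in> bool_alg X" "S.wproj g = pg C"
        using S.wproj_proj_set[of g] unfolding S.proj_set_def by blast
      then show "S.wproj g \<in> gen_subalgebra SA S.cyl_projs" using S.p_diag by simp
    qed
    have "S.cyl_projs \<subseteq> Xi ` U.diag"
    proof
      fix x assume "x \<in> S.cyl_projs"
      then obtain \<alpha> \<beta> where ab: "\<alpha> \<in> language X" "\<beta> \<in> language X" "x = pg (cyl X \<alpha> \<beta>)"
        unfolding S.cyl_projs_def by blast
      show "x \<in> Xi ` U.diag"
        unfolding ab(3) Xi_cyl_word[OF ab(1,2), symmetric] by (rule imageI[OF cyl_word_diag[OF ab(1,2)]])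
    qed
    then show "gen_subalgebra SA S.cyl_projs \<subseteq> gen_subalgebra SA (Xi ` U.e ` carrier FG)"
      unfolding \<open>Xi ` U.diag = _\<close> by (rule S.gen_subalgebra_mono_gen[OF w])
  qed
  finally show ?thesis by (simp add: carrier_DA)
qed

lemma PD_eq: "par_diag FG RR = PA\<lparr>carrier := U.diag\<rparr>"
  by (rule par_diag_eq[OF FGRR])

lemma ralg_PD: "ralg (par_diag FG RR)"
  unfolding PD_eq U.diag_def by (rule U.ralg_gen_subalgebra[OF U.e_image_closed])

lemma Xi_diag_iso: "Xi \<in> alg_iso (par_diag FG RR) DA"
proof -
  have sub: "U.diag \<subseteq> carrier PA" using U.diag_closed(1) by auto
  have "Xi \<in> alg_hom (PA\<lparr>carrier := U.diag\<rparr>) SA" by (rule alg_hom_subalgebra[OF Xi_hom sub])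
  then have "Xi \<in> alg_hom (PA\<lparr>carrier := U.diag\<rparr>) DA"
    unfolding DA_eq by (rule alg_hom_corestrict) (simp add: Xi_diag_image carrier_DA)
  moreover have "bij_betw Xi U.diag (carrier DA)"
    using Xi_diag_inj Xi_diag_image by (auto simp: bij_betw_def inj_on_def)
  ultimately show ?thesis by (simp add: alg_iso_def' PD_eq)
qed

text \<open>By injectivity on the diagonal, multiplicativity of \<open>\<pi>\<close> on reduced concatenations lifts to the partial
  group algebra.\<close>

lemma pe_append:
  assumes "reduced (v @ w)"
  shows "pe v \<otimes>\<^bsub>PA\<^esub> pe w = pe (v @ w)"
proof -
  have r: "reduced v" "reduced w" using assms by (auto simp: reduced_append)
  \<comment> \<open>The range projection of \<open>v @ w\<close> lies below that of
    \<open>v\<close>. This is an identity between diagonal elements and can be pulled back along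
    \<open>Xi\<close>.\<close>
  have "S.wproj v \<otimes>\<^bsub>SA\<^esub> S.wproj (v @ w) = S.wproj v \<otimes>\<^bsub>SA\<^esub> S.wprod v \<otimes>\<^bsub>SA\<^esub> S.wprod w \<otimes>\<^bsub>SA\<^esub> S.wprod (winv (v @ w))"
    by (simp add: S.wproj_def[of "v @ w"] S.wprod_append S.m_assoc)
  also have "\<dots> = S.wproj (v @ w)"
    unfolding S.wproj_wprod[OF r(1)] by (simp add: S.wproj_def[of "v @ w"] S.wprod_append S.m_assoc)
  finally have "Xi (U.e v \<otimes>\<^bsub>PA\<^esub> U.e (v @ w)) = Xi (U.e (v @ w))"
    using r assms by (simp add: alg_homD(2)[OF Xi_hom] Xi_e)
  then have e: "U.e v \<otimes>\<^bsub>PA\<^esub> U.e (v @ w) = U.e (v @ w)"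
    using r assms by (intro Xi_diag_inj U.diag_closed(5)) auto
  have "pe v \<otimes>\<^bsub>PA\<^esub> pe w = U.e v \<otimes>\<^bsub>PA\<^esub> pe (v @ w)"
    using U.u_mult[of v w] r assms by (simp add: mult_free_group foldr_red_cons_append)
  also have "\<dots> = U.e v \<otimes>\<^bsub>PA\<^esub> (U.e (v @ w) \<otimes>\<^bsub>PA\<^esub> pe (v @ w))" using U.u_inv_u assms by simp
  also have "\<dots> = (U.e v \<otimes>\<^bsub>PA\<^esub> U.e (v @ w)) \<otimes>\<^bsub>PA\<^esub> pe (v @ w)"
    using r assms by (simp add: U.m_assoc)
  also have "\<dots> = pe (v @ w)" unfolding e using assms by (simp add: U.u_inv_u)
  finally show ?thesis .
qed

lemma pe_letters: "reduced w \<Longrightarrow> mprod PA (map (\<lambda>l. pe [l]) w) = pe w"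
proof (induction w)
  case Nil
  show ?case using U.u_one by simp
next
  case (Cons l w)
  then show ?case using pe_append[of "[l]" w] reduced_Cons_tl[of l w] by simp
qed

section \<open>The inverse of \<open>Xi\<close>\<close>

definition proj_lift :: "'a word set \<Rightarrow> (('a \<times> bool) list list \<Rightarrow>\<^sub>0 'r) set" where
  "proj_lift C = inv_into U.diag Xi (pg C)"

lemma proj_lift:
  assumes "C \<in> bool_alg X"
  shows "proj_lift C \<in> U.diag" "Xi (proj_lift C) = pg C"
proof -
  have "pg C \<in> Xi ` U.diag" using S.p_diag[OF assms] Xi_diag_image carrier_DA by simp
  then show "proj_lift C \<in> U.diag" "Xi (proj_lift C) = pg C"
    unfolding proj_lift_def by (simp_all add: inv_into_into f_inv_into_f)
qed

lemma proj_lift_eqI: "C \<in> bool_alg X \<Longrightarrow> x \<in> U.diag \<Longrightarrow> Xi x = pg C \<Longrightarrow> x = proj_lift C"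
  using Xi_diag_inj proj_lift by auto

lemma subshift_family_PA: "subshift_family PA X proj_lift (\<lambda>a. pe [(a, True)]) (\<lambda>a. pe [(a, False)])"
proof -
  note h = alg_homD[OF Xi_hom]
  have c: "proj_lift C \<in> carrier PA" if "C \<in> bool_alg X" for C
    using U.diag_closed(1)[OF proj_lift(1)[OF that]] .
  show ?thesis
  proof (intro subshift_family.intro subshift_family_axioms.intro U.ralg_axioms subshift letters c)
    show "proj_lift X = \<one>\<^bsub>PA\<^esub>"
      by (rule proj_lift_eqI[symmetric]) (use U.diag_closed(2) h(4) S.p_space in auto)
    show "proj_lift {} = \<zero>\<^bsub>PA\<^esub>"
      by (rule proj_lift_eqI[symmetric])
        (use U.diag_closed(3) alg_hom_zero[OF U.ralg_axioms S.ralg_axioms Xi_hom] S.p_empty in auto)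
    fix B C assume B: "B \<in> bool_alg X" "C \<in> bool_alg X"
    have BC: "B \<inter> C \<in> bool_alg X" "B \<union> C \<in> bool_alg X" using B by auto
    show "proj_lift (B \<inter> C) = proj_lift B \<otimes>\<^bsub>PA\<^esub> proj_lift C"
      by (rule proj_lift_eqI[symmetric, OF BC(1)])
        (use B in \<open>simp_all add: U.diag_closed(5) proj_lift h(2) c S.p_inter\<close>)
    have m: "x \<ominus>\<^bsub>PA\<^esub> y \<in> U.diag" if "x \<in> U.diag" "y \<in> U.diag" for x y
      using U.diag_closed(4)[OF that(1) U.diag_closed(6)[OF that(2), of "-1"]]
        U.smult_minus_one[OF U.diag_closed(1)[OF that(2)]] by (simp add: a_minus_def)
    have "proj_lift B \<oplus>\<^bsub>PA\<^esub> proj_lift C \<ominus>\<^bsub>PA\<^esub> proj_lift (B \<inter> C) \<in> U.diag"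
      using B BC by (intro m U.diag_closed(4) proj_lift)
    moreover have "Xi (proj_lift B \<oplus>\<^bsub>PA\<^esub> proj_lift C \<ominus>\<^bsub>PA\<^esub> proj_lift (B \<inter> C)) = pg (B \<union> C)"
      using B BC by (simp add: alg_hom_minus[OF U.ralg_axioms S.ralg_axioms Xi_hom] c h(3) proj_lift S.p_union)
    ultimately show "proj_lift (B \<union> C) = proj_lift B \<oplus>\<^bsub>PA\<^esub> proj_lift C \<ominus>\<^bsub>PA\<^esub> proj_lift (B \<inter> C)"
      by (rule proj_lift_eqI[symmetric, OF BC(2)])
  next
    fix a
    show "pe [(a, True)] \<in> carrier PA" "pe [(a, False)] \<in> carrier PA" by simp_all
    show "pe [(a, True)] \<otimes>\<^bsub>PA\<^esub> pe [(a, False)] \<otimes>\<^bsub>PA\<^esub> pe [(a, True)] = pe [(a, True)]"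
      using U.u_inv_u[of "[(a, True)]"] by (simp add: U.e_def)
    show "pe [(a, False)] \<otimes>\<^bsub>PA\<^esub> pe [(a, True)] \<otimes>\<^bsub>PA\<^esub> pe [(a, False)] = pe [(a, False)]"
      using U.u_inv_u[of "[(a, False)]"] by (simp add: U.e_def)
  next
    fix \<alpha> \<beta> assume L: "\<alpha> \<in> language X" "\<beta> \<in> language X"
    have w: "mprod PA (map (\<lambda>a. pe [(a, True)]) \<gamma>) = pe (quot_word \<gamma> [])"
      "mprod PA (map (\<lambda>a. pe [(a, False)]) (rev \<gamma>)) = pe (quot_word [] \<gamma>)" for \<gamma>
      using pe_letters[OF reduced_pos[of \<gamma>]] pe_letters[OF reduced_neg[of \<gamma>]]
      by (simp_all add: quot_word_def comp_def)
    show "mprod PA (map (\<lambda>a. pe [(a, True)]) \<beta>) \<otimes>\<^bsub>PA\<^esub> mprod PA (map (\<lambda>a. pe [(a, False)]) (rev \<alpha>)) \<otimes>\<^bsub>PA\<^esub>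
        mprod PA (map (\<lambda>a. pe [(a, True)]) \<alpha>) \<otimes>\<^bsub>PA\<^esub> mprod PA (map (\<lambda>a. pe [(a, False)]) (rev \<beta>)) =
        proj_lift (cyl X \<alpha> \<beta>)"
      \<comment> \<open>After the letters are gathered into two positive and two negative words,
        both sides are diagonal and have the same image under \<open>Xi\<close>.\<close>
      unfolding w by (rule proj_lift_eqI[OF _ cyl_word_diag[OF L] Xi_cyl_word[OF L]]) (use L in simp)
  qed
qed

lemma sgens_Proj: "Proj C \<in> sgens X \<longleftrightarrow> C \<in> bool_alg X"
  by (auto simp: sgens_def)

lemma Xi_iso: "Xi \<in> alg_iso PA SA"
proof -
  obtain \<Psi> where \<Psi>: "\<Psi> \<in> alg_hom SA PA"
    and \<Psi>p: "\<And>C. C \<in> bool_alg X \<Longrightarrow> \<Psi> (pg C) = proj_lift C"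
    and \<Psi>s: "\<And>a. \<Psi> (sclass X (gen (Gen a))) = pe [(a, True)]"
    "\<And>a. \<Psi> (sclass X (gen (Gen_star a))) = pe [(a, False)]"
    by (rule subshift_algebra_universal[OF subshift_family_PA]) blast
  have id_hom: "id \<in> alg_hom B B" for B :: "('r, 'z) module" by (rule alg_homI) auto
  have 1: "\<Psi> (Xi x) = x" if x: "x \<in> carrier PA" for x
  proof -
    have "(\<Psi> \<circ> Xi) x = id x"
    proof (rule alg_hom_par_eqI[OF FGRR U.ralg_axioms alg_hom_comp[OF Xi_hom \<Psi>] id_hom _ x])
      fix g :: "('a \<times> bool) list" assume "g \<in> carrier FG"
      then have g: "reduced g" by simp
      have "\<Psi> (mprod SA (map S.letter g)) = mprod PA (map \<Psi> (map S.letter g))"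
        by (rule alg_hom_mprod[OF \<Psi> S.ralg_axioms]) auto
      also have "map \<Psi> (map S.letter g) = map (\<lambda>l. pe [l]) g"
        by (auto simp: S.letter_def \<Psi>s)
      finally show "(\<Psi> \<circ> Xi) (pe g) = id (pe g)"
        by (simp add: Xi_pe[OF g] S.wprod_def pe_letters[OF g] del: map_map)
    qed
    then show ?thesis by simp
  qed
  have 2: "Xi (\<Psi> x) = x" if x: "x \<in> carrier SA" for x
  proof -
    have x': "x \<in> carrier (pres_algebra (sgens X) (srels X))" using x by (simp add: subshift_algebra_def)
    have "(Xi \<circ> \<Psi>) x = id x"
    proof (rule alg_hom_pres_eqI[OF srels_closed S.ralg_axioms _ _ _ x'])
      show "Xi \<circ> \<Psi> \<in> alg_hom (pres_algebra (sgens X) (srels X)) SA" "id \<in> alg_hom (pres_algebra (sgens X) (srels X)) SA"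
        using alg_hom_comp[OF \<Psi> Xi_hom] id_hom by (simp_all add: subshift_algebra_def)
      fix y assume "y \<in> sgens X"
      then show "(Xi \<circ> \<Psi>) (sclass X (gen y)) = id (sclass X (gen y))"
        by (cases y) (auto simp: \<Psi>p \<Psi>s proj_lift Xi_pe S.wprod_Cons S.letter_def sgens_Proj)
    qed
    then show ?thesis by simp
  qed
  have "bij_betw Xi (carrier PA) (carrier SA)"
    by (rule bij_betwI[of _ _ _ \<Psi>]) (use 1 2 alg_homD(1)[OF Xi_hom] alg_homD(1)[OF \<Psi>] in auto)
  then show ?thesis using Xi_hom by (simp add: alg_iso_def')
qed

section \<open>Equivariance\<close>

lemma wproj_DA: "reduced g \<Longrightarrow> S.wproj g \<in> carrier DA"
  using Xi_diag_image U.e_diag[of g] Xi_e[of g] by force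

lemma delta_wproj:
  assumes "reduced g"
  shows "delta (S.wproj g) = (if simple_elt X g then indicator (cyl X (denom g) (numer g)) else (\<lambda>y. 0))"
proof (cases "simple_elt X g")
  case True
  then obtain \<alpha> \<beta> where "\<alpha> \<in> language X" "\<beta> \<in> language X" "g = quot_word \<alpha> \<beta>" by (auto simp: simple_elt_def)
  then show ?thesis using True by (simp add: S.wproj_quot_word delta_proj)
next
  case False
  then have "S.wproj g = \<zero>\<^bsub>SA\<^esub>" using S.wprod_not_simple[OF assms] by (simp add: S.wproj_def)
  then show ?thesis using False alg_hom_zero[OF D.ralg_axioms ralg_fun_algebra delta_hom]
    by (simp add: fun_algebra_simps)
qed

text \<open>Under \<open>tau\<close> the unit function becomes the indicator of the range cylinder
  of \<open>g\<close>. In the equivariance computation this turns the value of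
  \<open>rho (S.wprod g)\<close> at the unit function into a diagonal function.\<close>

lemma tau_indicator:
  assumes "reduced g"
  shows "tau X g (indicator X) = delta (S.wproj g)"
proof (cases "simple_elt X g")
  case True
  then obtain \<alpha> \<beta> where g: "g = quot_word \<alpha> \<beta>" by (auto simp: simple_elt_def)
  show ?thesis unfolding delta_wproj[OF assms] using True
    by (auto simp: tau_def g mem_cyl_iff tau_hat_def fun_eq_iff)
next
  case False
  then show ?thesis by (simp add: delta_wproj[OF assms] tau_def)
qed

text \<open>The conjugate \<open>z\<close> of \<open>x\<close> satisfies
  \<open>Xi z \<pi>(g) = \<pi>(g) Xi x\<close>. Applied to the unit function, the right side gives
  \<open>tau\<close> of the function of \<open>x\<close>, and the left side gives the function of
  \<open>z\<close>, since \<open>z\<close> is supported on the range of \<open>g\<close>.\<close>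

lemma equivariance:
  assumes g: "reduced g" and x: "x \<in> carrier (U.corner (winv g))"
  shows "delta (Xi x) \<in> tau_dom X (winv g)"
    and "delta (Xi (pe g \<otimes>\<^bsub>PA\<^esub> x \<otimes>\<^bsub>PA\<^esub> pe (winv g))) = tau X g (delta (Xi x))"
proof -
  note h = alg_homD[OF Xi_hom] and r = alg_homD[OF rho_hom] and d = alg_homD[OF delta_hom]
  have gi: "reduced (winv g)" using g by simp
  have xd: "x \<in> U.diag" and xe: "x \<otimes>\<^bsub>PA\<^esub> U.e (winv g) = x" using x U.carrier_corner[of "winv g" x] gi by auto
  have xc: "x \<in> carrier PA" using U.diag_closed(1)[OF xd] .
  have Xx: "Xi x \<in> carrier DA" using Xi_diag_image xd by auto
  then have Xs: "Xi x \<in> carrier SA" by (rule DA_carrier_SA)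
  have XeX: "Xi x \<otimes>\<^bsub>SA\<^esub> S.wproj (winv g) = Xi x"
    using h(2)[OF xc U.e_closed[of "winv g"]] gi by (simp add: xe Xi_e)
  then have dx: "delta (Xi x) = (\<lambda>y. delta (Xi x) y * delta (S.wproj (winv g)) y)"
    using d(2)[OF Xx wproj_DA[OF gi]] by (simp add: fun_algebra_simps)
  \<comment> \<open>By \<open>dx\<close> the function equals its product with the generator of the
    ideal, or is zero when \<open>winv g\<close> is not simple.\<close>
  show "delta (Xi x) \<in> tau_dom X (winv g)"
  proof (cases "simple_elt X (winv g)")
    case True
    let ?i = "indicator (cyl X (denom (winv g)) (numer (winv g))) :: 'a word \<Rightarrow> 'r"
    interpret F: ralg FA by (rule ralg_FA)
    have i: "?i \<in> carrier FA" using delta_image wproj_DA[OF gi] delta_wproj[OF gi] True by (metis imageI)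
    interpret I: ideal "Idl\<^bsub>FA\<^esub> {?i}" FA by (rule F.genideal_ideal) (use i in simp)
    have "delta (Xi x) \<otimes>\<^bsub>FA\<^esub> ?i \<in> Idl\<^bsub>FA\<^esub> {?i}"
      by (rule I.I_l_closed) (use F.genideal_self'[OF i] delta_image Xx in auto)
    moreover have "delta (Xi x) \<otimes>\<^bsub>FA\<^esub> ?i = delta (Xi x)"
      using dx True by (simp add: diag_algebra_def fun_algebra_simps delta_wproj[OF gi])
    ultimately show ?thesis using True by (simp add: tau_dom_def)
  next
    case False
    then show ?thesis using dx by (simp add: tau_dom_def delta_wproj[OF gi])
  qed
  let ?z = "pe g \<otimes>\<^bsub>PA\<^esub> x \<otimes>\<^bsub>PA\<^esub> pe (winv g)"
  have z: "?z \<in> carrier (U.corner g)" using U.corner_conj(1)[of g x] x g by simp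
  then have zd: "?z \<in> U.diag" and ze: "?z \<otimes>\<^bsub>PA\<^esub> U.e g = ?z" using U.carrier_corner[of g] g by auto
  have zc: "?z \<in> carrier PA" using U.diag_closed(1)[OF zd] .
  have Zd: "Xi ?z \<in> carrier DA" using Xi_diag_image zd by auto
  then have Zs: "Xi ?z \<in> carrier SA" by (rule DA_carrier_SA)
  have Xz: "Xi ?z = S.wprod g \<otimes>\<^bsub>SA\<^esub> Xi x \<otimes>\<^bsub>SA\<^esub> S.wprod (winv g)"
    using xc g by (simp add: h(2) Xi_pe)
  have ZeZ: "Xi ?z \<otimes>\<^bsub>SA\<^esub> S.wproj g = Xi ?z"
    using h(2)[OF zc U.e_closed[of g]] g by (simp only: ze Xi_e carrier_free_group)
  have sg: "rho (S.wprod g) f = tau X g f" for f using rho_spi[OF g] by (simp add: spi_eq_wprod[OF g])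
  \<comment> \<open>The last factor of the conjugate and the new \<open>S.wprod g\<close> combine to
    the projection of \<open>winv g\<close>, which \<open>Xi x\<close> absorbs.\<close>
  have "Xi ?z \<otimes>\<^bsub>SA\<^esub> S.wprod g = S.wprod g \<otimes>\<^bsub>SA\<^esub> (Xi x \<otimes>\<^bsub>SA\<^esub> S.wproj (winv g))"
    unfolding Xz using Xs by (simp add: S.wproj_def S.m_assoc)
  then have eq: "Xi ?z \<otimes>\<^bsub>SA\<^esub> S.wprod g = S.wprod g \<otimes>\<^bsub>SA\<^esub> Xi x" by (simp add: XeX)
  have "tau X g (delta (Xi x)) = rho (S.wprod g \<otimes>\<^bsub>SA\<^esub> Xi x) (indicator X)"
    using r(2)[OF S.wprod_closed Xs] by (simp add: end_algebra_simps sg delta_def)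
  also have "\<dots> = rho (Xi ?z) (delta (S.wproj g))"
    unfolding eq[symmetric] using r(2)[OF Zs S.wprod_closed] by (simp add: end_algebra_simps sg tau_indicator[OF g])
  also have "\<dots> = delta (Xi ?z \<otimes>\<^bsub>SA\<^esub> S.wproj g)"
    using r(2)[OF Zs S.wproj_closed] by (simp add: end_algebra_simps delta_def)
  also have "\<dots> = delta (Xi ?z)" by (simp only: ZeZ)
  finally show "delta (Xi ?z) = tau X g (delta (Xi x))" by simp
qed

end

theorem theorem5p11:
  fixes X :: "'a word set"
  assumes "subshift X"
    and "\<And>a. X \<noteq> {} \<Longrightarrow> [a] \<in> language X"
  defines "F \<equiv> free_group :: ('a \<times> bool) list monoid"
    and "\<R> \<equiv> subshift_rels X :: (('a \<times> bool) list list \<Rightarrow>\<^sub>0 'r::comm_ring_1) set"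
  shows "\<exists>\<Xi> \<in> alg_iso (par_algebra F \<R>) (subshift_algebra X).
    (\<forall>g \<in> carrier F. \<Xi> (par_elt F \<R> g) = spi X g) \<and>
    \<Xi> \<in> alg_iso (par_diag F \<R>) (diag_subalgebra X) \<and>
    (let \<Xi>D = inv_into (carrier (diag_algebra X)) (diag_ident X) \<circ> \<Xi> in
      \<Xi>D \<in> alg_iso (par_diag F \<R>) (diag_algebra X) \<and>
      (\<forall>g \<in> carrier F. \<forall>x \<in> carrier (idem_ideal (par_diag F \<R>) (par_eps F \<R> (inv\<^bsub>F\<^esub> g))).
         \<Xi>D x \<in> tau_dom X (inv\<^bsub>F\<^esub> g) \<and> \<Xi>D (theta F \<R> g x) = tau X g (\<Xi>D x)))"
proof -
  interpret shift_space X "TYPE('r)" by (rule shift_space.intro) (use assms(1,2) in auto)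
  define \<Xi>D where "\<Xi>D = inv_into (carrier FA) (diag_ident X) \<circ> Xi"
  \<comment> \<open>On the diagonal the inverse identification is \<open>delta\<close>, so each
    claim about \<open>\<Xi>D\<close> becomes one about \<open>delta \<circ> Xi\<close>.\<close>
  have D: "\<Xi>D x = delta (Xi x)" if "x \<in> U.diag" for x
    using inv_diag_ident[of "Xi x"] Xi_diag_image that by (auto simp: \<Xi>D_def)
  have "\<Xi>D \<in> alg_iso (par_diag FG RR) FA"
  proof (rule alg_iso_cong[OF ralg_PD])
    show "delta \<circ> Xi \<in> alg_iso (par_diag FG RR) FA"
      using Xi_diag_iso delta_iso alg_hom_comp bij_betw_trans unfolding alg_iso_def' by blast
  qed (use D in \<open>simp add: PD_eq\<close>)
  moreover have "\<Xi>D x \<in> tau_dom X (inv\<^bsub>FG\<^esub> g) \<and> \<Xi>D (theta FG RR g x) = tau X g (\<Xi>D x)"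
    if gF: "g \<in> carrier FG" and x: "x \<in> carrier (idem_ideal (par_diag FG RR) (par_eps FG RR (inv\<^bsub>FG\<^esub> g)))" for g x
  proof -
    have g: "reduced g" using gF by simp
    have xc: "x \<in> carrier (U.corner (winv g))"
      using x g by (simp add: U.corner_def PD_eq par_eps_e)
    have th: "theta FG RR g x = pe g \<otimes>\<^bsub>PA\<^esub> x \<otimes>\<^bsub>PA\<^esub> pe (winv g)"
      using theta_eq[OF FGRR gF x] g by simp
    have xd: "x \<in> U.diag" using xc U.carrier_corner[of "winv g"] g by simp
    have zd: "pe g \<otimes>\<^bsub>PA\<^esub> x \<otimes>\<^bsub>PA\<^esub> pe (winv g) \<in> U.diag"
      using U.corner_conj(1)[of g x] xc U.carrier_corner[of g] g by simp
    show ?thesis using equivariance[OF g xc] g by (simp add: D[OF xd] th D[OF zd])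
  qed
  ultimately show ?thesis
    unfolding F_def \<R>_def Let_def \<Xi>D_def[symmetric]
    by (intro bexI[OF _ Xi_iso] conjI ballI)
      (use Xi_diag_iso in \<open>simp_all add: Xi_pe spi_eq_wprod \<Xi>D_def[symmetric]\<close>)
qed

end
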